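(* Let $f:\mathbb{R}^n\to\mathbb{R}$ be $L$-smooth and $\mu$-strongly convex ($\mu>0$), let $g$ be convex, proper and lower semicontinuous on $\mathbb{R}^n$, and let $x^\star$ be the unique minimizer of $f+g$. Consider the ARPSD algorithm with $\gamma\in(0,2/(\mu+L)]$ under the following randomness assumption: for all $k>0$, $\mathfrak{S}^k$ is $\mathcal{F}^k$-measurable and admissible; if $k\notin\mathsf{L}$, the selections are independent and identically distributed on $[k_\ell,k]$; and the decision to adapt or not at time $k$ is $\mathcal{F}^k$-measurable, i.e. $(k_\ell)_\ell$ is a sequence of $\mathcal{F}^k$-stopping times. Suppose the adaptation strategy is chosen so that: (i) the adaptation cost is upper bounded by a deterministic sequence: $\|\mathsf{Q}_\ell\mathsf{Q}_{\ell-1}^{-1}\|_2^2\le\mathbf{a}_\ell$; (ii) the inter-adaptation time is lower bounded by a deterministic sequence: $k_\ell-k_{\ell-1}\ge\mathbf{c}_\ell$; (iii) the selection uniformity is lower bounded by a deterministic sequence: $\lambda_{\min}(\mathsf{P}_{\ell-1})\ge\lambda_{\ell-1}$. Set $1-\alpha_{\ell-1}:=1-2\gamma\mu L\lambda_{\ell-1}/(\mu+L)$ and define the corrected rate for cycle $\ell$ by $$(1-\beta_\ell):=(1-\alpha_{\ell-1})\,\mathbf{a}_\ell^{1/\mathbf{c}_\ell}.$$ Then for any $k\in[k_\ell,k_{\ell+1})$, $$\mathbb{E}\left[\|x^{k+1}-x^\star\|_2^2\right]\le(1-\alpha_\ell)^{k-k_\ell}\prod_{m=1}^\ell(1-\beta_m)^{\mathbf{c}_m}\,\|z^0-\mathsf{Q}_0(x^\star-\gamma\nabla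 f(x^\star))\|_2^2.$$
   Context: A family $\mathcal{C}=\{\mathcal{C}_i\}_i$ of linear subspaces of $\mathbb{R}^n$ is covering if $\sum_i\mathcal{C}_i=\mathbb{R}^n$. A selection $\mathfrak{S}$ from a covering family $\mathcal{C}$ is a random subspace: a random subset $\omega=\{\mathcal{C}_{i_1},\ldots,\mathcal{C}_{i_s}\}$ of $\mathcal{C}$ is drawn and $\mathfrak{S}(\omega)=\sum_{j=1}^s\mathcal{C}_{i_j}$. It is admissible if $\mathbb{P}[x\in\mathfrak{S}^\perp]<1$ for all $x\in\mathbb{R}^n\setminus\{0\}$. $P_F$ denotes the orthogonal projection matrix onto the subspace $F$. The average projection matrix of an admissible selection, $\mathbb{E}[P_{\mathfrak{S}}]$, is positive definite. $\mathbf{prox}_{\gamma g}(x)=\mathrm{argmin}_{y\in\mathbb{R}^n}\{g(y)+\frac{1}{2\gamma}\|y-x\|_2^2\}$. "$L$-smooth" means differentiable with $L$-Lipschitz gradient. $\|\cdot\|_2$ is the Euclidean norm of vectors and the spectral norm of matrices. ARPSD algorithm (Adaptive Randomized Proximal Subspace Descent) with stepsize $\gamma$: start from a (deterministic) $z^0\in\mathbb{R}^n$, an initial admissible selection with average projection $\mathsf{P}_0$ and $\mathsf{Q}_0=\mathsf{P}_0^{-1/2}$, $x^1=\mathbf{prox}_{\gamma g}(\mathsf{Q}_0^{-1}z^0)$, $\ell=0$, $\mathsf{L}=\{0\}$. For $k=1,2,\ldots$: $$y^k=\mathsf{Q}_\ell(x^k-\gamma\nabla f(x^k)),\qquad z^k=P_{\mathfrak{S}^k}(y^k)+(I-P_{\mathfrak{S}^k})(z^{k-1}),\qquad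 x^{k+1}=\mathbf{prox}_{\gamma g}(\mathsf{Q}_\ell^{-1}(z^k));$$ then, if an adaptation is decided: $\mathsf{L}\leftarrow\mathsf{L}\cup\{k+1\}$, $\ell\leftarrow\ell+1$; a new admissible selection is generated, with average projection $\mathsf{P}_\ell$ (the expected projection matrix under the selection law used during cycle $\ell$, given the past); $\mathsf{Q}_\ell=\mathsf{P}_\ell^{-1/2}$ and $\mathsf{Q}_\ell^{-1}$ are computed; and $z^k$ is rescaled: $z^k\leftarrow\mathsf{Q}_\ell\mathsf{Q}_{\ell-1}^{-1}z^k$. $\mathsf{L}$ is the set of adaptation times; its elements are listed increasingly as $k_0=0$ and $k_\ell=\min\{k>k_{\ell-1}:k\in\mathsf{L}\}$. $\mathcal{F}^k$ is the sigma-algebra generated by the selections $\mathfrak{S}^j$, $j\le k$.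
   Formalization: As cycle 0 has only k_1−1 iterations, the literal bound can fail; it is assumed in addition that k_1−1 ≥ c_1 almost surely whenever λ_ℓ < λ_0. With random k_ℓ, expectations are over the event that k lies in cycle ℓ; also c_ℓ > 0 and λ_ℓ ≥ 0. *)

theory Defs
  imports "HOL-Probability.Probability"
begin

section \<open>Functions on Euclidean space\<close>

definition gradient :: "('a::real_inner \<Rightarrow> real) \<Rightarrow> 'a \<Rightarrow> 'a" where
  "gradient f x = (THE d. GDERIV f x :> d)"

definition smooth_fun :: "real \<Rightarrow> ('a::real_inner \<Rightarrow> real) \<Rightarrow> bool" where
  "smooth_fun L f \<longleftrightarrow> (\<forall>x. f differentiable (at x)) \<and> L-lipschitz_on UNIV (gradient f)"

definition strongly_convex :: "real \<Rightarrow> ('a::real_inner \<Rightarrow> real) \<Rightarrow> bool" where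
  "strongly_convex \<mu> f \<longleftrightarrow> convex_on UNIV (\<lambda>x. f x - \<mu> / 2 * (norm x)\<^sup>2)"

definition proper_fun :: "('a \<Rightarrow> ereal) \<Rightarrow> bool" where
  "proper_fun g \<longleftrightarrow> (\<forall>x. g x \<noteq> -\<infinity>) \<and> (\<exists>x. g x \<noteq> \<infinity>)"

text \<open>Only used for functions that never take the value \<open>-\<infinity>\<close>, so that the right-hand side
  never has the form \<open>\<infinity> - \<infinity>\<close>.\<close>

definition convex_ereal :: "('a::real_vector \<Rightarrow> ereal) \<Rightarrow> bool" where
  "convex_ereal g \<longleftrightarrow>
     (\<forall>x y t. 0 < t \<and> t < 1 \<longrightarrow>
        g ((1 - t) *\<^sub>R x + t *\<^sub>R y) \<le> ereal (1 - t) * g x + ereal t * g y)"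

definition lower_semicontinuous :: "('a::topological_space \<Rightarrow> ereal) \<Rightarrow> bool" where
  "lower_semicontinuous g \<longleftrightarrow> (\<forall>x. g x \<le> Liminf (at x) g)"

definition prox :: "real \<Rightarrow> ('a::real_normed_vector \<Rightarrow> ereal) \<Rightarrow> 'a \<Rightarrow> 'a" where
  "prox \<gamma> g x = arg_min (\<lambda>y. g y + ereal (1 / (2 * \<gamma>) * (norm (y - x))\<^sup>2)) (\<lambda>_. True)"

section \<open>Matrices\<close>

definition psd_matrix :: "real^'n^'n \<Rightarrow> bool" where
  "psd_matrix A \<longleftrightarrow> transpose A = A \<and> (\<forall>x. 0 \<le> x \<bullet> (A *v x))"

definition matrix_sqrt :: "real^'n^'n \<Rightarrow> real^'n^'n" where
  "matrix_sqrt A = (THE B. psd_matrix B \<and> B ** B = A)"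

definition inv_sqrt :: "real^'n^'n \<Rightarrow> real^'n^'n" where
  "inv_sqrt A = matrix_inv (matrix_sqrt A)"

definition lambda_min :: "real^'n^'n \<Rightarrow> real" where
  "lambda_min A = Min {c. \<exists>v. v \<noteq> 0 \<and> A *v v = c *\<^sub>R v}"

definition spectral_norm :: "real^'n^'n \<Rightarrow> real" where
  "spectral_norm A = onorm (\<lambda>x. A *v x)"

definition proj_mat :: "(real^'n) set \<Rightarrow> real^'n^'n" where
  "proj_mat V = matrix (closest_point V)"

section \<open>Random subspaces\<close>

definition subspace_sum :: "('i \<Rightarrow> (real^'n) set) \<Rightarrow> 'i set \<Rightarrow> (real^'n) set" where
  "subspace_sum C I = span (\<Union>i\<in>I. C i)"

definition covering_family :: "'i set \<Rightarrow> ('i \<Rightarrow> (real^'n) set) \<Rightarrow> bool" where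
  "covering_family I C \<longleftrightarrow> (\<forall>i\<in>I. subspace (C i)) \<and> subspace_sum C I = UNIV"

text \<open>The measurable space of linear subspaces: a subspace is identified with its orthogonal
  projection matrix, and carries the Borel structure of matrices.\<close>

definition subspace_algebra :: "(real^'n) set measure" where
  "subspace_algebra = vimage_algebra {V. subspace V} proj_mat borel"

text \<open>In the next two definitions \<open>\<nu>\<close> is the law of a random subspace, i.e. a probability
  measure on \<^const>\<open>subspace_algebra\<close>.\<close>

definition admissible :: "(real^'n) set measure \<Rightarrow> bool" where
  "admissible \<nu> \<longleftrightarrow> (\<forall>x. x \<noteq> 0 \<longrightarrow> measure \<nu> {V \<in> space \<nu>. x \<in> V\<^sup>\<bottom>} < 1)"

definition avg_proj :: "(real^'n) set measure \<Rightarrow> real^'n^'n" where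
  "avg_proj \<nu> = (\<integral>V. proj_mat V \<partial>\<nu>)"

text \<open>The sigma-algebra generated by \<open>S 1, \<dots>, S k\<close>; it is trivial for \<open>k = 0\<close>.\<close>

definition selection_filtration ::
    "'w measure \<Rightarrow> (nat \<Rightarrow> 'w \<Rightarrow> (real^'n) set) \<Rightarrow> nat \<Rightarrow> 'w measure" where
  "selection_filtration M S k =
     sigma (space M) (\<Union>j\<in>{1..k}. {S j -` B \<inter> space M | B. B \<in> sets subspace_algebra})"

section \<open>The algorithm\<close>

text \<open>One sample path. The inputs are the matrices \<open>Q l\<close>, the drawn subspaces \<open>S k\<close> and the
  decisions \<open>D k\<close> to adapt at the end of iteration \<open>k \<ge> 1\<close>. The state of index \<open>k\<close> is the
  triple \<open>(x\<^sup>k\<^sup>+\<^sup>1, z\<^sup>k, l)\<close> at the end of iteration \<open>k\<close>, with \<open>z\<^sup>k\<close> already rescaled if an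
  adaptation took place; index \<open>0\<close> is the initialization.\<close>

primrec arpsd ::
    "(real^'n \<Rightarrow> real) \<Rightarrow> (real^'n \<Rightarrow> ereal) \<Rightarrow> real \<Rightarrow> real^'n \<Rightarrow> (nat \<Rightarrow> real^'n^'n)
      \<Rightarrow> (nat \<Rightarrow> (real^'n) set) \<Rightarrow> (nat \<Rightarrow> bool) \<Rightarrow> nat \<Rightarrow> (real^'n) \<times> (real^'n) \<times> nat" where
  "arpsd f g \<gamma> z0 Q S D 0 = (prox \<gamma> g (matrix_inv (Q 0) *v z0), z0, 0)"
| "arpsd f g \<gamma> z0 Q S D (Suc k) =
     (case arpsd f g \<gamma> z0 Q S D k of (x, z, l) \<Rightarrow>
        let P = proj_mat (S (Suc k));
            y = Q l *v (x - \<gamma> *\<^sub>R gradient f x);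
            z' = P *v y + (mat 1 - P) *v z;
            x' = prox \<gamma> g (matrix_inv (Q l) *v z')
        in if D (Suc k)
           then (x', (Q (Suc l) ** matrix_inv (Q l)) *v z', Suc l)
           else (x', z', l))"

text \<open>A decision to adapt at the end of iteration \<open>k\<close> is recorded as the time \<open>k + 1\<close>, the first
  iteration that uses the new selection. Since iterations start at \<open>1\<close> whereas the initial time
  is \<open>0\<close>, a cycle \<open>l \<ge> 1\<close> consists of as many iterations as the difference of the
  adaptation times delimiting it, but cycle \<open>0\<close> of one iteration less.\<close>

definition adapt_set :: "(nat \<Rightarrow> bool) \<Rightarrow> nat set" where
  "adapt_set D = insert 0 {Suc k | k. k \<ge> 1 \<and> D k}"

text \<open>The value is \<open>\<infinity>\<close> if there are fewer than \<open>l\<close> adaptations.\<close>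

primrec adapt_time :: "(nat \<Rightarrow> bool) \<Rightarrow> nat \<Rightarrow> enat" where
  "adapt_time D 0 = 0"
| "adapt_time D (Suc l) = Inf {enat k | k. k \<in> adapt_set D \<and> adapt_time D l < enat k}"

end

theory Submission
  imports Defs
begin

text \<open>
  Consider one iteration in a cycle with average projection \<open>P\<close> and \<open>Q = P\<^sup>-\<^sup>1\<^sup>/\<^sup>2\<close>. Put
  \<open>u\<^sup>* = x\<^sup>* - \<gamma> \<nabla>f x\<^sup>*\<close> and \<open>z\<^sup>* = Q u\<^sup>*\<close>. Optimality says \<open>x\<^sup>* = prox u\<^sup>*\<close>, and the iterate is
  \<open>x = prox (Q\<^sup>-\<^sup>1 z)\<close>, so nonexpansiveness of \<open>prox\<close> bounds the squared error of \<open>x\<close> by the form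
  \<open>e \<bullet> P e\<close> of the error \<open>e = z - z\<^sup>*\<close>. The new \<open>z\<close> mixes \<open>y\<close> and the old \<open>z\<close> by a random orthogonal
  projection with mean \<open>P\<close>, so its expected squared error is the form of \<open>P\<close> at \<open>y - z\<^sup>*\<close> plus the form of
  \<open>1 - P\<close> at \<open>e\<close>. The choice of \<open>Q\<close> makes the first of these the squared distance of two gradient steps,
  which is at most \<open>\<kappa> = 1 - 2 \<gamma> \<mu> L / (\<mu> + L)\<close> times the squared error of \<open>x\<close>. Altogether the
  squared error of \<open>z\<close> decreases by at least \<open>(1 - \<kappa>) e \<bullet> P e\<close>, and the bound on the smallest
  eigenvalue of \<open>P\<close> turns this into the factor \<open>1 - \<alpha>\<close> of the cycle (lemma \<open>expected_error_le\<close>). An adaptation rescales \<open>z\<close> and \<open>z\<^sup>*\<close> by the same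
  matrix and costs at most the factor \<open>a\<close> of the new cycle (lemma \<open>iteration_transition\<close>).

  It remains to accumulate these factors over cycles whose lengths are random and depend on the past. A
  deterministic value function, depending on the cycle and on the time elapsed in it, bounds how much a
  unit of error can still contribute to the quantity to be estimated, whatever the adaptation decisions
  are: an iteration beyond the guaranteed length of a cycle only contracts further, so the worst
  case is to adapt as early as allowed. The value function times the squared error decreases in
  expectation (lemmas \<open>sum_rewards_le\<close> and \<open>target_cycle_bound\<close>), and the two parts of the theorem
  are two choices of what is paid in the last cycle. In extended nonnegative reals this also
  covers the rate \<open>0\<close>.

  For the expectations to make sense, \<open>Q\<close> must be a measurable function of the law. The square root is the
  limit of a polynomial iteration (lemma \<open>sqrt_iter_converges\<close>), and the inverse is rational. The
  conditional expectation over the next selection is computed with the joint law of the past and the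
  selection (lemma \<open>nn_integral_conditional_law\<close>). Finally, proximal points exist because
  optimality of \<open>x\<^sup>*\<close> already yields an affine minorant of \<open>g\<close>
  (lemmas \<open>prox_gradient_fixed_point\<close> and \<open>prox_subgradient\<close>).
\<close>

section \<open>Smooth and strongly convex functions\<close>

lemma le_of_forall_small_quadratic:
  fixes A B c :: real
  assumes "\<And>t. 0 < t \<Longrightarrow> t < 1 \<Longrightarrow> A * t - c * t\<^sup>2 \<le> B * t"
  shows "A \<le> B"
proof (rule tendsto_lowerbound)
  show "((\<lambda>t. B + c * t) \<longlongrightarrow> B) (at_right 0)"
    by (rule tendsto_eq_intros refl | simp)+
  have "eventually (\<lambda>t::real. t \<in> {0<..<1}) (at_right 0)"
    by (rule eventually_at_right_real) simp
  then show "eventually (\<lambda>t. A \<le> B + c * t) (at_right 0)"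
  proof eventually_elim
    case (elim t)
    then have "A * t \<le> (B + c * t) * t"
      using assms[of t] by (simp add: algebra_simps power2_eq_square)
    then show ?case using elim by simp
  qed
qed simp

lemma GDERIV_unique:
  fixes f :: "'a::real_inner \<Rightarrow> real"
  assumes "GDERIV f x :> d" "GDERIV f x :> e"
  shows "d = e"
proof -
  have "(\<lambda>h. h \<bullet> d) = (\<lambda>h. h \<bullet> e)"
    using assms unfolding gderiv_def by (rule has_derivative_unique)
  then have "(d - e) \<bullet> d = (d - e) \<bullet> e" by meson
  then have "(d - e) \<bullet> (d - e) = 0" by (simp add: inner_diff_right)
  then show ?thesis by simp
qed

lemma GDERIV_gradient:
  fixes f :: "'a::euclidean_space \<Rightarrow> real"
  assumes "f differentiable (at x)"
  shows "GDERIV f x :> gradient f x"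
proof -
  obtain f' where f': "(f has_derivative f') (at x)"
    using assms unfolding differentiable_def by blast
  then interpret f': bounded_linear f' by (rule has_derivative_bounded_linear)
  have "GDERIV f x :> adjoint f' 1"
    unfolding gderiv_def
    using f' adjoint_works[OF f'.linear_axioms, of _ 1] by (simp add: inner_commute)
  then have "\<exists>!d. GDERIV f x :> d" using GDERIV_unique by blast
  then show ?thesis unfolding gradient_def by (rule theI')
qed

text \<open>The descent lemma: along the segment from \<open>x\<close> to \<open>y\<close>, the derivative of \<open>f\<close> minus its
  linearization grows at most linearly with slope \<open>L\<close> times the squared length, so the difference
  of \<open>\<plusminus>f\<close> and the quadratic is monotone.\<close>

lemma smooth_quadratic_bound:
  fixes f :: "'a::euclidean_space \<Rightarrow> real"
  assumes "smooth_fun L f"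
  shows "\<bar>f y - f x - gradient f x \<bullet> (y - x)\<bar> \<le> L / 2 * (norm (y - x))\<^sup>2"
proof -
  define v where "v = y - x"
  have grad: "GDERIV f p :> gradient f p" for p
    using assms unfolding smooth_fun_def by (intro GDERIV_gradient) auto
  have line: "((\<lambda>t. f (x + t *\<^sub>R v)) has_real_derivative gradient f (x + t *\<^sub>R v) \<bullet> v) (at t)" for t
  proof -
    have "((\<lambda>t. x + t *\<^sub>R v) has_derivative (\<lambda>h. h *\<^sub>R v)) (at t)"
      by (auto intro!: derivative_eq_intros)
    from has_derivative_compose[OF this grad[unfolded gderiv_def]]
    show ?thesis by (simp add: has_field_derivative_def inner_commute mult_commute_abs)
  qed
  have lip: "\<bar>(gradient f (x + t *\<^sub>R v) - gradient f x) \<bullet> v\<bar> \<le> L * t * (norm v)\<^sup>2" if "0 \<le> t" for t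
  proof -
    have "dist (gradient f (x + t *\<^sub>R v)) (gradient f x) \<le> L * dist (x + t *\<^sub>R v) x"
      using assms unfolding smooth_fun_def lipschitz_on_def by blast
    then have "norm (gradient f (x + t *\<^sub>R v) - gradient f x) \<le> L * (t * norm v)"
      using that by (simp add: dist_norm)
    then have "norm (gradient f (x + t *\<^sub>R v) - gradient f x) * norm v \<le> L * (t * norm v) * norm v"
      by (rule mult_right_mono) simp
    with Cauchy_Schwarz_ineq2[of "gradient f (x + t *\<^sub>R v) - gradient f x" v]
    show ?thesis by (simp add: power2_eq_square algebra_simps)
  qed
  have side: "s * (f y - f x - gradient f x \<bullet> v) \<le> L / 2 * (norm v)\<^sup>2" if s: "s = 1 \<or> s = -1" for s
  proof -
    let ?\<phi> = "\<lambda>t. s * (f (x + t *\<^sub>R v) - f x - t * (gradient f x \<bullet> v)) - L / 2 * t\<^sup>2 * (norm v)\<^sup>2"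
    have "?\<phi> 1 \<le> ?\<phi> 0"
    proof (rule DERIV_nonpos_imp_nonincreasing[where f = ?\<phi>])
      fix t :: real assume "0 \<le> t" "t \<le> 1"
      have "(?\<phi> has_real_derivative
          s * ((gradient f (x + t *\<^sub>R v) - gradient f x) \<bullet> v) - L * t * (norm v)\<^sup>2) (at t)"
        by (rule derivative_eq_intros line refl | simp add: inner_diff_left algebra_simps)+
      moreover have "s * ((gradient f (x + t *\<^sub>R v) - gradient f x) \<bullet> v) - L * t * (norm v)\<^sup>2 \<le> 0"
        using lip[OF \<open>0 \<le> t\<close>] s by auto
      ultimately show "\<exists>d. (?\<phi> has_real_derivative d) (at t) \<and> d \<le> 0" by blast
    qed simp
    then show ?thesis by (simp add: v_def)
  qed
  show ?thesis using side[of 1, simplified] side[of "-1", simplified] unfolding v_def by linarith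
qed

text \<open>Convexity of \<open>f - \<mu>/2 norm\<^sup>2\<close> on the segment, divided by the step length \<open>t\<close>; smoothness serves
  only to replace \<open>f (x + t v)\<close> by its linearization up to a term of order \<open>t\<^sup>2\<close>.\<close>

lemma strongly_convex_gradient_ineq:
  fixes f :: "'a::euclidean_space \<Rightarrow> real"
  assumes "smooth_fun L f" "strongly_convex \<mu> f"
  shows "f x + gradient f x \<bullet> (y - x) + \<mu> / 2 * (norm (y - x))\<^sup>2 \<le> f y"
proof -
  define v where "v = y - x"
  have "gradient f x \<bullet> v + \<mu> / 2 * (norm v)\<^sup>2 \<le> f y - f x"
  proof (rule le_of_forall_small_quadratic)
    fix t :: real assume t: "0 < t" "t < 1"
    have y: "(1 - t) *\<^sub>R x + t *\<^sub>R y = x + t *\<^sub>R v" by (simp add: v_def algebra_simps)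
    have "f (x + t *\<^sub>R v) - \<mu> / 2 * (norm (x + t *\<^sub>R v))\<^sup>2
        \<le> (1 - t) * (f x - \<mu> / 2 * (norm x)\<^sup>2) + t * (f y - \<mu> / 2 * (norm y)\<^sup>2)"
      using assms(2) t unfolding strongly_convex_def y[symmetric]
      by (intro convex_onD[where A = UNIV]) auto
    moreover have "(norm (x + t *\<^sub>R v))\<^sup>2
        = (1 - t) * (norm x)\<^sup>2 + t * (norm y)\<^sup>2 - t * (1 - t) * (norm v)\<^sup>2"
      unfolding v_def by (simp add: power2_norm_eq_inner inner_simps inner_commute algebra_simps)
    ultimately have convex: "f (x + t *\<^sub>R v) + \<mu> / 2 * (t * (1 - t) * (norm v)\<^sup>2) \<le> (1 - t) * f x + t * f y"
      by (simp add: field_simps)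
    have "\<bar>f (x + t *\<^sub>R v) - f x - t * (gradient f x \<bullet> v)\<bar> \<le> L / 2 * (t\<^sup>2 * (norm v)\<^sup>2)"
      using smooth_quadratic_bound[OF assms(1), of "x + t *\<^sub>R v" x] t
      by (simp add: power_mult_distrib)
    then have "f x + t * (gradient f x \<bullet> v) - L / 2 * (t\<^sup>2 * (norm v)\<^sup>2) \<le> f (x + t *\<^sub>R v)"
      by linarith
    with convex show "(gradient f x \<bullet> v + \<mu> / 2 * (norm v)\<^sup>2) * t
        - (L / 2 + \<mu> / 2) * (norm v)\<^sup>2 * t\<^sup>2 \<le> (f y - f x) * t"
      by (simp add: field_simps power2_eq_square)
  qed
  then show ?thesis by (simp add: v_def)
qed

lemma smooth_strongly_convex_const:
  fixes f :: "'a::euclidean_space \<Rightarrow> real"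
  assumes "smooth_fun L f" "strongly_convex \<mu> f"
  shows "\<mu> \<le> L"
proof -
  obtain b :: 'a where b: "b \<in> Basis" using nonempty_Basis by blast
  have "\<mu> / 2 * (norm (b - 0))\<^sup>2 \<le> L / 2 * (norm (b - 0))\<^sup>2"
    using smooth_quadratic_bound[OF assms(1), of b 0] strongly_convex_gradient_ineq[OF assms, of 0 b]
    by linarith
  moreover have "norm b = 1" using b by simp
  ultimately show ?thesis by simp
qed

text \<open>Applied to the convex function \<open>h = f - \<mu>/2 norm\<^sup>2\<close> with gradient \<open>G\<close>, the lower bound at \<open>x\<close> and the
  quadratic upper bound at \<open>y\<close> are compared at a gradient step away from \<open>y\<close>; symmetrizing in \<open>x\<close>
  and \<open>y\<close> makes \<open>G\<close> cocoercive with constant \<open>1 / (L - \<mu>)\<close>. The inequality below is this fact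
  written in terms of \<open>f\<close>, where no division by \<open>L - \<mu>\<close> remains.\<close>

lemma gradient_strong_cocoercive:
  fixes f :: "'a::euclidean_space \<Rightarrow> real"
  assumes "smooth_fun L f" "strongly_convex \<mu> f"
  shows "(norm (gradient f x - gradient f y))\<^sup>2 + \<mu> * L * (norm (x - y))\<^sup>2
           \<le> (\<mu> + L) * ((gradient f x - gradient f y) \<bullet> (x - y))"
proof -
  define h where "h p = f p - \<mu> / 2 * (norm p)\<^sup>2" for p
  define G where "G p = gradient f p - \<mu> *\<^sub>R p" for p
  have sq: "(norm q)\<^sup>2 = (norm p)\<^sup>2 + 2 * (p \<bullet> (q - p)) + (norm (q - p))\<^sup>2" for p q :: 'a
    by (simp add: power2_norm_eq_inner inner_simps inner_commute)
  have \<mu>sq: "\<mu> / 2 * (norm q)\<^sup>2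
      = \<mu> / 2 * (norm p)\<^sup>2 + \<mu> * (p \<bullet> (q - p)) + \<mu> / 2 * (norm (q - p))\<^sup>2" for p q :: 'a
    unfolding sq[of q p] by (simp add: algebra_simps)
  have lower: "h p + G p \<bullet> (q - p) \<le> h q" for p q
    using strongly_convex_gradient_ineq[OF assms, of p q] \<mu>sq[of q p]
    unfolding h_def G_def inner_diff_left inner_scaleR_left by linarith
  have upper: "h q \<le> h p + G p \<bullet> (q - p) + (L - \<mu>) / 2 * (norm (q - p))\<^sup>2" for p q
    using smooth_quadratic_bound[OF assms(1), of q p] \<mu>sq[of q p]
    unfolding h_def G_def inner_diff_left inner_scaleR_left diff_divide_distrib left_diff_distrib by linarith
  have half: "t * (norm (G x - G y))\<^sup>2 - (L - \<mu>) / 2 * t\<^sup>2 * (norm (G x - G y))\<^sup>2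
      \<le> h y - h x - G x \<bullet> (y - x)" for t x y
  proof -
    \<comment> \<open>a gradient step from \<open>y\<close> on the convex function \<open>h - G x \<bullet> _\<close>, which is minimal at \<open>x\<close>\<close>
    define z where "z = y - t *\<^sub>R (G y - G x)"
    have "h x + G x \<bullet> (z - x) \<le> h y + G y \<bullet> (z - y) + (L - \<mu>) / 2 * (norm (z - y))\<^sup>2"
      using lower[of x z] upper[of z y] by linarith
    moreover have "(norm (z - y))\<^sup>2 = t\<^sup>2 * (norm (G x - G y))\<^sup>2"
      by (simp add: z_def power_mult_distrib norm_minus_commute)
    moreover have "G y \<bullet> (z - y) - G x \<bullet> (z - x) = - t * (norm (G x - G y))\<^sup>2 - G x \<bullet> (y - x)"
      by (simp add: z_def power2_norm_eq_inner inner_simps inner_commute algebra_simps)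
    ultimately show ?thesis by (simp add: algebra_simps)
  qed
  have both: "(2 * t - (L - \<mu>) * t\<^sup>2) * (norm (G x - G y))\<^sup>2 \<le> (G x - G y) \<bullet> (x - y)" for t
    using half[of t x y] half[of t y x] norm_minus_commute[of "G x" "G y"]
    by (simp add: inner_simps inner_commute field_simps)
  have "\<mu> \<le> L" using assms by (rule smooth_strongly_convex_const)
  have "(norm (G x - G y))\<^sup>2 \<le> (L - \<mu>) * ((G x - G y) \<bullet> (x - y))"
  proof (cases "L = \<mu>")
    case True
    have "(norm (G x - G y))\<^sup>2 = 0"
    proof (rule ccontr)
      assume "(norm (G x - G y))\<^sup>2 \<noteq> 0"
      then show False
        using both[of "((G x - G y) \<bullet> (x - y) + 1) / (2 * (norm (G x - G y))\<^sup>2)"] True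
        by simp
    qed
    then show ?thesis using True by simp
  next
    case False
    with \<open>\<mu> \<le> L\<close> have pos: "0 < L - \<mu>" by simp
    then have "2 * (1 / (L - \<mu>)) - (L - \<mu>) * (1 / (L - \<mu>))\<^sup>2 = 1 / (L - \<mu>)"
      by (simp add: power2_eq_square)
    then have "1 / (L - \<mu>) * (norm (G x - G y))\<^sup>2 \<le> (G x - G y) \<bullet> (x - y)"
      using both[of "1 / (L - \<mu>)"] by simp
    then show ?thesis using pos by (simp add: pos_divide_le_eq mult.commute)
  qed
  moreover have "G x - G y = (gradient f x - gradient f y) - \<mu> *\<^sub>R (x - y)"
    by (simp add: G_def algebra_simps)
  ultimately show ?thesis
    by (simp add: power2_norm_eq_inner inner_simps inner_commute algebra_simps)
qed

text \<open>Expanding the square leaves \<open>\<gamma> (\<gamma> - 2 / (\<mu> + L))\<close> as the coefficient of the squared gradient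
  difference, which is where the bound on the step size enters.\<close>

lemma gradient_step_contraction:
  fixes f :: "'a::euclidean_space \<Rightarrow> real"
  assumes "smooth_fun L f" "strongly_convex \<mu> f" "0 < \<mu>" "0 < \<gamma>" "\<gamma> \<le> 2 / (\<mu> + L)"
  shows "(norm ((x - \<gamma> *\<^sub>R gradient f x) - (y - \<gamma> *\<^sub>R gradient f y)))\<^sup>2
           \<le> (1 - 2 * \<gamma> * \<mu> * L / (\<mu> + L)) * (norm (x - y))\<^sup>2"
proof -
  define d where "d = gradient f x - gradient f y"
  define v where "v = x - y"
  have L: "\<mu> \<le> L" using assms(1,2) by (rule smooth_strongly_convex_const)
  have "(norm d)\<^sup>2 + \<mu> * L * (norm v)\<^sup>2 \<le> (\<mu> + L) * (d \<bullet> v)"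
    unfolding d_def v_def using gradient_strong_cocoercive[OF assms(1,2)] .
  then have "((norm d)\<^sup>2 + \<mu> * L * (norm v)\<^sup>2) / (\<mu> + L) \<le> d \<bullet> v"
    using L assms(3) by (simp add: field_simps)
  then have "2 * \<gamma> * (((norm d)\<^sup>2 + \<mu> * L * (norm v)\<^sup>2) / (\<mu> + L)) \<le> 2 * \<gamma> * (d \<bullet> v)"
    using assms(4) by (intro mult_left_mono) auto
  moreover have "\<gamma> * \<gamma> * (norm d)\<^sup>2 \<le> \<gamma> * (2 / (\<mu> + L)) * (norm d)\<^sup>2"
    using assms(4,5) by (intro mult_right_mono mult_left_mono) auto
  moreover have "(norm (v - \<gamma> *\<^sub>R d))\<^sup>2 = (norm v)\<^sup>2 - 2 * \<gamma> * (d \<bullet> v) + \<gamma> * \<gamma> * (norm d)\<^sup>2"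
    by (simp add: power2_norm_eq_inner inner_simps inner_commute algebra_simps)
  ultimately have "(norm (v - \<gamma> *\<^sub>R d))\<^sup>2 \<le> (1 - 2 * \<gamma> * \<mu> * L / (\<mu> + L)) * (norm v)\<^sup>2"
    by (simp add: algebra_simps add_divide_distrib)
  moreover have "(x - \<gamma> *\<^sub>R gradient f x) - (y - \<gamma> *\<^sub>R gradient f y) = v - \<gamma> *\<^sub>R d"
    by (simp add: v_def d_def algebra_simps)
  ultimately show ?thesis by (simp only: v_def)
qed

text \<open>By the inequality of arithmetic and geometric means, \<open>4 \<mu> L \<le> (\<mu> + L)\<^sup>2\<close>.\<close>

lemma gradient_step_factor:
  fixes \<mu> L \<gamma> :: real
  assumes "0 < \<mu>" "\<mu> \<le> L" "0 < \<gamma>" "\<gamma> \<le> 2 / (\<mu> + L)"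
  shows "0 \<le> 2 * \<gamma> * \<mu> * L / (\<mu> + L)" "2 * \<gamma> * \<mu> * L / (\<mu> + L) \<le> 1"
proof -
  show "0 \<le> 2 * \<gamma> * \<mu> * L / (\<mu> + L)" using assms by simp
  have "2 * \<gamma> * \<mu> * L / (\<mu> + L) = \<gamma> * (2 * (\<mu> * L) / (\<mu> + L))" by simp
  also have "\<dots> \<le> 2 / (\<mu> + L) * (2 * (\<mu> * L) / (\<mu> + L))"
    using assms by (intro mult_right_mono) auto
  also have "\<dots> \<le> 1"
  proof -
    have "4 * (\<mu> * L) \<le> (\<mu> + L) * (\<mu> + L)"
      using zero_le_power2[of "\<mu> - L"] by (simp add: power2_eq_square algebra_simps)
    then have "4 * (\<mu> * L) / ((\<mu> + L) * (\<mu> + L)) \<le> 1" using assms by (simp add: divide_le_eq_1)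
    then show ?thesis by simp
  qed
  finally show "2 * \<gamma> * \<mu> * L / (\<mu> + L) \<le> 1" .
qed

section \<open>The proximal operator\<close>

definition is_subgradient :: "('a::real_inner \<Rightarrow> ereal) \<Rightarrow> 'a \<Rightarrow> 'a \<Rightarrow> bool" where
  "is_subgradient g p d \<longleftrightarrow> \<bar>g p\<bar> \<noteq> \<infinity> \<and> (\<forall>y. g p + ereal (d \<bullet> (y - p)) \<le> g y)"

text \<open>If \<open>p\<close> minimizes \<open>h + g\<close>, then moving from \<open>p\<close> towards \<open>y\<close> by a small \<open>t\<close> changes \<open>g\<close> by at most
  \<open>t (g y - g p)\<close> and \<open>h\<close> by \<open>t d \<bullet> (y - p)\<close> up to \<open>t\<^sup>2\<close>. Subgradients of \<open>g\<close> arise in this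
  way twice, for \<open>h = f\<close> and for the quadratic in the proximal operator.\<close>

lemma minimizer_imp_subgradient:
  fixes g :: "'a::real_inner \<Rightarrow> ereal" and h :: "'a \<Rightarrow> real"
  assumes g: "convex_ereal g" "proper_fun g"
    and min: "\<And>y. ereal (h p) + g p \<le> ereal (h y) + g y"
    and upper: "\<And>y. h y \<le> h p + d \<bullet> (y - p) + C * (norm (y - p))\<^sup>2"
  shows "is_subgradient g p (- d)"
proof -
  have not_minf: "g y \<noteq> - \<infinity>" for y using g(2) unfolding proper_fun_def by blast
  obtain q where "g q \<noteq> \<infinity>" using g(2) unfolding proper_fun_def by blast
  then have "ereal (h q) + g q < \<infinity>" by simp
  then have "g p \<noteq> \<infinity>" using min[of q] by auto
  then obtain r where r: "g p = ereal r" using not_minf[of p] by (cases "g p") auto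
  have "g p + ereal (- d \<bullet> (y - p)) \<le> g y" for y
  proof (cases "g y")
    case (real s)
    have "- d \<bullet> (y - p) \<le> s - r"
    proof (rule le_of_forall_small_quadratic)
      fix t :: real assume t: "0 < t" "t < 1"
      let ?y = "(1 - t) *\<^sub>R p + t *\<^sub>R y"
      have y: "?y - p = t *\<^sub>R (y - p)" by (simp add: algebra_simps)
      have "h ?y \<le> h p + t * (d \<bullet> (y - p)) + C * (t\<^sup>2 * (norm (y - p))\<^sup>2)"
        using upper[of ?y] unfolding y by (simp add: power_mult_distrib)
      note upper_t = this
      have "ereal (h p + r) \<le> ereal (h ?y) + g ?y" using min[of ?y] r by simp
      also have "\<dots> \<le> ereal (h ?y) + (ereal (1 - t) * g p + ereal t * g y)"
        using g(1) t unfolding convex_ereal_def by (intro add_left_mono) blast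
      also have "\<dots> = ereal (h ?y + (1 - t) * r + t * s)" using r real by simp
      finally have "h p + r \<le> h ?y + (1 - t) * r + t * s" by simp
      with upper_t show "(- d \<bullet> (y - p)) * t - C * (norm (y - p))\<^sup>2 * t\<^sup>2 \<le> (s - r) * t"
        unfolding inner_minus_left by argo
    qed
    then show ?thesis using r real by simp
  qed (use not_minf in auto)
  then show ?thesis unfolding is_subgradient_def using r by auto
qed

lemma subgradient_monotone:
  assumes "is_subgradient g p d" "is_subgradient g q e"
  shows "0 \<le> (d - e) \<bullet> (p - q)"
proof -
  obtain r s where rs: "g p = ereal r" "g q = ereal s"
    using assms unfolding is_subgradient_def by auto
  have "r + d \<bullet> (q - p) \<le> s" "s + e \<bullet> (p - q) \<le> r"
    using assms rs unfolding is_subgradient_def by (auto dest: spec[of _ q] spec[of _ p])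
  then show ?thesis by (simp add: inner_simps)
qed

lemma closed_sublevel_lsc:
  fixes g :: "'a::topological_space \<Rightarrow> ereal"
  assumes "lower_semicontinuous g"
  shows "closed {y. g y \<le> c}"
proof -
  have "open {y. c < g y}"
  proof (subst open_subopen, safe)
    fix x assume x: "c < g x"
    then have "c < Liminf (at x) g"
      using assms unfolding lower_semicontinuous_def by (blast intro: less_le_trans)
    then have "eventually (\<lambda>y. c < g y) (at x)" by (rule less_LiminfD)
    then obtain T where "open T" "x \<in> T" "\<forall>y\<in>T. y \<noteq> x \<longrightarrow> c < g y"
      unfolding eventually_at_topological by blast
    moreover from this x have "T \<subseteq> {y. c < g y}" by auto
    ultimately show "\<exists>T. open T \<and> x \<in> T \<and> T \<subseteq> {y. c < g y}" by blast
  qed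
  moreover have "{y. g y \<le> c} = - {y. c < g y}" by auto
  ultimately show ?thesis by (simp add: closed_def)
qed

text \<open>The sublevel sets of \<open>g + q\<close> are closed, and bounded because those of the minorant \<open>m\<close> are; so the
  sublevel sets just above the infimum form a decreasing sequence of nonempty compact sets.\<close>

lemma lsc_add_continuous_attains_min:
  fixes g :: "'a::heine_borel \<Rightarrow> ereal" and q :: "'a \<Rightarrow> real"
  assumes g: "lower_semicontinuous g" "proper_fun g"
    and q: "continuous_on UNIV q"
    and lower: "\<And>y. ereal (m y) \<le> g y + ereal (q y)"
    and bounded: "\<And>c. bounded {y. m y \<le> c}"
    and below: "\<And>y. b \<le> m y"
  obtains p where "\<And>y. g p + ereal (q p) \<le> g y + ereal (q y)"
proof -
  define H where "H y = g y + ereal (q y)" for y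
  have closed: "closed {y. H y \<le> ereal c}" for c
    unfolding closed_sequential_limits
  proof (intro allI impI, elim conjE)
    fix s l assume s: "\<forall>n. s n \<in> {y. H y \<le> ereal c}" and lim: "s \<longlonglongrightarrow> l"
    have qs: "(\<lambda>n. q (s n)) \<longlonglongrightarrow> q l"
      using q lim by (rule continuous_on_tendsto_compose) auto
    have "g l + ereal (q l) \<le> ereal c"
    proof (rule ereal_le_epsilon2)
      fix e :: real assume "0 < e"
      then have "eventually (\<lambda>n. q l - e < q (s n)) sequentially"
        using qs by (intro order_tendstoD(1)) auto
      then have ev: "eventually (\<lambda>n. s n \<in> {y. g y \<le> ereal (c - q l + e)}) sequentially"
      proof eventually_elim
        case (elim n)
        have "g (s n) + ereal (q (s n)) \<le> ereal c" using s unfolding H_def by simp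
        then show ?case using elim by (cases "g (s n)") auto
      qed
      have "l \<in> {y. g y \<le> ereal (c - q l + e)}"
        by (rule Lim_in_closed_set[OF closed_sublevel_lsc[OF g(1)] ev _ lim]) simp
      then show "g l + ereal (q l) \<le> ereal c + ereal e" by (cases "g l") auto
    qed
    then show "l \<in> {y. H y \<le> ereal c}" by (simp add: H_def)
  qed
  obtain y0 where "g y0 \<noteq> \<infinity>" using g(2) unfolding proper_fun_def by blast
  moreover have "g y0 \<noteq> - \<infinity>" using g(2) unfolding proper_fun_def by blast
  ultimately obtain h0 where h0: "H y0 = ereal h0" unfolding H_def by (cases "g y0") auto
  have Hb: "ereal b \<le> H y" for y
    using order_trans[OF _ lower[of y], of "ereal b"] below[of y] unfolding H_def by simp
  define i where "i = (INF y. H y)"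
  have "ereal b \<le> i" unfolding i_def by (intro INF_greatest Hb)
  moreover have "i \<le> ereal h0" unfolding i_def h0[symmetric] by (intro INF_lower) simp
  ultimately obtain r where r: "i = ereal r" by (cases i) auto
  define K where "K n = {y. H y \<le> ereal (r + 1 / Suc n)}" for n
  have "(\<Inter>n. K n) \<noteq> {}"
  proof (rule compact_nest)
    fix n
    have "K n \<subseteq> {y. m y \<le> r + 1 / Suc n}"
    proof safe
      fix y assume "y \<in> K n"
      then have "ereal (m y) \<le> ereal (r + 1 / Suc n)"
        using order_trans[OF lower[of y], of "ereal (r + 1 / Suc n)"] unfolding K_def H_def by simp
      then show "m y \<le> r + 1 / Suc n" by simp
    qed
    then show "compact (K n)"
      using closed bounded bounded_subset unfolding K_def compact_eq_bounded_closed by blast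
    have "i < ereal (r + 1 / Suc n)" unfolding r by simp
    then obtain y where "H y < ereal (r + 1 / Suc n)"
      unfolding i_def by (auto simp: INF_less_iff)
    then show "K n \<noteq> {}" unfolding K_def by (auto intro: less_imp_le)
  next
    fix k n :: nat assume "k \<le> n"
    then have "1 / real (Suc n) \<le> 1 / real (Suc k)" by (simp add: frac_le)
    then have "ereal (r + 1 / Suc n) \<le> ereal (r + 1 / Suc k)" by simp
    then show "K n \<subseteq> K k" unfolding K_def by (blast intro: order_trans)
  qed
  then obtain p where p: "\<And>n. H p \<le> ereal (r + 1 / Suc n)" unfolding K_def by blast
  have "H p \<le> ereal r"
  proof (rule ereal_le_epsilon2)
    fix e :: real assume "0 < e"
    then obtain n where "1 / Suc n < e" using nat_approx_posE by metis
    then have "ereal (r + 1 / Suc n) \<le> ereal r + ereal e" by simp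
    with p[of n] show "H p \<le> ereal r + ereal e" by (rule order_trans)
  qed
  moreover have "ereal r \<le> H y" for y
    using INF_lower[of y UNIV H] unfolding i_def[symmetric] r by simp
  ultimately have "H p \<le> H y" for y by (rule order_trans)
  then show thesis using that unfolding H_def by blast
qed

text \<open>The subgradient \<open>d\<close> at \<open>q\<close> supplies an affine minorant of \<open>g\<close>. Adding the quadratic makes the minorant
  coercive, hence the minimization problem that defines the proximal point has a solution, and its
  optimality condition is the claim.\<close>

lemma prox_subgradient:
  fixes g :: "'a::euclidean_space \<Rightarrow> ereal"
  assumes g: "convex_ereal g" "proper_fun g" "lower_semicontinuous g"
    and sub: "is_subgradient g q d" and \<gamma>: "0 < \<gamma>"
  shows "is_subgradient g (prox \<gamma> g x) ((1 / \<gamma>) *\<^sub>R (x - prox \<gamma> g x))"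
proof -
  define h where "h y = 1 / (2 * \<gamma>) * (norm (y - x))\<^sup>2" for y
  obtain r where r: "g q = ereal r" using sub unfolding is_subgradient_def by auto
  have sub': "ereal (r + d \<bullet> (y - q)) \<le> g y" for y
    using sub r unfolding is_subgradient_def by simp
  \<comment> \<open>completing the square in the affine minorant plus the quadratic\<close>
  define z where "z = x - \<gamma> *\<^sub>R d"
  define b where "b = r + d \<bullet> (x - q) - \<gamma> / 2 * (norm d)\<^sup>2"
  have square: "r + d \<bullet> (y - q) + h y = b + 1 / (2 * \<gamma>) * (norm (y - z))\<^sup>2" for y
  proof -
    have "(norm (y - z))\<^sup>2 = (norm (y - x))\<^sup>2 + 2 * \<gamma> * (d \<bullet> (y - x)) + \<gamma> * \<gamma> * (norm d)\<^sup>2"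
      unfolding z_def by (simp add: power2_norm_eq_inner inner_simps inner_commute algebra_simps)
    then have "1 / (2 * \<gamma>) * (norm (y - z))\<^sup>2
        = 1 / (2 * \<gamma>) * (norm (y - x))\<^sup>2 + d \<bullet> (y - x) + \<gamma> / 2 * (norm d)\<^sup>2"
      using \<gamma> by (simp add: field_simps power2_eq_square)
    then show ?thesis by (simp add: h_def b_def inner_diff_right)
  qed
  obtain p where p: "\<And>y. g p + ereal (h p) \<le> g y + ereal (h y)"
  proof (rule lsc_add_continuous_attains_min[OF g(3,2)])
    show "continuous_on UNIV h" unfolding h_def by (intro continuous_intros)
    show "ereal (b + 1 / (2 * \<gamma>) * (norm (y - z))\<^sup>2) \<le> g y + ereal (h y)" for y
      using add_right_mono[OF sub'[of y], of "ereal (h y)"] by (simp only: square[symmetric] plus_ereal.simps)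
    show "b \<le> b + 1 / (2 * \<gamma>) * (norm (y - z))\<^sup>2" for y using \<gamma> by simp
    show "bounded {y. b + 1 / (2 * \<gamma>) * (norm (y - z))\<^sup>2 \<le> c}" for c
    proof (rule bounded_subset[OF bounded_cball], safe)
      fix y assume "b + 1 / (2 * \<gamma>) * (norm (y - z))\<^sup>2 \<le> c"
      then have "(norm (y - z))\<^sup>2 \<le> 2 * \<gamma> * (c - b)" using \<gamma> by (simp add: field_simps)
      then have "norm (y - z) \<le> sqrt (2 * \<gamma> * (c - b))" by (rule real_le_rsqrt)
      then show "y \<in> cball z (sqrt (2 * \<gamma> * (c - b)))"
        by (simp add: dist_norm norm_minus_commute)
    qed
  qed (use that in auto)
  have min: "ereal (h (prox \<gamma> g x)) + g (prox \<gamma> g x) \<le> ereal (h y) + g y" for y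
  proof -
    have "is_arg_min (\<lambda>y. g y + ereal (h y)) (\<lambda>_. True) p"
      using p unfolding is_arg_min_def by (simp add: not_less)
    then have "is_arg_min (\<lambda>y. g y + ereal (h y)) (\<lambda>_. True) (prox \<gamma> g x)"
      unfolding prox_def arg_min_def h_def by (rule someI)
    then show ?thesis unfolding is_arg_min_def by (simp add: not_less add.commute)
  qed
  have "is_subgradient g (prox \<gamma> g x) (- ((1 / \<gamma>) *\<^sub>R (prox \<gamma> g x - x)))"
  proof (rule minimizer_imp_subgradient[OF g(1,2) min])
    fix y
    let ?p = "prox \<gamma> g x"
    have "(norm (y - x))\<^sup>2 = (norm (?p - x))\<^sup>2 + 2 * ((?p - x) \<bullet> (y - ?p)) + (norm (y - ?p))\<^sup>2"
      by (simp add: power2_norm_eq_inner inner_simps inner_commute)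
    then show "h y \<le> h ?p + ((1 / \<gamma>) *\<^sub>R (?p - x)) \<bullet> (y - ?p) + 1 / (2 * \<gamma>) * (norm (y - ?p))\<^sup>2"
      using \<gamma> unfolding h_def inner_scaleR_left by (simp add: field_simps del: scaleR_diff_right)
  qed
  then show ?thesis by (simp add: scaleR_diff_right)
qed

text \<open>Both points carry subgradients that satisfy the same optimality condition, and monotonicity of the
  subdifferential leaves no room between them.\<close>

lemma prox_eqI:
  fixes g :: "'a::euclidean_space \<Rightarrow> ereal"
  assumes g: "convex_ereal g" "proper_fun g" "lower_semicontinuous g"
    and sub: "is_subgradient g q d" and \<gamma>: "0 < \<gamma>"
  shows "prox \<gamma> g (q + \<gamma> *\<^sub>R d) = q"
proof -
  let ?p = "prox \<gamma> g (q + \<gamma> *\<^sub>R d)"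
  have "0 \<le> ((1 / \<gamma>) *\<^sub>R (q + \<gamma> *\<^sub>R d - ?p) - d) \<bullet> (?p - q)"
    by (rule subgradient_monotone[OF prox_subgradient[OF g sub \<gamma>] sub])
  moreover have "(1 / \<gamma>) *\<^sub>R (q + \<gamma> *\<^sub>R d - ?p) - d = - ((1 / \<gamma>) *\<^sub>R (?p - q))"
    using \<gamma> by (simp add: algebra_simps)
  ultimately have "(?p - q) \<bullet> (?p - q) \<le> 0" using \<gamma> by (simp add: divide_le_0_iff)
  then show ?thesis by (simp flip: power2_norm_eq_inner)
qed

text \<open>Monotonicity of the subdifferential says that \<open>prox\<close> is firmly nonexpansive; the Cauchy-Schwarz
  inequality weakens this to the claim.\<close>

lemma prox_nonexpansive:
  fixes g :: "'a::euclidean_space \<Rightarrow> ereal"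
  assumes g: "convex_ereal g" "proper_fun g" "lower_semicontinuous g"
    and sub: "is_subgradient g q d" and \<gamma>: "0 < \<gamma>"
  shows "norm (prox \<gamma> g x - prox \<gamma> g y) \<le> norm (x - y)"
proof -
  define u where "u = prox \<gamma> g x - prox \<gamma> g y"
  have "0 \<le> ((1 / \<gamma>) *\<^sub>R (x - prox \<gamma> g x) - (1 / \<gamma>) *\<^sub>R (y - prox \<gamma> g y)) \<bullet> u"
    unfolding u_def by (rule subgradient_monotone[OF prox_subgradient[OF g sub \<gamma>] prox_subgradient[OF g sub \<gamma>]])
  also have "(1 / \<gamma>) *\<^sub>R (x - prox \<gamma> g x) - (1 / \<gamma>) *\<^sub>R (y - prox \<gamma> g y) = (1 / \<gamma>) *\<^sub>R ((x - y) - u)"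
    by (simp add: u_def algebra_simps)
  finally have "0 \<le> ((x - y) - u) \<bullet> u" using \<gamma> by (simp add: zero_le_divide_iff)
  then have "norm u * norm u \<le> (x - y) \<bullet> u" by (simp add: inner_diff_left norm_eq_square dot_square_norm power2_eq_square)
  also have "\<dots> \<le> norm (x - y) * norm u" by (rule norm_cauchy_schwarz)
  finally show ?thesis unfolding u_def[symmetric] by (cases "u = 0") (auto simp: mult_le_cancel_right)
qed

text \<open>Optimality of \<open>xstar\<close> for \<open>f + g\<close> is a fixed point equation of the proximal gradient step. The
  subgradient found here also guarantees that proximal points exist at all.\<close>

lemma prox_gradient_fixed_point:
  fixes f :: "'a::euclidean_space \<Rightarrow> real"
  assumes f: "smooth_fun L f"
    and g: "convex_ereal g" "proper_fun g" "lower_semicontinuous g"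
    and xstar: "is_arg_min (\<lambda>y. ereal (f y) + g y) (\<lambda>_. True) xstar"
  shows "is_subgradient g xstar (- gradient f xstar)"
    and "0 < \<gamma> \<Longrightarrow> prox \<gamma> g (xstar - \<gamma> *\<^sub>R gradient f xstar) = xstar"
proof -
  show sub: "is_subgradient g xstar (- gradient f xstar)"
  proof (rule minimizer_imp_subgradient[OF g(1,2)])
    show "ereal (f xstar) + g xstar \<le> ereal (f y) + g y" for y
      using xstar unfolding is_arg_min_def by (simp add: not_less)
    show "f y \<le> f xstar + gradient f xstar \<bullet> (y - xstar) + L / 2 * (norm (y - xstar))\<^sup>2" for y
      using smooth_quadratic_bound[OF f, of y xstar] by linarith
  qed
  show "prox \<gamma> g (xstar - \<gamma> *\<^sub>R gradient f xstar) = xstar" if "0 < \<gamma>"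
    using prox_eqI[OF g sub that] by simp
qed

section \<open>Symmetric matrices: smallest eigenvalue and square root\<close>

lemma symmetric_dot:
  fixes A :: "real^'n^'n"
  assumes "transpose A = A"
  shows "(A *v x) \<bullet> y = x \<bullet> (A *v y)"
  using assms dot_lmul_matrix[of x A y] transpose_matrix_vector[of A x] by simp

lemma norm_matrix_vector_le: "norm (A *v x) \<le> spectral_norm A * norm x"
  for A :: "real^'n^'n"
  unfolding spectral_norm_def by (rule onorm) simp

lemma spectral_norm_nonneg: "0 \<le> spectral_norm A"
  for A :: "real^'n^'n"
  unfolding spectral_norm_def by (rule onorm_pos_le) simp

lemma spectral_norm_le:
  fixes A :: "real^'n^'n"
  assumes "\<And>x. norm (A *v x) \<le> b * norm x"
  shows "spectral_norm A \<le> b"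
  unfolding spectral_norm_def using assms by (rule onorm_le)

lemma spectral_norm_mult: "spectral_norm (A ** B) \<le> spectral_norm A * spectral_norm B"
  for A B :: "real^'n^'n"
proof (rule spectral_norm_le)
  fix x
  have "norm ((A ** B) *v x) \<le> spectral_norm A * norm (B *v x)"
    unfolding matrix_vector_mul_assoc[symmetric] by (rule norm_matrix_vector_le)
  also have "\<dots> \<le> spectral_norm A * (spectral_norm B * norm x)"
    by (intro mult_left_mono norm_matrix_vector_le spectral_norm_nonneg)
  finally show "norm ((A ** B) *v x) \<le> spectral_norm A * spectral_norm B * norm x" by simp
qed

lemma matrix_sub_ldistrib: "A ** (B - C) = A ** B - A ** C"
  and matrix_sub_rdistrib: "(A - B) ** C = A ** C - B ** C"
  for A B C :: "real^'n^'n"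
  by (simp_all add: matrix_eq matrix_vector_mul_assoc[symmetric]
      matrix_vector_mult_diff_rdistrib matrix_vector_mult_diff_distrib)

lemma spectral_norm_add: "spectral_norm (A + B) \<le> spectral_norm A + spectral_norm B"
  for A B :: "real^'n^'n"
proof (rule spectral_norm_le)
  fix x
  have "norm ((A + B) *v x) \<le> norm (A *v x) + norm (B *v x)"
    unfolding matrix_vector_mult_add_rdistrib by (rule norm_triangle_ineq)
  also have "\<dots> \<le> spectral_norm A * norm x + spectral_norm B * norm x"
    by (intro add_mono norm_matrix_vector_le)
  finally show "norm ((A + B) *v x) \<le> (spectral_norm A + spectral_norm B) * norm x"
    by (simp add: algebra_simps)
qed

lemma spectral_norm_half: "spectral_norm ((1/2) *\<^sub>R A) \<le> spectral_norm A / 2"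
  for A :: "real^'n^'n"
proof (rule spectral_norm_le)
  fix x
  show "norm (((1/2) *\<^sub>R A) *v x) \<le> spectral_norm A / 2 * norm x"
    using norm_matrix_vector_le[of A x] by (simp add: scaleR_matrix_vector_assoc[symmetric])
qed

lemma norm_matrix_le_spectral_norm:
  fixes A :: "real^'n^'n"
  shows "norm A \<le> real CARD('n) * real CARD('n) * spectral_norm A"
proof -
  have row: "norm (A $ i) \<le> real CARD('n) * spectral_norm A" for i
  proof -
    have "norm (A $ i) \<le> (\<Sum>j\<in>UNIV. \<bar>A $ i $ j\<bar>)" by (rule norm_le_l1_cart)
    also have "\<dots> \<le> (\<Sum>j\<in>(UNIV::'n set). spectral_norm A)"
      unfolding spectral_norm_def by (intro sum_mono matrix_component_le_onorm)
    finally show ?thesis by simp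
  qed
  have "norm A \<le> (\<Sum>i\<in>UNIV. norm (A $ i))"
    unfolding norm_vec_def by (rule L2_set_le_sum) simp
  also have "\<dots> \<le> (\<Sum>i\<in>(UNIV::'n set). real CARD('n) * spectral_norm A)"
    by (intro sum_mono row)
  finally show ?thesis by simp
qed

text \<open>The Cauchy-Schwarz inequality for the form of \<open>A\<close>, obtained from nonnegativity of the form at
  \<open>x - A x / q\<close>. It serves to bound the operator norm of \<open>A\<close> by \<open>q\<close>, and to see that the form vanishes only
  on the kernel of \<open>A\<close>.\<close>

lemma psd_norm_bound:
  fixes A :: "real^'n^'n"
  assumes sym: "transpose A = A" and psd: "\<And>x. 0 \<le> x \<bullet> (A *v x)"
    and q: "0 < q" "\<And>x. x \<bullet> (A *v x) \<le> q * (norm x)\<^sup>2"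
  shows "(norm (A *v x))\<^sup>2 \<le> q * (x \<bullet> (A *v x))"
proof -
  define w where "w = A *v x"
  have "0 \<le> (x - (1 / q) *\<^sub>R w) \<bullet> (A *v (x - (1 / q) *\<^sub>R w))" by (rule psd)
  also have "\<dots> = x \<bullet> w - 2 / q * (norm w)\<^sup>2 + (1 / q)\<^sup>2 * (w \<bullet> (A *v w))"
  proof -
    have "x \<bullet> (A *v w) = w \<bullet> w" by (simp add: w_def symmetric_dot[OF sym])
    then show ?thesis
      by (simp add: matrix_vector_mult_diff_distrib matrix_vector_mult_scaleR inner_simps
          w_def[symmetric] power2_norm_eq_inner power_divide diff_divide_distrib)
        (simp add: power2_eq_square)
  qed
  also have "\<dots> \<le> x \<bullet> w - 2 / q * (norm w)\<^sup>2 + (1 / q)\<^sup>2 * (q * (norm w)\<^sup>2)"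
    by (intro add_left_mono mult_left_mono q) simp
  also have "\<dots> = x \<bullet> w - (norm w)\<^sup>2 / q" using q(1) by (simp add: power2_eq_square)
  finally show ?thesis using q(1) unfolding w_def[symmetric] by (simp add: field_simps)
qed

text \<open>Let \<open>v\<close> minimize the quadratic form on the unit sphere, with value \<open>c\<close>. Then \<open>A - c\<close> is positive
  semidefinite and its form vanishes at \<open>v\<close>, so \<open>v\<close> lies in its kernel.\<close>

lemma rayleigh_minimum_eigenvector:
  fixes A :: "real^'n^'n"
  assumes sym: "transpose A = A"
  shows "\<exists>v c. v \<noteq> 0 \<and> A *v v = c *\<^sub>R v \<and> (\<forall>x. c * (norm x)\<^sup>2 \<le> x \<bullet> (A *v x))"
proof -
  have "continuous_on (sphere 0 1) (\<lambda>x::real^'n. x \<bullet> (A *v x))"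
    by (intro continuous_intros linear_continuous_on) simp
  then obtain v where v: "v \<in> sphere 0 1"
    "\<And>x. x \<in> sphere 0 1 \<Longrightarrow> v \<bullet> (A *v v) \<le> x \<bullet> (A *v x)"
    using continuous_attains_inf[of "sphere 0 1" "\<lambda>x. x \<bullet> (A *v x)"] by auto
  define c where "c = v \<bullet> (A *v v)"
  have ge: "c * (norm x)\<^sup>2 \<le> x \<bullet> (A *v x)" for x
  proof (cases "x = 0")
    case False
    then have "c \<le> ((1 / norm x) *\<^sub>R x) \<bullet> (A *v ((1 / norm x) *\<^sub>R x))"
      unfolding c_def by (intro v(2)) simp
    also have "\<dots> = (x \<bullet> (A *v x)) / (norm x)\<^sup>2"
      by (simp add: matrix_vector_mult_scaleR power2_eq_square)
    finally show ?thesis using False by (simp add: field_simps)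
  qed simp
  define B where "B = A - c *\<^sub>R mat 1"
  have Bv: "B *v x = A *v x - c *\<^sub>R x" for x
    by (simp add: B_def matrix_vector_mult_diff_rdistrib scaleR_matrix_vector_assoc[symmetric])
  have Bsym: "transpose B = B" using sym unfolding B_def by (simp add: transpose_def vec_eq_iff mat_def)
  have Bpsd: "0 \<le> x \<bullet> (B *v x)" for x
    using ge[of x] by (simp add: Bv inner_diff_right power2_norm_eq_inner)
  have Bup: "x \<bullet> (B *v x) \<le> (spectral_norm B + 1) * (norm x)\<^sup>2" for x
  proof -
    have "x \<bullet> (B *v x) \<le> norm x * norm (B *v x)" by (rule norm_cauchy_schwarz)
    also have "\<dots> \<le> norm x * (spectral_norm B * norm x)"
      by (intro mult_left_mono norm_matrix_vector_le) simp
    also have "\<dots> \<le> (spectral_norm B + 1) * (norm x)\<^sup>2"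
      by (simp add: power2_eq_square algebra_simps)
    finally show ?thesis .
  qed
  have "v \<bullet> (B *v v) = 0"
    using v(1) by (simp add: Bv inner_diff_right c_def flip: power2_norm_eq_inner)
  then have "(norm (B *v v))\<^sup>2 \<le> 0"
    using psd_norm_bound[OF Bsym Bpsd _ Bup, of v] spectral_norm_nonneg[of B] by simp
  then have "A *v v = c *\<^sub>R v" by (simp add: Bv)
  moreover have "v \<noteq> 0" using v(1) by auto
  ultimately show ?thesis using ge by blast
qed

text \<open>Eigenvectors for different eigenvalues are orthogonal, hence linearly independent. Finiteness makes the
  minimum in \<^const>\<open>lambda_min\<close> a genuine one.\<close>

lemma finite_eigenvalues_symmetric:
  fixes A :: "real^'n^'n"
  assumes sym: "transpose A = A"
  shows "finite {c. \<exists>v. v \<noteq> 0 \<and> A *v v = c *\<^sub>R v}" (is "finite ?E")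
proof -
  define V where "V c = (SOME v. v \<noteq> 0 \<and> A *v v = c *\<^sub>R v)" for c
  have V: "V c \<noteq> 0 \<and> A *v V c = c *\<^sub>R V c" if "c \<in> ?E" for c
    using that unfolding V_def mem_Collect_eq by (rule someI_ex)
  have orth: "V c \<bullet> V d = 0" if "c \<in> ?E" "d \<in> ?E" "c \<noteq> d" for c d
  proof -
    have "c * (V c \<bullet> V d) = d * (V c \<bullet> V d)"
      using symmetric_dot[OF sym, of "V c" "V d"] V[OF that(1)] V[OF that(2)] by simp
    then show ?thesis using that(3) by simp
  qed
  have inj: "inj_on V ?E"
  proof (rule inj_onI, rule ccontr)
    fix c d assume cd: "c \<in> ?E" "d \<in> ?E" "V c = V d" "c \<noteq> d"
    have "V c \<bullet> V c = 0" using orth[OF cd(1,2,4)] unfolding cd(3)[symmetric] .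
    then show False using V[OF cd(1)] by (metis inner_eq_zero_iff)
  qed
  have "pairwise orthogonal (V ` ?E)"
    unfolding pairwise_def orthogonal_def using orth by blast
  moreover have "0 \<notin> V ` ?E" using V by (metis (no_types, lifting) imageE)
  ultimately have "finite (V ` ?E)"
    using pairwise_orthogonal_independent independent_imp_finite by blast
  then show ?thesis using inj by (rule finite_imageD)
qed

lemma lambda_min_le_quadratic_form:
  fixes A :: "real^'n^'n"
  assumes sym: "transpose A = A"
  shows "lambda_min A * (norm x)\<^sup>2 \<le> x \<bullet> (A *v x)"
proof -
  obtain v c where cv: "v \<noteq> 0" "A *v v = c *\<^sub>R v" "\<And>x. c * (norm x)\<^sup>2 \<le> x \<bullet> (A *v x)"
    using rayleigh_minimum_eigenvector[OF sym] by metis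
  have "lambda_min A \<le> c"
    unfolding lambda_min_def using finite_eigenvalues_symmetric[OF sym] cv by (intro Min_le) auto
  then have "lambda_min A * (norm x)\<^sup>2 \<le> c * (norm x)\<^sup>2" by (intro mult_right_mono) auto
  then show ?thesis using cv(3)[of x] by linarith
qed

text \<open>The difference \<open>D = B - C\<close> satisfies \<open>B D = - D C\<close>. An eigenvector \<open>v\<close> of \<open>D\<close> for the eigenvalue \<open>c\<close> then
  gives \<open>c (v \<bullet> B v + v \<bullet> C v) = 0\<close>, so that every eigenvalue of \<open>D\<close> is \<open>0\<close>; the extreme ones bound the quadratic
  form of \<open>D\<close>.\<close>

lemma psd_sqrt_unique:
  fixes B C :: "real^'n^'n"
  assumes B: "psd_matrix B" and C: "psd_matrix C" and pd: "\<And>x. x \<noteq> 0 \<Longrightarrow> 0 < x \<bullet> (B *v x)"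
    and eq: "B ** B = C ** C"
  shows "B = C"
proof -
  have symB: "transpose B = B" and symC: "transpose C = C" and psdC: "\<And>x. 0 \<le> x \<bullet> (C *v x)"
    using B C unfolding psd_matrix_def by auto
  have sq: "B *v (B *v x) = C *v (C *v x)" for x
    by (simp add: matrix_vector_mul_assoc eq)
  \<comment> \<open>applied to \<open>B - C\<close> and to \<open>C - B\<close>\<close>
  have nonneg: "0 \<le> x \<bullet> (D *v x)"
    if D: "transpose D = D" "\<And>x. B *v (D *v x) = - (D *v (C *v x))" for D :: "real^'n^'n" and x
  proof -
    obtain v c where cv: "v \<noteq> 0" "D *v v = c *\<^sub>R v" "\<And>x. c * (norm x)\<^sup>2 \<le> x \<bullet> (D *v x)"
      using rayleigh_minimum_eigenvector[OF D(1)] by metis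
    have "v \<bullet> (B *v (D *v v)) = - ((D *v v) \<bullet> (C *v v))"
      using D(2)[of v] symmetric_dot[OF D(1), of v] by simp
    then have "c * (v \<bullet> (B *v v) + v \<bullet> (C *v v)) = 0"
      by (simp add: cv(2) matrix_vector_mult_scaleR algebra_simps)
    moreover have "0 < v \<bullet> (B *v v) + v \<bullet> (C *v v)"
      using pd[OF cv(1)] psdC[of v] by linarith
    ultimately have "c = 0" by simp
    then show ?thesis using cv(3)[of x] by simp
  qed
  define D where "D = B - C"
  have D: "transpose D = D"
    using symB symC unfolding D_def by (simp add: transpose_def vec_eq_iff)
  have D': "transpose (- D) = - D" using D by (simp add: transpose_def vec_eq_iff)
  have anti: "B *v (D *v x) = - (D *v (C *v x))" for x
    by (simp add: D_def matrix_vector_mult_diff_rdistrib matrix_vector_mult_diff_distrib sq)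
  have neg: "(- D) *v x = - (D *v x)" for x
    using matrix_vector_mult_diff_rdistrib[of 0 D x] by simp
  have form: "x \<bullet> (D *v x) = 0" for x
  proof (rule antisym)
    show "0 \<le> x \<bullet> (D *v x)" by (rule nonneg[OF D anti])
    have "0 \<le> x \<bullet> ((- D) *v x)"
      by (rule nonneg[OF D'])
        (simp add: neg anti matrix_vector_mult_diff_distrib[of B 0, simplified])
    then show "x \<bullet> (D *v x) \<le> 0" by (simp add: neg)
  qed
  have "D *v x = 0" for x
    using psd_norm_bound[OF D, of 1 x] by (simp add: form)
  then have "D = 0" by (simp add: matrix_eq)
  then show ?thesis by (simp add: D_def)
qed

text \<open>Writing the square root of \<open>A\<close> as \<open>1 - Y\<close> turns the equation into \<open>Y = (1 - A + Y\<^sup>2) / 2\<close>, which is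
  solved by iteration. Besides existence, this exhibits the square root as a limit of polynomials in
  the entries of \<open>A\<close>, and so as a measurable function of \<open>A\<close>.\<close>

primrec sqrt_iter :: "real^'n^'n \<Rightarrow> nat \<Rightarrow> real^'n^'n" where
  "sqrt_iter A 0 = 0"
| "sqrt_iter A (Suc k) = (1 / 2) *\<^sub>R ((mat 1 - A) + sqrt_iter A k ** sqrt_iter A k)"

lemma tendsto_matrix_mult [tendsto_intros]:
  fixes f g :: "'b \<Rightarrow> real^'n^'n"
  assumes "(f \<longlongrightarrow> A) F" "(g \<longlongrightarrow> B) F"
  shows "((\<lambda>x. f x ** g x) \<longlongrightarrow> A ** B) F"
  unfolding matrix_matrix_mult_def by (intro tendsto_intros assms)

text \<open>Average projections of admissible laws are of this kind.\<close>

definition contracting_pd :: "real^'n^'n \<Rightarrow> bool" where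
  "contracting_pd A \<longleftrightarrow> transpose A = A \<and> (\<forall>x. x \<noteq> 0 \<longrightarrow> 0 < x \<bullet> (A *v x))
      \<and> (\<forall>x. x \<bullet> (A *v x) \<le> (norm x)\<^sup>2)"

text \<open>With \<open>E = 1 - A\<close> of norm at most \<open>q < 1\<close>, the iterates stay in the ball of radius \<open>r = 1 - sqrt (1 - q)\<close>,
  where \<open>q + r\<^sup>2 = 2 r\<close>; on it the iteration contracts by the factor \<open>r < 1\<close>.\<close>

lemma sqrt_iter_converges:
  fixes A :: "real^'n^'n"
  assumes A: "contracting_pd A"
  obtains B where "(\<lambda>k. mat 1 - sqrt_iter A k) \<longlonglongrightarrow> B" "B ** B = A" "transpose B = B"
    "\<And>x. x \<noteq> 0 \<Longrightarrow> 0 < x \<bullet> (B *v x)"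
proof -
  have sym: "transpose A = A" and up: "\<And>x. x \<bullet> (A *v x) \<le> (norm x)\<^sup>2"
    using A unfolding contracting_pd_def by auto
  obtain v c where cv: "v \<noteq> 0" "A *v v = c *\<^sub>R v" "\<And>x. c * (norm x)\<^sup>2 \<le> x \<bullet> (A *v x)"
    using rayleigh_minimum_eigenvector[OF sym] by metis
  have "0 < v \<bullet> (A *v v)" using A cv(1) unfolding contracting_pd_def by blast
  then have "0 < c * (v \<bullet> v)" by (simp add: cv(2))
  then have "0 < c" using inner_ge_zero[of v] by (auto simp: zero_less_mult_iff)
  \<comment> \<open>halving keeps \<open>q\<close> strictly between \<open>0\<close> and \<open>1\<close>, even for \<open>A = mat 1\<close>\<close>
  define q where "q = 1 - min c 1 / 2"
  have q: "0 < q" "q < 1" unfolding q_def using \<open>0 < c\<close> by auto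
  define r where "r = 1 - sqrt (1 - q)"
  have r: "0 \<le> r" "r < 1" unfolding r_def using q by auto
  have rq: "q + r * r = 2 * r"
    using q unfolding r_def by (simp add: algebra_simps)
  define E where "E = mat 1 - A"
  have Ev: "E *v x = x - A *v x" for x by (simp add: E_def matrix_vector_mult_diff_rdistrib)
  have Esym: "transpose E = E" using sym unfolding E_def by (simp add: transpose_def vec_eq_iff mat_def)
  have Eup: "x \<bullet> (E *v x) \<le> q * (norm x)\<^sup>2" for x
  proof -
    have "(1 - q) * (norm x)\<^sup>2 \<le> c * (norm x)\<^sup>2"
      unfolding q_def using \<open>0 < c\<close> by (intro mult_right_mono) auto
    with cv(3)[of x] show ?thesis
      by (simp add: Ev inner_diff_right left_diff_distrib flip: power2_norm_eq_inner)
  qed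
  have Epsd: "0 \<le> x \<bullet> (E *v x)" for x
    using up[of x] by (simp add: Ev inner_diff_right flip: power2_norm_eq_inner)
  have Enorm: "spectral_norm E \<le> q"
  proof (rule spectral_norm_le)
    fix x
    have "(norm (E *v x))\<^sup>2 \<le> q * (x \<bullet> (E *v x))"
      by (rule psd_norm_bound[OF Esym Epsd q(1) Eup])
    also have "\<dots> \<le> q * (q * (norm x)\<^sup>2)" using q by (intro mult_left_mono Eup) simp
    finally have "(norm (E *v x))\<^sup>2 \<le> (q * norm x)\<^sup>2" by (simp add: power2_eq_square algebra_simps)
    then show "norm (E *v x) \<le> q * norm x" using q by (auto intro: power2_le_imp_le)
  qed
  let ?Y = "sqrt_iter A"
  have Y: "?Y (Suc k) = (1 / 2) *\<^sub>R (E + ?Y k ** ?Y k)" for k by (simp add: E_def)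
  have Ynorm: "spectral_norm (?Y k) \<le> r" for k
  proof (induction k)
    case 0
    show ?case using r by (intro spectral_norm_le) simp
  next
    case (Suc k)
    have "spectral_norm (?Y k ** ?Y k) \<le> r * r"
      using Suc spectral_norm_nonneg[of "?Y k"] r
      by (intro order_trans[OF spectral_norm_mult] mult_mono) auto
    then have "spectral_norm (E + ?Y k ** ?Y k) \<le> q + r * r"
      using Enorm spectral_norm_add[of E "?Y k ** ?Y k"] by linarith
    then show ?case unfolding Y using spectral_norm_half[of "E + ?Y k ** ?Y k"] rq by linarith
  qed
  have step: "spectral_norm (?Y (Suc k) - ?Y k) \<le> r ^ k" for k
  proof (induction k)
    case 0
    show ?case using Ynorm[of 1] r by simp
  next
    case (Suc k)
    let ?D = "?Y (Suc k) - ?Y k"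
    have "?Y (Suc (Suc k)) - ?Y (Suc k) = (1 / 2) *\<^sub>R (?Y (Suc k) ** ?D + ?D ** ?Y k)"
    proof -
      have "(1 / 2) *\<^sub>R (E + Z ** Z) - (1 / 2) *\<^sub>R (E + X ** X) = (1 / 2) *\<^sub>R (Z ** (Z - X) + (Z - X) ** X)"
        for X Z :: "real^'n^'n"
        by (simp add: matrix_sub_ldistrib matrix_sub_rdistrib flip: scaleR_diff_right)
      then show ?thesis unfolding Y[of "Suc k"] by (subst (2) Y[of k]) simp
    qed
    moreover have "spectral_norm (?Y (Suc k) ** ?D) \<le> r * r ^ k" "spectral_norm (?D ** ?Y k) \<le> r ^ k * r"
      using Suc Ynorm r spectral_norm_nonneg
      by (auto intro!: order_trans[OF spectral_norm_mult] mult_mono simp del: sqrt_iter.simps)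
    ultimately show ?case
      using spectral_norm_half[of "?Y (Suc k) ** ?D + ?D ** ?Y k"]
        spectral_norm_add[of "?Y (Suc k) ** ?D" "?D ** ?Y k"] by (simp add: mult.commute[of r] del: sqrt_iter.simps)
  qed
  have "summable (\<lambda>k. ?Y (Suc k) - ?Y k)"
  proof (rule summable_comparison_test)
    show "summable (\<lambda>k. real CARD('n) * real CARD('n) * r ^ k)"
      using r by (intro summable_mult summable_geometric) auto
    show "\<exists>N. \<forall>k\<ge>N. norm (?Y (Suc k) - ?Y k) \<le> real CARD('n) * real CARD('n) * r ^ k"
      using norm_matrix_le_spectral_norm step
      by (intro exI[of _ 0] allI impI) (auto intro!: order_trans[OF norm_matrix_le_spectral_norm] mult_left_mono simp del: sqrt_iter.simps)
  qed
  from summable_LIMSEQ[OF this] obtain Y' where Y': "?Y \<longlonglongrightarrow> Y'"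
    unfolding sum_lessThan_telescope by auto
  have "(\<lambda>k. ?Y (Suc k)) \<longlonglongrightarrow> (1 / 2) *\<^sub>R (E + Y' ** Y')"
    unfolding Y by (intro tendsto_intros Y')
  then have fixp: "Y' = (1 / 2) *\<^sub>R (E + Y' ** Y')"
    using LIMSEQ_Suc[OF Y'] LIMSEQ_unique by blast
  have Ysym: "transpose (?Y k) = ?Y k" for k
  proof (induction k)
    case (Suc k)
    then show ?case
      unfolding Y using Esym matrix_transpose_mul[of "?Y k" "?Y k"]
      by (simp add: transpose_def vec_eq_iff)
  qed (simp add: transpose_def vec_eq_iff)
  have Y'sym: "transpose Y' = Y'"
  proof -
    have "(\<lambda>k. transpose (?Y k)) \<longlonglongrightarrow> transpose Y'"
      unfolding transpose_def by (intro tendsto_intros Y')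
    then show ?thesis unfolding Ysym using Y' LIMSEQ_unique by blast
  qed
  have Y'norm: "norm (Y' *v x) \<le> r * norm x" for x
  proof (rule tendsto_upperbound)
    show "(\<lambda>k. norm (?Y k *v x)) \<longlonglongrightarrow> norm (Y' *v x)"
      unfolding matrix_vector_mult_def by (intro tendsto_intros Y')
    show "eventually (\<lambda>k. norm (?Y k *v x) \<le> r * norm x) sequentially"
      using norm_matrix_vector_le Ynorm
      by (intro always_eventually allI order_trans[OF norm_matrix_vector_le] mult_right_mono) auto
  qed simp
  define B where "B = mat 1 - Y'"
  have "2 *\<^sub>R Y' = E + Y' ** Y'" by (subst fixp) simp
  then have "B ** B = A"
    by (simp add: B_def matrix_sub_ldistrib matrix_sub_rdistrib E_def scaleR_2 algebra_simps)
  moreover have "transpose B = B"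
    using Y'sym unfolding B_def by (simp add: transpose_def vec_eq_iff mat_def)
  moreover have "(\<lambda>k. mat 1 - ?Y k) \<longlonglongrightarrow> B" unfolding B_def by (intro tendsto_intros Y')
  moreover have "0 < x \<bullet> (B *v x)" if "x \<noteq> 0" for x
  proof -
    have "x \<bullet> (Y' *v x) \<le> norm x * (r * norm x)"
      by (rule order_trans[OF norm_cauchy_schwarz]) (intro mult_left_mono Y'norm norm_ge_zero)
    also have "\<dots> < norm x * norm x" using that r by simp
    finally show ?thesis
      by (simp add: B_def matrix_vector_mult_diff_rdistrib inner_diff_right
          power2_eq_square flip: power2_norm_eq_inner)
  qed
  ultimately show thesis using that[of B] by simp
qed

lemma matrix_sqrt_contracting_pd:
  fixes A :: "real^'n^'n"
  assumes A: "contracting_pd A"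
  shows "(\<lambda>k. mat 1 - sqrt_iter A k) \<longlonglongrightarrow> matrix_sqrt A"
    and "matrix_sqrt A ** matrix_sqrt A = A"
    and "transpose (matrix_sqrt A) = matrix_sqrt A"
    and "x \<noteq> 0 \<Longrightarrow> 0 < x \<bullet> (matrix_sqrt A *v x)"
proof -
  obtain B where B: "(\<lambda>k. mat 1 - sqrt_iter A k) \<longlonglongrightarrow> B" "B ** B = A" "transpose B = B"
    "\<And>x. x \<noteq> 0 \<Longrightarrow> 0 < x \<bullet> (B *v x)"
    using sqrt_iter_converges[OF A] by metis
  have psd: "psd_matrix B"
    unfolding psd_matrix_def using B(3,4) by (metis inner_zero_left less_le_not_le linorder_le_cases)
  have "matrix_sqrt A = B"
    unfolding matrix_sqrt_def
  proof (rule the_equality)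
    show "psd_matrix B \<and> B ** B = A" using psd B(2) by simp
    show "C = B" if "psd_matrix C \<and> C ** C = A" for C
      using psd_sqrt_unique[of B C] psd that B by simp
  qed
  then show "(\<lambda>k. mat 1 - sqrt_iter A k) \<longlonglongrightarrow> matrix_sqrt A" "matrix_sqrt A ** matrix_sqrt A = A"
    "transpose (matrix_sqrt A) = matrix_sqrt A" "x \<noteq> 0 \<Longrightarrow> 0 < x \<bullet> (matrix_sqrt A *v x)"
    using B by simp_all
qed

lemma matrix_inv_eqI:
  fixes A B :: "real^'n^'n"
  assumes "A ** B = mat 1"
  shows "matrix_inv A = B"
proof -
  have "B ** A = mat 1" using assms matrix_left_right_inverse by blast
  then have inv: "invertible A" using assms unfolding invertible_def by blast
  then have "A ** matrix_inv A = mat 1" "matrix_inv A ** A = mat 1"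
    unfolding matrix_inv_def invertible_def by (metis (mono_tags, lifting) someI_ex)+
  then show ?thesis using assms by (metis matrix_mul_assoc matrix_mul_lid matrix_mul_rid)
qed

lemma inv_sqrt_contracting_pd:
  fixes A :: "real^'n^'n"
  assumes A: "contracting_pd A"
  shows "matrix_sqrt A *v (inv_sqrt A *v x) = x"
    and "inv_sqrt A *v (matrix_sqrt A *v x) = x"
    and "matrix_inv (inv_sqrt A) = matrix_sqrt A"
    and "det (matrix_sqrt A) \<noteq> 0"
proof -
  have ker: "x = 0" if "matrix_sqrt A *v x = 0" for x
    using matrix_sqrt_contracting_pd(4)[OF A, of x] that by force
  then obtain B where BA: "B ** matrix_sqrt A = mat 1"
    using matrix_left_invertible_ker[of "matrix_sqrt A"] by blast
  then have AB: "matrix_sqrt A ** B = mat 1" using matrix_left_right_inverse by blast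
  then have B: "inv_sqrt A = B" unfolding inv_sqrt_def by (rule matrix_inv_eqI)
  show "matrix_sqrt A *v (inv_sqrt A *v x) = x" "inv_sqrt A *v (matrix_sqrt A *v x) = x"
    unfolding B matrix_vector_mul_assoc AB BA by simp_all
  show "matrix_inv (inv_sqrt A) = matrix_sqrt A" unfolding B by (rule matrix_inv_eqI[OF BA])
  show "det (matrix_sqrt A) \<noteq> 0"
    using AB BA invertible_det_nz[of "matrix_sqrt A"] unfolding invertible_def by blast
qed

lemma norm_matrix_sqrt:
  fixes A :: "real^'n^'n"
  assumes A: "contracting_pd A"
  shows "(norm (matrix_sqrt A *v x))\<^sup>2 = x \<bullet> (A *v x)"
    and "norm (matrix_sqrt A *v x) \<le> norm x"
proof -
  show eq: "(norm (matrix_sqrt A *v x))\<^sup>2 = x \<bullet> (A *v x)"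
    unfolding power2_norm_eq_inner symmetric_dot[OF matrix_sqrt_contracting_pd(3)[OF A]]
    by (simp add: matrix_vector_mul_assoc matrix_sqrt_contracting_pd(2)[OF A])
  have "x \<bullet> (A *v x) \<le> (norm x)\<^sup>2" using A unfolding contracting_pd_def by blast
  then show "norm (matrix_sqrt A *v x) \<le> norm x"
    unfolding eq[symmetric] by (rule power2_le_imp_le) simp
qed

section \<open>Measurability of matrix operations\<close>

lemma borel_measurable_vecI:
  fixes f :: "'w \<Rightarrow> ('b::euclidean_space)^'n"
  assumes "\<And>i. (\<lambda>w. f w $ i) \<in> borel_measurable M"
  shows "f \<in> borel_measurable M"
proof (subst borel_measurable_euclidean_space, rule ballI)
  fix b :: "'b^'n" assume "b \<in> Basis"
  then obtain i u where "b = axis i u" "u \<in> Basis" unfolding Basis_vec_def by blast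
  moreover have "(\<lambda>w. f w $ i \<bullet> u) \<in> borel_measurable M" using assms[of i] by measurable
  ultimately show "(\<lambda>w. f w \<bullet> b) \<in> borel_measurable M" by (simp add: inner_axis)
qed

lemma borel_measurable_matrix_nth [measurable (raw)]:
  fixes f :: "'w \<Rightarrow> real^'n^'m"
  assumes "f \<in> borel_measurable M"
  shows "(\<lambda>w. f w $ i $ j) \<in> borel_measurable M"
proof -
  have "continuous_on UNIV (\<lambda>A::real^'n^'m. A $ i $ j)" by (intro continuous_intros)
  from borel_measurable_continuous_onI[OF this] show ?thesis using assms by measurable
qed

lemma borel_measurable_matrix_vector_mult [measurable (raw)]:
  fixes f :: "'w \<Rightarrow> real^'n^'m" and g :: "'w \<Rightarrow> real^'n"
  assumes "f \<in> borel_measurable M" "g \<in> borel_measurable M"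
  shows "(\<lambda>w. f w *v g w) \<in> borel_measurable M"
proof (rule borel_measurable_vecI)
  fix i
  note assms[measurable]
  have [measurable]: "(\<lambda>w. g w $ j) \<in> borel_measurable M" for j
    using measurable_compose[OF assms(2) borel_measurable_nth] .
  have "(\<lambda>w. \<Sum>j\<in>UNIV. f w $ i $ j * g w $ j) \<in> borel_measurable M" by measurable
  then show "(\<lambda>w. (f w *v g w) $ i) \<in> borel_measurable M"
    by (simp add: matrix_vector_mult_def)
qed

lemma borel_measurable_matrix_mult [measurable (raw)]:
  fixes f g :: "'w \<Rightarrow> real^'n^'n"
  assumes "f \<in> borel_measurable M" "g \<in> borel_measurable M"
  shows "(\<lambda>w. f w ** g w) \<in> borel_measurable M"
proof (intro borel_measurable_vecI)
  fix i j
  note assms[measurable]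
  have "(\<lambda>w. \<Sum>k\<in>UNIV. f w $ i $ k * g w $ k $ j) \<in> borel_measurable M" by measurable
  then show "(\<lambda>w. (f w ** g w) $ i $ j) \<in> borel_measurable M"
    by (simp add: matrix_matrix_mult_def)
qed

lemma borel_measurable_det [measurable (raw)]:
  fixes f :: "'w \<Rightarrow> real^'n^'n"
  assumes [measurable]: "f \<in> borel_measurable M"
  shows "(\<lambda>w. det (f w)) \<in> borel_measurable M"
  unfolding det_def by measurable

lemma borel_measurable_matrix_sqrt:
  fixes f :: "'w \<Rightarrow> real^'n^'n"
  assumes f [measurable]: "f \<in> borel_measurable M"
    and A: "\<And>w. w \<in> space M \<Longrightarrow> contracting_pd (f w)"
  shows "(\<lambda>w. matrix_sqrt (f w)) \<in> borel_measurable M"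
proof (rule borel_measurable_LIMSEQ_metric)
  show "(\<lambda>k. mat 1 - sqrt_iter (f w) k) \<longlonglongrightarrow> matrix_sqrt (f w)" if "w \<in> space M" for w
    by (rule matrix_sqrt_contracting_pd(1)[OF A[OF that]])
  have [measurable]: "(\<lambda>w. sqrt_iter (f w) k) \<in> borel_measurable M" for k
    by (induction k) simp_all
  show "(\<lambda>w. mat 1 - sqrt_iter (f w) k) \<in> borel_measurable M" for k
    by measurable
qed

text \<open>By Cramer's rule the entries of the inverse are quotients of polynomials in the entries of the matrix.\<close>

lemma borel_measurable_matrix_inv:
  fixes f :: "'w \<Rightarrow> real^'n^'n"
  assumes f [measurable]: "f \<in> borel_measurable M"
    and det: "\<And>w. w \<in> space M \<Longrightarrow> det (f w) \<noteq> 0"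
  shows "(\<lambda>w. matrix_inv (f w)) \<in> borel_measurable M"
proof (intro borel_measurable_vecI)
  fix i j
  let ?C = "\<lambda>w. (\<chi> i' j'. if j' = i then axis j 1 $ i' else f w $ i' $ j') :: real^'n^'n"
  have [measurable]: "?C \<in> borel_measurable M"
  proof (intro borel_measurable_vecI)
    fix i' j' show "(\<lambda>w. ?C w $ i' $ j') \<in> borel_measurable M" by (cases "j' = i") simp_all
  qed
  have "matrix_inv (f w) $ i $ j = det (?C w) / det (f w)" if "w \<in> space M" for w
  proof -
    have "invertible (f w)" using det[OF that] by (simp add: invertible_det_nz)
    then have "f w ** matrix_inv (f w) = mat 1"
      unfolding matrix_inv_def invertible_def by (metis (mono_tags, lifting) someI_ex)
    then have "f w *v (matrix_inv (f w) *v axis j 1) = axis j 1"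
      by (simp add: matrix_vector_mul_assoc)
    then have "matrix_inv (f w) *v axis j 1
        = (\<chi> k. det (\<chi> i' j'. if j' = k then axis j 1 $ i' else f w $ i' $ j') / det (f w))"
      using cramer[OF det[OF that]] by blast
    then have "(matrix_inv (f w) *v axis j 1) $ i = det (?C w) / det (f w)" by simp
    then show ?thesis by (simp add: matrix_vector_mul_component inner_axis)
  qed
  moreover have "(\<lambda>w. det (?C w) / det (f w)) \<in> borel_measurable M" by measurable
  ultimately show "(\<lambda>w. matrix_inv (f w) $ i $ j) \<in> borel_measurable M"
    by (simp cong: measurable_cong)
qed

section \<open>Random orthogonal projections\<close>

text \<open>The residual of the closest point is orthogonal to the subspace, which characterizes the closest
  point and makes it linear in \<open>x\<close>.\<close>

lemma proj_mat_closest_point: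
  fixes V :: "(real^'n) set"
  assumes V: "subspace V"
  shows "proj_mat V *v x = closest_point V x"
    and "proj_mat V *v x \<in> V"
    and "v \<in> V \<Longrightarrow> (x - proj_mat V *v x) \<bullet> v = 0"
proof -
  let ?p = "closest_point V"
  have cl: "closed V" and ne: "V \<noteq> {}" and cv: "convex V"
    using V closed_subspace subspace_0 subspace_imp_convex by blast+
  have inV: "?p x \<in> V" for x using cl ne by (rule closest_point_in_set)
  have orth: "(x - ?p x) \<bullet> v = 0" if "v \<in> V" for x v
  proof -
    have "?p x + v \<in> V" "?p x - v \<in> V"
      using V inV that by (auto intro: subspace_add subspace_diff)
    then show ?thesis
      using closest_point_dot[OF cv cl, of "?p x + v" x] closest_point_dot[OF cv cl, of "?p x - v" x]
      by (simp add: inner_minus_right)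
  qed
  have uniq: "?p x = q" if "q \<in> V" "\<And>v. v \<in> V \<Longrightarrow> (x - q) \<bullet> v = 0" for x q
  proof -
    have d: "q - ?p x \<in> V" using V inV that by (auto intro: subspace_diff)
    have "(q - ?p x) \<bullet> (q - ?p x) = (x - ?p x) \<bullet> (q - ?p x) - (x - q) \<bullet> (q - ?p x)"
      by (simp add: inner_diff_left)
    then have "(q - ?p x) \<bullet> (q - ?p x) = 0" using orth[OF d] that(2)[OF d] by simp
    then show ?thesis by simp
  qed
  have "linear ?p"
  proof (rule linearI)
    show "?p (x + y) = ?p x + ?p y" for x y
    proof (rule uniq)
      show "(x + y - (?p x + ?p y)) \<bullet> v = 0" if "v \<in> V" for v
        using orth[OF that, of x] orth[OF that, of y] by (simp add: inner_simps)
    qed (intro subspace_add V inV)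
    show "?p (c *\<^sub>R x) = c *\<^sub>R ?p x" for c x
    proof (rule uniq)
      show "(c *\<^sub>R x - c *\<^sub>R ?p x) \<bullet> v = 0" if "v \<in> V" for v
        using orth[OF that, of x] by (simp flip: scaleR_diff_right)
    qed (intro subspace_scale V inV)
  qed
  then show eq: "proj_mat V *v x = ?p x" unfolding proj_mat_def by (simp add: matrix_vector_mul)
  show "proj_mat V *v x \<in> V" "v \<in> V \<Longrightarrow> (x - proj_mat V *v x) \<bullet> v = 0"
    unfolding eq using inV orth by simp_all
qed

lemma proj_mat_inner:
  fixes V :: "(real^'n) set"
  assumes V: "subspace V"
  shows "(proj_mat V *v x) \<bullet> y = (proj_mat V *v x) \<bullet> (proj_mat V *v y)"
    and "x \<bullet> (proj_mat V *v y) = (proj_mat V *v x) \<bullet> (proj_mat V *v y)"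
    and "x \<bullet> (proj_mat V *v x) = (norm (proj_mat V *v x))\<^sup>2"
    and "norm (proj_mat V *v x) \<le> norm x"
proof -
  show 1: "x \<bullet> (proj_mat V *v y) = (proj_mat V *v x) \<bullet> (proj_mat V *v y)" for x y
    using proj_mat_closest_point(3)[OF V proj_mat_closest_point(2)[OF V, of y], of x]
    by (simp add: inner_diff_left)
  show "(proj_mat V *v x) \<bullet> y = (proj_mat V *v x) \<bullet> (proj_mat V *v y)"
    using 1[of y x] by (simp add: inner_commute)
  show sq: "x \<bullet> (proj_mat V *v x) = (norm (proj_mat V *v x))\<^sup>2"
    unfolding power2_norm_eq_inner by (rule 1)
  have "norm (proj_mat V *v x) * norm (proj_mat V *v x) \<le> norm x * norm (proj_mat V *v x)"
    using norm_cauchy_schwarz[of x "proj_mat V *v x"] sq by (simp add: power2_eq_square)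
  then show "norm (proj_mat V *v x) \<le> norm x"
    by (cases "proj_mat V *v x = 0") (auto simp: mult_le_cancel_right)
qed

lemma proj_mat_eq_0_iff:
  fixes V :: "(real^'n) set"
  assumes V: "subspace V"
  shows "proj_mat V *v x = 0 \<longleftrightarrow> x \<in> V\<^sup>\<bottom>"
proof
  assume "proj_mat V *v x = 0"
  then show "x \<in> V\<^sup>\<bottom>"
    using proj_mat_closest_point(3)[OF V, of _ x]
    by (auto simp: orthogonal_comp_def orthogonal_def inner_commute)
next
  assume "x \<in> V\<^sup>\<bottom>"
  then have "x \<bullet> (proj_mat V *v x) = 0"
    using proj_mat_closest_point(2)[OF V, of x]
    by (auto simp: orthogonal_comp_def orthogonal_def inner_commute)
  then show "proj_mat V *v x = 0" using proj_mat_inner(3)[OF V, of x] by simp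
qed

text \<open>The two summands lie in \<open>V\<close> and in its orthogonal complement, so their squared norms add up, and each
  is a quadratic form of the projection. Being affine in the projection, the right-hand side can be
  averaged over \<open>V\<close>.\<close>

lemma norm_mix_proj_mat:
  fixes V :: "(real^'n) set"
  assumes V: "subspace V"
  shows "(norm (proj_mat V *v y + (mat 1 - proj_mat V) *v z))\<^sup>2
           = y \<bullet> (proj_mat V *v y) + (norm z)\<^sup>2 - z \<bullet> (proj_mat V *v z)"
proof -
  have "(proj_mat V *v y) \<bullet> (z - proj_mat V *v z) = 0"
    using proj_mat_inner(1)[OF V, of y z] by (simp add: inner_diff_right)
  moreover have "(mat 1 - proj_mat V) *v z = z - proj_mat V *v z"
    by (simp add: matrix_vector_mult_diff_rdistrib)
  moreover have "(norm (z - proj_mat V *v z))\<^sup>2 = (norm z)\<^sup>2 - z \<bullet> (proj_mat V *v z)"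
    using proj_mat_inner(2)[OF V, of z z]
    by (simp add: power2_norm_eq_inner inner_simps inner_commute)
  ultimately show ?thesis
    using proj_mat_inner(3)[OF V, of y]
    by (simp add: power2_norm_eq_inner inner_add_left inner_add_right inner_commute)
qed

lemma space_subspace_algebra: "space subspace_algebra = {V. subspace V}"
  unfolding subspace_algebra_def by simp

lemma measurable_proj_mat [measurable]: "proj_mat \<in> borel_measurable subspace_algebra"
  unfolding subspace_algebra_def by (rule measurable_vimage_algebra1) simp

lemma measurable_avg_proj [measurable]: "avg_proj \<in> borel_measurable (subprob_algebra subspace_algebra)"
  unfolding avg_proj_def by measurable

lemma integrable_proj_mat:
  assumes \<nu>: "\<nu> \<in> space (prob_algebra (subspace_algebra :: (real^'n) set measure))"
  shows "integrable \<nu> (proj_mat :: (real^'n) set \<Rightarrow> _)"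
proof -
  have sets [measurable_cong]: "sets \<nu> = sets subspace_algebra" and "prob_space \<nu>"
    using \<nu> by (auto simp: space_prob_algebra)
  interpret prob_space \<nu> by fact
  show ?thesis
  proof (rule integrable_const_bound)
    show "proj_mat \<in> borel_measurable \<nu>" by measurable
    have "norm (proj_mat V) \<le> real CARD('n) * real CARD('n) * 1"
      if "subspace V" for V :: "(real^'n) set"
      using proj_mat_inner(4)[OF that]
      by (intro order_trans[OF norm_matrix_le_spectral_norm] mult_left_mono spectral_norm_le) auto
    then show "AE V in \<nu>. norm (proj_mat V) \<le> real CARD('n) * real CARD('n) * 1"
      using sets_eq_imp_space_eq[OF sets] by (auto simp: space_subspace_algebra)
  qed
qed

lemma avg_proj_quadratic_form:
  fixes x y :: "real^'n"
  assumes \<nu>: "\<nu> \<in> space (prob_algebra subspace_algebra)"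
  shows "integrable \<nu> (\<lambda>V. x \<bullet> (proj_mat V *v y))"
    and "x \<bullet> (avg_proj \<nu> *v y) = (\<integral>V. x \<bullet> (proj_mat V *v y) \<partial>\<nu>)"
proof -
  have lin: "bounded_linear (\<lambda>A::real^'n^'n. x \<bullet> (A *v y))"
    unfolding linear_conv_bounded_linear[symmetric]
    by (rule linearI)
      (simp_all add: matrix_vector_mult_add_rdistrib inner_add_right scaleR_matrix_vector_assoc[symmetric])
  show "integrable \<nu> (\<lambda>V. x \<bullet> (proj_mat V *v y))"
    by (rule integrable_bounded_linear[OF lin integrable_proj_mat[OF \<nu>]])
  show "x \<bullet> (avg_proj \<nu> *v y) = (\<integral>V. x \<bullet> (proj_mat V *v y) \<partial>\<nu>)"
    unfolding avg_proj_def by (rule integral_bounded_linear[OF lin integrable_proj_mat[OF \<nu>], symmetric])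
qed

text \<open>The form of the average projection at \<open>x\<close> is the expected squared norm of the projection of \<open>x\<close>. It
  vanishes only if the random subspace is almost surely orthogonal to \<open>x\<close>, which admissibility excludes.\<close>

lemma contracting_pd_avg_proj:
  fixes \<nu> :: "(real^'n) set measure"
  assumes \<nu>: "\<nu> \<in> space (prob_algebra subspace_algebra)" and adm: "admissible \<nu>"
  shows "contracting_pd (avg_proj \<nu>)"
  unfolding contracting_pd_def
proof (intro conjI allI impI)
  have sets [measurable_cong]: "sets \<nu> = sets subspace_algebra" and "prob_space \<nu>"
    using \<nu> by (auto simp: space_prob_algebra)
  interpret prob_space \<nu> by fact
  have sub: "subspace V" if "V \<in> space \<nu>" for V
    using that sets_eq_imp_space_eq[OF sets] by (auto simp: space_subspace_algebra)
  note form = avg_proj_quadratic_form[OF \<nu>]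
  have "x \<bullet> (avg_proj \<nu> *v y) = y \<bullet> (avg_proj \<nu> *v x)" for x y
    unfolding form(2)
    by (intro Bochner_Integration.integral_cong refl)
      (metis sub proj_mat_inner(1,2) inner_commute)
  then have "(transpose (avg_proj \<nu>) *v y) \<bullet> x = (avg_proj \<nu> *v y) \<bullet> x" for x y
    unfolding transpose_matrix_vector dot_lmul_matrix by (simp add: inner_commute)
  then have "transpose (avg_proj \<nu>) *v y = avg_proj \<nu> *v y" for y
    by (meson vector_eq_rdot)
  then show "transpose (avg_proj \<nu>) = avg_proj \<nu>" by (simp add: matrix_eq del: transpose_matrix_vector)
  fix x
  have "(\<integral>V. x \<bullet> (proj_mat V *v x) \<partial>\<nu>) \<le> (\<integral>V. (norm x)\<^sup>2 \<partial>\<nu>)"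
  proof (rule integral_mono[OF form(1)])
    show "x \<bullet> (proj_mat V *v x) \<le> (norm x)\<^sup>2" if "V \<in> space \<nu>" for V
      using proj_mat_inner(3,4)[OF sub[OF that], of x] by (simp add: power_mono)
  qed simp
  then show "x \<bullet> (avg_proj \<nu> *v x) \<le> (norm x)\<^sup>2" unfolding form(2) by (simp add: prob_space)
  assume "x \<noteq> 0"
  have nonneg: "AE V in \<nu>. 0 \<le> x \<bullet> (proj_mat V *v x)"
    by (intro AE_I2) (simp add: proj_mat_inner(3)[OF sub])
  show "0 < x \<bullet> (avg_proj \<nu> *v x)"
  proof (rule ccontr)
    assume "\<not> 0 < x \<bullet> (avg_proj \<nu> *v x)"
    moreover have "0 \<le> x \<bullet> (avg_proj \<nu> *v x)" unfolding form(2) using nonneg by (rule integral_nonneg_AE)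
    ultimately have "(\<integral>V. x \<bullet> (proj_mat V *v x) \<partial>\<nu>) = 0" unfolding form(2) by simp
    then have "AE V in \<nu>. x \<bullet> (proj_mat V *v x) = 0"
      using integral_nonneg_eq_0_iff_AE[OF form(1) nonneg] by simp
    then have "AE V in \<nu>. proj_mat V *v x = 0"
      by (rule AE_mp) (intro AE_I2, simp add: proj_mat_inner(3)[OF sub])
    moreover have "{V \<in> space \<nu>. x \<in> V\<^sup>\<bottom>} = {V \<in> space \<nu>. proj_mat V *v x = 0}"
      using proj_mat_eq_0_iff[OF sub] by auto
    moreover have "{V \<in> space \<nu>. proj_mat V *v x = 0} \<in> sets \<nu>" by measurable
    ultimately have "measure \<nu> {V \<in> space \<nu>. x \<in> V\<^sup>\<bottom>} = 1"
      by (simp add: prob_Collect_eq_1)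
    then show False using adm \<open>x \<noteq> 0\<close> unfolding admissible_def by (metis less_irrefl)
  qed
qed

lemma nn_integral_norm_mix_proj_mat:
  fixes y z :: "real^'n"
  assumes \<nu>: "\<nu> \<in> space (prob_algebra subspace_algebra)"
  shows "(\<integral>\<^sup>+V. ennreal ((norm (proj_mat V *v y + (mat 1 - proj_mat V) *v z))\<^sup>2) \<partial>\<nu>)
           = ennreal (y \<bullet> (avg_proj \<nu> *v y) + (norm z)\<^sup>2 - z \<bullet> (avg_proj \<nu> *v z))"
proof -
  have sets: "sets \<nu> = sets subspace_algebra" and "prob_space \<nu>"
    using \<nu> by (auto simp: space_prob_algebra)
  interpret prob_space \<nu> by fact
  note form = avg_proj_quadratic_form[OF \<nu>]
  let ?q = "\<lambda>V. y \<bullet> (proj_mat V *v y) + (norm z)\<^sup>2 - z \<bullet> (proj_mat V *v z)"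
  have eq: "(norm (proj_mat V *v y + (mat 1 - proj_mat V) *v z))\<^sup>2 = ?q V" if "V \<in> space \<nu>" for V
    using that sets_eq_imp_space_eq[OF sets] by (intro norm_mix_proj_mat) (auto simp: space_subspace_algebra)
  have "(\<integral>\<^sup>+V. ennreal ((norm (proj_mat V *v y + (mat 1 - proj_mat V) *v z))\<^sup>2) \<partial>\<nu>) = (\<integral>\<^sup>+V. ennreal (?q V) \<partial>\<nu>)"
    by (intro nn_integral_cong) (simp add: eq)
  also have "\<dots> = ennreal (\<integral>V. ?q V \<partial>\<nu>)"
    using eq by (intro nn_integral_eq_integral AE_I2 Bochner_Integration.integrable_diff
        Bochner_Integration.integrable_add form(1)) (simp_all flip: eq)
  also have "(\<integral>V. ?q V \<partial>\<nu>) = y \<bullet> (avg_proj \<nu> *v y) + (norm z)\<^sup>2 - z \<bullet> (avg_proj \<nu> *v z)"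
    unfolding form(2) by (simp add: form(1) prob_space)
  finally show ?thesis .
qed

section \<open>Cycles and adaptation times\<close>

text \<open>The cycle to which time \<open>k + 1\<close> belongs: as many adaptations as were decided in iterations \<open>1\<close> to \<open>k\<close>. Unlike
  \<^const>\<open>adapt_time\<close>, it is computed forwards in time and so visibly depends on past decisions only.\<close>

primrec cycle_index :: "(nat \<Rightarrow> bool) \<Rightarrow> nat \<Rightarrow> nat" where
  "cycle_index D 0 = 0"
| "cycle_index D (Suc k) = (if D (Suc k) then Suc (cycle_index D k) else cycle_index D k)"

text \<open>The adaptation time that opened the cycle of time \<open>k + 1\<close>.\<close>

primrec cycle_start :: "(nat \<Rightarrow> bool) \<Rightarrow> nat \<Rightarrow> nat" where
  "cycle_start D 0 = 0"
| "cycle_start D (Suc k) = (if D (Suc k) then k + 2 else cycle_start D k)"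

lemma cycle_start_le: "cycle_start D k \<le> Suc k"
  by (induction k) auto

lemma adapt_set_le_cycle_start:
  assumes "j \<in> adapt_set D" "j \<le> Suc k"
  shows "j \<le> cycle_start D k"
  using assms
proof (induction k)
  case (Suc k)
  show ?case
  proof (cases "j = k + 2")
    case True
    then have "D (Suc k)" using Suc.prems(1) by (auto simp: adapt_set_def)
    then show ?thesis using True by simp
  next
    case False
    then have "j \<le> cycle_start D k" using Suc by simp
    then show ?thesis using cycle_start_le[of D k] by auto
  qed
qed (auto simp: adapt_set_def)

lemma adapt_time_Suc_gt: "adapt_time D m < \<infinity> \<Longrightarrow> adapt_time D m < adapt_time D (Suc m)"
proof -
  assume "adapt_time D m < \<infinity>"
  then obtain i where i: "adapt_time D m = enat i" by auto
  have "enat (Suc i) \<le> adapt_time D (Suc m)"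
    unfolding adapt_time.simps i by (intro Inf_greatest) auto
  then show ?thesis by (simp only: i Suc_ile_eq)
qed

lemma adapt_time_mono: "m \<le> m' \<Longrightarrow> adapt_time D m \<le> adapt_time D m'"
proof (rule lift_Suc_mono_le[of "adapt_time D"])
  show "adapt_time D n \<le> adapt_time D (Suc n)" for n
  proof (cases "adapt_time D n < \<infinity>")
    case False
    then have "{enat k |k. k \<in> adapt_set D \<and> adapt_time D n < enat k} = {}" by auto
    then show ?thesis unfolding adapt_time.simps by (metis Inf_empty top_greatest)
  qed (use adapt_time_Suc_gt in \<open>blast intro: less_imp_le\<close>)
qed

lemma adapt_time_cycle_index: "adapt_time D (cycle_index D k) = enat (cycle_start D k)"
proof (induction k)
  case (Suc k)
  show ?case
  proof (cases "D (Suc k)")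
    case True
    have "Inf {enat j |j. j \<in> adapt_set D \<and> enat (cycle_start D k) < enat j} = enat (k + 2)"
    proof (rule antisym)
      show "Inf {enat j |j. j \<in> adapt_set D \<and> enat (cycle_start D k) < enat j} \<le> enat (k + 2)"
        using True cycle_start_le[of D k] by (intro Inf_lower) (auto simp: adapt_set_def)
      show "enat (k + 2) \<le> Inf {enat j |j. j \<in> adapt_set D \<and> enat (cycle_start D k) < enat j}"
        using adapt_set_le_cycle_start[of _ D k] by (intro Inf_greatest) (force simp: not_le)
    qed
    then show ?thesis using True Suc by simp
  qed (use Suc in simp)
qed (simp add: zero_enat_def)

lemma adapt_time_Suc_cycle_index: "enat (Suc k) < adapt_time D (Suc (cycle_index D k))"
proof -
  have "enat (Suc (Suc k)) \<le> adapt_time D (Suc (cycle_index D k))"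
    unfolding adapt_time.simps adapt_time_cycle_index
    using adapt_set_le_cycle_start[of _ D k] by (intro Inf_greatest) (force simp: not_le)
  then show ?thesis by (simp only: Suc_ile_eq)
qed

text \<open>The adaptation times increase, so time \<open>k + 1\<close> lies in exactly one of the intervals between them.\<close>

lemma in_cycle_iff:
  "adapt_time D m \<le> enat (Suc k) \<and> enat (Suc k) < adapt_time D (Suc m) \<longleftrightarrow> cycle_index D k = m"
proof
  assume m: "adapt_time D m \<le> enat (Suc k) \<and> enat (Suc k) < adapt_time D (Suc m)"
  have start: "adapt_time D (cycle_index D k) \<le> enat (Suc k)"
    by (simp add: adapt_time_cycle_index cycle_start_le)
  show "cycle_index D k = m"
  proof (rule linorder_cases)
    assume "cycle_index D k < m"
    then have "adapt_time D (Suc (cycle_index D k)) \<le> adapt_time D m" by (intro adapt_time_mono) simp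
    with adapt_time_Suc_cycle_index[of k D] have "enat (Suc k) < adapt_time D m"
      by (rule less_le_trans)
    then show ?thesis using m leD by blast
  next
    assume "m < cycle_index D k"
    then have "adapt_time D (Suc m) \<le> adapt_time D (cycle_index D k)" by (intro adapt_time_mono) simp
    then have "adapt_time D (Suc m) \<le> enat (Suc k)" using start by (rule order_trans)
    then show ?thesis using m leD by blast
  qed
next
  assume "cycle_index D k = m"
  then show "adapt_time D m \<le> enat (Suc k) \<and> enat (Suc k) < adapt_time D (Suc m)"
    using adapt_time_Suc_cycle_index[of k D] adapt_time_cycle_index[of D k] cycle_start_le[of D k]
    by auto
qed

section \<open>Integration against a conditional law\<close>

text \<open>The conditional probabilities of the events \<open>X \<in> B\<close> determine the joint law of the past and \<open>X\<close>: it
  agrees with the law that draws \<open>\<omega>\<close> first and then \<open>v\<close> from \<open>\<kappa> \<omega>\<close>, because the two coincide on measurable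
  rectangles. This is how the error after
  an iteration, a function of the past and of the new selection, is averaged over the selection.\<close>

lemma nn_integral_conditional_law:
  assumes "prob_space M" and sub: "subalgebra M G"
    and X [measurable]: "X \<in> measurable M N"
    and \<kappa>: "\<kappa> \<in> measurable G (prob_algebra N)"
    and cond: "\<And>B. B \<in> sets N \<Longrightarrow>
      AE \<omega> in M. real_cond_exp M G (\<lambda>\<omega>. indicator B (X \<omega>)) \<omega> = measure (\<kappa> \<omega>) B"
    and \<phi>: "\<phi> \<in> borel_measurable (G \<Otimes>\<^sub>M N)"
  shows "(\<integral>\<^sup>+\<omega>. \<phi> (\<omega>, X \<omega>) \<partial>M) = (\<integral>\<^sup>+\<omega>. (\<integral>\<^sup>+v. \<phi> (\<omega>, v) \<partial>\<kappa> \<omega>) \<partial>M)"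
proof -
  interpret M: prob_space M by fact
  interpret fm: finite_measure_subalgebra M G
    using sub by unfold_locales
  have spG: "space G = space M" and setsG: "sets G \<subseteq> sets M"
    using sub by (auto simp: subalgebra_def)
  have [measurable]: "(\<lambda>\<omega>. (\<omega>, X \<omega>)) \<in> measurable M (G \<Otimes>\<^sub>M N)"
    using measurable_from_subalg[OF sub measurable_ident_sets[OF refl]]
    by (intro measurable_Pair) (simp_all add: id_def)
  let ?R = "restr_to_subalg M G"
  have R: "sets ?R = sets G" "space ?R = space G"
    using sets_restr_to_subalg[OF sub] space_restr_to_subalg[of M G] spG by auto
  have \<kappa>s: "\<kappa> \<in> measurable G (subprob_algebra N)" using \<kappa> by (rule measurable_prob_algebraD)
  have \<kappa>p: "prob_space (\<kappa> \<omega>)" "sets (\<kappa> \<omega>) = sets N" if "\<omega> \<in> space M" for \<omega>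
    using measurable_space[OF \<kappa>, of \<omega>] that by (auto simp: spG space_prob_algebra)
  let ?K = "\<lambda>\<omega>. distr (\<kappa> \<omega>) (G \<Otimes>\<^sub>M N) (Pair \<omega>)"
  have K: "?K \<in> measurable ?R (subprob_algebra (G \<Otimes>\<^sub>M N))"
    unfolding measurable_cong_sets[OF R(1) refl]
    by (rule measurable_distr2[OF _ \<kappa>s]) (simp add: measurable_split_conv)
  have ne: "space ?R \<noteq> {}" unfolding R spG by (rule M.not_empty)
  have PairK: "Pair \<omega> \<in> measurable (\<kappa> \<omega>) (G \<Otimes>\<^sub>M N)" if "\<omega> \<in> space M" for \<omega>
    unfolding measurable_cong_sets[OF \<kappa>p(2)[OF that] refl] using that by (simp add: spG)
  let ?P1 = "distr M (G \<Otimes>\<^sub>M N) (\<lambda>\<omega>. (\<omega>, X \<omega>))" and ?P2 = "?R \<bind> ?K"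
  let ?E = "{A \<times> B |A B. A \<in> sets G \<and> B \<in> sets N}"
  have setsP2: "sets ?P2 = sets (G \<Otimes>\<^sub>M N)"
    by (rule sets_bind[OF _ ne]) simp
  have P1: "emeasure ?P1 (A \<times> B) = emeasure M {\<omega> \<in> space M. \<omega> \<in> A \<and> X \<omega> \<in> B}"
    if "A \<in> sets G" "B \<in> sets N" for A B
    using that by (subst emeasure_distr) (auto intro!: arg_cong[where f = "emeasure M"])
  have eq: "emeasure ?P1 (A \<times> B) = emeasure ?P2 (A \<times> B)" if A: "A \<in> sets G" and B: "B \<in> sets N" for A B
  proof -
    have [measurable]: "A \<in> sets M" using A setsG by blast
    note B[measurable]
    have K_AB: "emeasure (?K \<omega>) (A \<times> B) = indicator A \<omega> * emeasure (\<kappa> \<omega>) B" if "\<omega> \<in> space M" for \<omega>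
    proof -
      have "Pair \<omega> -` (A \<times> B) \<inter> space (\<kappa> \<omega>) = (if \<omega> \<in> A then B else {})"
        using sets.sets_into_space[OF B] sets_eq_imp_space_eq[OF \<kappa>p(2)[OF that]] by auto
      then show ?thesis using A B by (subst emeasure_distr[OF PairK[OF that]]) auto
    qed
    have meas: "(\<lambda>\<omega>. indicator A \<omega> * emeasure (\<kappa> \<omega>) B) \<in> borel_measurable G"
      using A measurable_compose[OF \<kappa>s measurable_emeasure_subprob_algebra[OF B]] by measurable
    have int: "integrable M (\<lambda>\<omega>. indicator A \<omega> * indicator B (X \<omega>) :: real)"
      by (rule M.integrable_const_bound[where B = 1]) (auto simp: indicator_def)
    have intB: "integrable M (\<lambda>\<omega>. indicator B (X \<omega>) :: real)"
      by (rule M.integrable_const_bound[where B = 1]) (auto simp: indicator_def)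
    have "emeasure ?P2 (A \<times> B) = (\<integral>\<^sup>+\<omega>. emeasure (?K \<omega>) (A \<times> B) \<partial>?R)"
      using A B by (intro emeasure_bind[OF ne K]) auto
    also have "\<dots> = (\<integral>\<^sup>+\<omega>. indicator A \<omega> * emeasure (\<kappa> \<omega>) B \<partial>?R)"
      using K_AB by (intro nn_integral_cong) (simp add: R spG)
    also have "\<dots> = (\<integral>\<^sup>+\<omega>. indicator A \<omega> * emeasure (\<kappa> \<omega>) B \<partial>M)"
      by (rule nn_integral_subalgebra2[OF sub meas])
    also have "\<dots> = (\<integral>\<^sup>+\<omega>. ennreal (indicator A \<omega> * measure (\<kappa> \<omega>) B) \<partial>M)"
      using \<kappa>p by (intro nn_integral_cong)
        (simp add: finite_measure.emeasure_eq_measure prob_space.finite_measure indicator_def)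
    also have "\<dots> = (\<integral>\<^sup>+\<omega>. ennreal (indicator A \<omega> * real_cond_exp M G (\<lambda>\<omega>. indicator B (X \<omega>)) \<omega>) \<partial>M)"
      using cond[OF B] by (intro nn_integral_cong_AE) auto
    also have "\<dots> = ennreal (\<integral>\<omega>. indicator A \<omega> * real_cond_exp M G (\<lambda>\<omega>. indicator B (X \<omega>)) \<omega> \<partial>M)"
    proof (rule nn_integral_eq_integral)
      show "integrable M (\<lambda>\<omega>. indicator A \<omega> * real_cond_exp M G (\<lambda>\<omega>. indicator B (X \<omega>)) \<omega>)"
        using A by (intro fm.real_cond_exp_intg(1) int) auto
      show "AE \<omega> in M. 0 \<le> indicator A \<omega> * real_cond_exp M G (\<lambda>\<omega>. indicator B (X \<omega>)) \<omega>"
        using cond[OF B] by eventually_elim simp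
    qed
    also have "\<dots> = ennreal (\<integral>\<omega>. indicator A \<omega> * indicator B (X \<omega>) \<partial>M)"
      using A by (subst fm.real_cond_exp_intg(2)[OF int]) auto
    also have "\<dots> = (\<integral>\<^sup>+\<omega>. ennreal (indicator A \<omega> * indicator B (X \<omega>)) \<partial>M)"
      by (rule nn_integral_eq_integral[symmetric, OF int]) simp
    also have "\<dots> = (\<integral>\<^sup>+\<omega>. indicator {\<omega> \<in> space M. \<omega> \<in> A \<and> X \<omega> \<in> B} \<omega> \<partial>M)"
      by (intro nn_integral_cong) (auto simp: indicator_def)
    also have "\<dots> = emeasure ?P1 (A \<times> B)"
      using P1[OF A B] by simp
    finally show ?thesis by simp
  qed
  have P12: "?P1 = ?P2"
  proof (rule measure_eqI_generator_eq)
    show "Int_stable ?E" by (rule Int_stable_pair_measure_generator)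
    show "?E \<subseteq> Pow (space G \<times> space N)" by (rule pair_measure_closed)
    show "sets ?P1 = sigma_sets (space G \<times> space N) ?E" by (simp add: sets_pair_measure)
    show "sets ?P2 = sigma_sets (space G \<times> space N) ?E" unfolding setsP2 by (rule sets_pair_measure)
    show "emeasure ?P1 Z = emeasure ?P2 Z" if "Z \<in> ?E" for Z using that by (auto simp only: eq mem_Collect_eq)
    show "range (\<lambda>i::nat. space G \<times> space N) \<subseteq> ?E" by auto
    show "(\<Union>i::nat. space G \<times> space N) = space G \<times> space N" by simp
    have "prob_space ?P1" by (rule M.prob_space_distr) measurable
    then show "emeasure ?P1 (space G \<times> space N) \<noteq> \<infinity>" for i :: nat
      by (simp add: prob_space.finite_measure finite_measure.emeasure_finite)
  qed
  have "(\<integral>\<^sup>+\<omega>. \<phi> (\<omega>, X \<omega>) \<partial>M) = (\<integral>\<^sup>+z. \<phi> z \<partial>?P1)"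
    using \<phi> by (subst nn_integral_distr) auto
  also have "\<dots> = (\<integral>\<^sup>+\<omega>. (\<integral>\<^sup>+z. \<phi> z \<partial>?K \<omega>) \<partial>?R)"
    unfolding P12 by (rule nn_integral_bind[OF \<phi> K])
  also have "\<dots> = (\<integral>\<^sup>+\<omega>. (\<integral>\<^sup>+v. \<phi> (\<omega>, v) \<partial>\<kappa> \<omega>) \<partial>?R)"
  proof (rule nn_integral_cong)
    fix \<omega> assume "\<omega> \<in> space ?R"
    then have "\<omega> \<in> space M" by (simp add: R spG)
    then show "(\<integral>\<^sup>+z. \<phi> z \<partial>?K \<omega>) = (\<integral>\<^sup>+v. \<phi> (\<omega>, v) \<partial>\<kappa> \<omega>)"
      using \<phi> by (intro nn_integral_distr PairK) simp_all
  qed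
  also have "\<dots> = (\<integral>\<^sup>+\<omega>. (\<integral>\<^sup>+v. \<phi> (\<omega>, v) \<partial>\<kappa> \<omega>) \<partial>M)"
    using \<phi> \<kappa>s by (intro nn_integral_subalgebra2[OF sub] nn_integral_measurable_subprob_algebra2[where N = N]) simp_all
  finally show ?thesis .
qed

section \<open>Accumulating the contraction over random cycles\<close>

text \<open>The part of the analysis that does not depend on what the iterates are. \<open>V k\<close> is the squared error on entering an
  iteration, \<open>W k\<close> the one on leaving it before a possible rescaling; \<open>cyc k\<close> is the current cycle and
  \<open>el k\<close> the time elapsed since it started. In cycle \<open>m\<close> one iteration contracts by \<open>\<rho> m\<close> in expectation, an
  adaptation into cycle \<open>m\<close> costs the factor \<open>a m\<close> and is possible only once the elapsed time has reached \<open>N m\<close>.\<close>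

locale cycle_process =
  fixes M :: "'w measure" and V W :: "nat \<Rightarrow> 'w \<Rightarrow> ennreal"
    and cyc el :: "nat \<Rightarrow> 'w \<Rightarrow> nat" and \<rho> a :: "nat \<Rightarrow> ennreal" and N :: "nat \<Rightarrow> nat"
  assumes measurable_VW [measurable]: "\<And>k. V k \<in> borel_measurable M" "\<And>k. W k \<in> borel_measurable M"
    and measurable_cyc [measurable]: "\<And>k. cyc k \<in> measurable M (count_space UNIV)"
      "\<And>k. el k \<in> measurable M (count_space UNIV)"
    and contraction: "\<And>k (\<phi> :: nat \<Rightarrow> nat \<Rightarrow> ennreal).
      (\<integral>\<^sup>+\<omega>. \<phi> (cyc k \<omega>) (el k \<omega>) * W k \<omega> \<partial>M)
        \<le> (\<integral>\<^sup>+\<omega>. \<phi> (cyc k \<omega>) (el k \<omega>) * (\<rho> (cyc k \<omega>) * V k \<omega>) \<partial>M)"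
    and transition: "\<And>k. AE \<omega> in M.
      (cyc (Suc k) \<omega> = cyc k \<omega> \<and> el (Suc k) \<omega> = Suc (el k \<omega>) \<and> V (Suc k) \<omega> = W k \<omega>) \<or>
      (cyc (Suc k) \<omega> = Suc (cyc k \<omega>) \<and> el (Suc k) \<omega> = 0
        \<and> V (Suc k) \<omega> \<le> a (Suc (cyc k \<omega>)) * W k \<omega> \<and> N (Suc (cyc k \<omega>)) \<le> Suc (el k \<omega>))"
begin

text \<open>A verification argument as in dynamic programming. Leaving the iteration of index \<open>k\<close> in cycle \<open>m\<close> at elapsed time \<open>e\<close> pays
  \<open>R k m e\<close> times the error, and \<open>h k m e\<close> bounds what a unit of error can still earn. Then \<open>h\<close> times \<open>V\<close>,
  plus the rewards collected so far, decreases in expectation. The random decisions to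
  adapt cause no trouble, because the two hypotheses on \<open>h\<close> cover either decision.\<close>

lemma sum_rewards_le:
  fixes h R :: "nat \<Rightarrow> nat \<Rightarrow> nat \<Rightarrow> ennreal"
  assumes stay: "\<And>k m e. \<rho> m * (R k m e + h (Suc k) m (Suc e)) \<le> h k m e"
    and adapt: "\<And>k m e. N (Suc m) \<le> Suc e \<Longrightarrow>
      \<rho> m * (R k m e + a (Suc m) * h (Suc k) (Suc m) 0) \<le> h k m e"
  shows "(\<Sum>k. \<integral>\<^sup>+\<omega>. R k (cyc k \<omega>) (el k \<omega>) * W k \<omega> \<partial>M)
           \<le> (\<integral>\<^sup>+\<omega>. h 0 (cyc 0 \<omega>) (el 0 \<omega>) * V 0 \<omega> \<partial>M)"
proof -
  let ?r = "\<lambda>k. \<integral>\<^sup>+\<omega>. R k (cyc k \<omega>) (el k \<omega>) * W k \<omega> \<partial>M"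
  let ?\<Phi> = "\<lambda>k. \<integral>\<^sup>+\<omega>. h k (cyc k \<omega>) (el k \<omega>) * V k \<omega> \<partial>M"
  have step: "?r k + ?\<Phi> (Suc k) \<le> ?\<Phi> k" for k
  proof -
    \<comment> \<open>the best continuation, maximized over the two decisions that may be available\<close>
    define \<psi> where "\<psi> m e = R k m e + max (h (Suc k) m (Suc e))
        (if N (Suc m) \<le> Suc e then a (Suc m) * h (Suc k) (Suc m) 0 else 0)" for m e
    have \<psi>: "\<rho> m * \<psi> m e \<le> h k m e" for m e
    proof -
      have "\<psi> m e = R k m e + h (Suc k) m (Suc e) \<or>
          N (Suc m) \<le> Suc e \<and> \<psi> m e = R k m e + a (Suc m) * h (Suc k) (Suc m) 0"
        unfolding \<psi>_def by (auto simp: max_def)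
      then show ?thesis using stay[of m k e] adapt[of m e k] by auto
    qed
    have "?r k + ?\<Phi> (Suc k) = (\<integral>\<^sup>+\<omega>. R k (cyc k \<omega>) (el k \<omega>) * W k \<omega>
        + h (Suc k) (cyc (Suc k) \<omega>) (el (Suc k) \<omega>) * V (Suc k) \<omega> \<partial>M)"
      by (rule nn_integral_add[symmetric]) measurable
    also have "\<dots> \<le> (\<integral>\<^sup>+\<omega>. \<psi> (cyc k \<omega>) (el k \<omega>) * W k \<omega> \<partial>M)"
    proof (rule nn_integral_mono_AE)
      show "AE \<omega> in M. R k (cyc k \<omega>) (el k \<omega>) * W k \<omega>
          + h (Suc k) (cyc (Suc k) \<omega>) (el (Suc k) \<omega>) * V (Suc k) \<omega> \<le> \<psi> (cyc k \<omega>) (el k \<omega>) * W k \<omega>"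
        using transition[of k]
      proof eventually_elim
        case (elim \<omega>)
        let ?m = "cyc k \<omega>" and ?e = "el k \<omega>"
        have "h (Suc k) (cyc (Suc k) \<omega>) (el (Suc k) \<omega>) * V (Suc k) \<omega>
            \<le> max (h (Suc k) ?m (Suc ?e))
              (if N (Suc ?m) \<le> Suc ?e then a (Suc ?m) * h (Suc k) (Suc ?m) 0 else 0) * W k \<omega>"
          using elim
        proof (elim disjE conjE)
          assume *: "cyc (Suc k) \<omega> = Suc (cyc k \<omega>)" "el (Suc k) \<omega> = 0"
            "V (Suc k) \<omega> \<le> a (Suc (cyc k \<omega>)) * W k \<omega>" "N (Suc (cyc k \<omega>)) \<le> Suc (el k \<omega>)"
          have "h (Suc k) (cyc (Suc k) \<omega>) (el (Suc k) \<omega>) * V (Suc k) \<omega>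
              \<le> h (Suc k) (Suc ?m) 0 * (a (Suc ?m) * W k \<omega>)"
            unfolding *(1,2) by (rule mult_left_mono[OF *(3)]) simp
          also have "\<dots> = (a (Suc ?m) * h (Suc k) (Suc ?m) 0) * W k \<omega>" by (simp add: mult_ac)
          also have "\<dots> \<le> max (h (Suc k) ?m (Suc ?e)) (a (Suc ?m) * h (Suc k) (Suc ?m) 0) * W k \<omega>"
            by (rule mult_right_mono) auto
          finally show ?thesis using *(4) by simp
        qed (auto intro!: mult_right_mono)
        then have "R k ?m ?e * W k \<omega> + h (Suc k) (cyc (Suc k) \<omega>) (el (Suc k) \<omega>) * V (Suc k) \<omega>
            \<le> R k ?m ?e * W k \<omega> + max (h (Suc k) ?m (Suc ?e))
              (if N (Suc ?m) \<le> Suc ?e then a (Suc ?m) * h (Suc k) (Suc ?m) 0 else 0) * W k \<omega>"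
          by (rule add_left_mono)
        then show ?case unfolding \<psi>_def by (simp only: distrib_right)
      qed
    qed
    also have "\<dots> \<le> (\<integral>\<^sup>+\<omega>. \<psi> (cyc k \<omega>) (el k \<omega>) * (\<rho> (cyc k \<omega>) * V k \<omega>) \<partial>M)"
      by (rule contraction)
    also have "\<dots> = (\<integral>\<^sup>+\<omega>. (\<rho> (cyc k \<omega>) * \<psi> (cyc k \<omega>) (el k \<omega>)) * V k \<omega> \<partial>M)"
      by (simp only: mult_ac)
    also have "\<dots> \<le> ?\<Phi> k"
      by (intro nn_integral_mono mult_right_mono \<psi>) simp
    finally show ?thesis .
  qed
  have "(\<Sum>k<n. ?r k) + ?\<Phi> n \<le> ?\<Phi> 0" for n
  proof (induction n)
    case (Suc n)
    have "(\<Sum>k<Suc n. ?r k) + ?\<Phi> (Suc n) = (\<Sum>k<n. ?r k) + (?r n + ?\<Phi> (Suc n))"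
      by (simp add: add.assoc)
    also have "\<dots> \<le> (\<Sum>k<n. ?r k) + ?\<Phi> n" by (intro add_left_mono step)
    finally show ?case using Suc by (rule order_trans)
  qed simp
  then have "(\<Sum>k<n. ?r k) \<le> ?\<Phi> 0" for n
    by (rule order_trans[OF add_increasing2[OF zero_le order_refl]])
  then show ?thesis by (intro suminf_le_const summableI)
qed

text \<open>Here rewards are paid in one cycle \<open>l\<close> only, with value function \<open>h\<close> inside it. In an earlier cycle \<open>m\<close>, the
  worst decision is to adapt as early as allowed, since further iterations only contract; this leaves the
  factor \<open>\<rho> m\<close> to the power of the waiting time that remains. The exponent in cycle \<open>0\<close> is \<open>N 1 - 1\<close> because the elapsed time
  there starts from \<open>1\<close>.\<close>

lemma target_cycle_bound:
  fixes R h :: "nat \<Rightarrow> nat \<Rightarrow> ennreal" and H :: ennreal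
  assumes \<rho>_le_1: "\<And>m. \<rho> m \<le> 1"
    and target: "\<And>k e. \<rho> l * (R k e + h (Suc k) (Suc e)) \<le> h k e" and entry: "\<And>k. h k 0 \<le> H"
    and init: "\<And>\<omega>. \<omega> \<in> space M \<Longrightarrow> cyc 0 \<omega> = 0" "\<And>\<omega>. \<omega> \<in> space M \<Longrightarrow> el 0 \<omega> = 1"
      "\<And>\<omega>. \<omega> \<in> space M \<Longrightarrow> V 0 \<omega> = v" "emeasure M (space M) = 1"
  shows "(\<Sum>k. \<integral>\<^sup>+\<omega>. (if cyc k \<omega> = l then R k (el k \<omega>) else 0) * W k \<omega> \<partial>M)
           \<le> (if l = 0 then h 0 1
              else \<rho> 0 ^ (N 1 - 1) * (a 1 * ((\<Prod>r=2..l. \<rho> (r - 1) ^ N r * a r) * H))) * v"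
proof -
  \<comment> \<open>the value of a unit of error on entering cycle \<open>m\<close>\<close>
  define G where "G m = (\<Prod>r=Suc m..l. \<rho> (r - 1) ^ N r * a r) * H" for m
  have G_l: "G l = H" by (simp add: G_def)
  have G_step: "G m = \<rho> m ^ N (Suc m) * a (Suc m) * G (Suc m)" if "m < l" for m
  proof -
    have "{Suc m..l} = insert (Suc m) {Suc (Suc m)..l}" using that by auto
    then show ?thesis unfolding G_def by (simp add: mult_ac)
  qed
  define g where "g k m e = (if m < l then \<rho> m ^ (N (Suc m) - e) * (a (Suc m) * G (Suc m))
      else if m = l then h k e else 0)" for k m e
  define S where "S k m e = (if m = l then R k e else 0)" for k m e
  have pow: "\<rho> m * \<rho> m ^ (n - Suc e) \<le> \<rho> m ^ (n - e)" for m n e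
  proof (cases "e < n")
    case True
    then have "n - e = Suc (n - Suc e)" by simp
    then show ?thesis by simp
  qed (use \<rho>_le_1 in simp)
  have entry_g: "g k (Suc m) 0 \<le> G (Suc m)" if "m < l" for k m
    using that entry[of k] G_step[of "Suc m"] G_l
    by (cases "Suc m = l") (auto simp: g_def mult_ac)
  have "(\<Sum>k. \<integral>\<^sup>+\<omega>. S k (cyc k \<omega>) (el k \<omega>) * W k \<omega> \<partial>M)
      \<le> (\<integral>\<^sup>+\<omega>. g 0 (cyc 0 \<omega>) (el 0 \<omega>) * V 0 \<omega> \<partial>M)"
  proof (rule sum_rewards_le)
    fix k m e
    consider "m < l" | "m = l" | "l < m" by linarith
    then show "\<rho> m * (S k m e + g (Suc k) m (Suc e)) \<le> g k m e"
    proof cases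
      case 1
      then have "\<rho> m * (S k m e + g (Suc k) m (Suc e))
          = (\<rho> m * \<rho> m ^ (N (Suc m) - Suc e)) * (a (Suc m) * G (Suc m))"
        by (simp add: S_def g_def mult.assoc)
      also have "\<dots> \<le> g k m e" using 1 by (simp add: g_def mult_right_mono[OF pow])
      finally show ?thesis .
    qed (use target in \<open>auto simp: S_def g_def\<close>)
  next
    fix k m e assume N: "N (Suc m) \<le> Suc e"
    consider "m < l" | "m = l" | "l < m" by linarith
    then show "\<rho> m * (S k m e + a (Suc m) * g (Suc k) (Suc m) 0) \<le> g k m e"
    proof cases
      case 1
      then have "\<rho> m * (S k m e + a (Suc m) * g (Suc k) (Suc m) 0)
          \<le> \<rho> m * (a (Suc m) * G (Suc m))"
        by (simp add: S_def mult_left_mono entry_g)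
      also have "\<dots> \<le> (\<rho> m * \<rho> m ^ (N (Suc m) - Suc e)) * (a (Suc m) * G (Suc m))"
        using N by simp
      also have "\<dots> \<le> g k m e" using 1 by (simp add: g_def mult_right_mono[OF pow])
      finally show ?thesis .
    next
      case 2
      then have "\<rho> m * (S k m e + a (Suc m) * g (Suc k) (Suc m) 0) \<le> \<rho> l * (R k e + h (Suc k) (Suc e))"
        by (simp add: S_def g_def mult_left_mono)
      also have "\<dots> \<le> g k m e" using target[of k e] 2 by (simp add: g_def)
      finally show ?thesis .
    qed (simp add: S_def g_def)
  qed
  also have "\<dots> = (\<integral>\<^sup>+\<omega>. g 0 0 1 * v \<partial>M)" by (intro nn_integral_cong) (simp add: init)
  also have "\<dots> = g 0 0 1 * v" by (simp add: init)
  also have "g 0 0 1 = (if l = 0 then h 0 1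
      else \<rho> 0 ^ (N 1 - 1) * (a 1 * ((\<Prod>r=2..l. \<rho> (r - 1) ^ N r * a r) * H)))"
    by (simp add: g_def G_def numeral_2_eq_2)
  finally show ?thesis unfolding S_def .
qed

end

section \<open>The algorithm\<close>

text \<open>The algorithm driven by random selections, with the analytic input reduced to a contraction factor \<open>\<kappa>\<close> of
  the gradient step and the nonexpansiveness of the proximal operator. All random quantities of index \<open>k\<close> below are
  known after iteration \<open>k\<close>, except \<open>Zpre\<close> and \<open>W\<close>, which involve the selection of iteration \<open>k + 1\<close>.\<close>

locale arpsd_process = prob_space M for M :: "'w measure" +
  fixes f :: "real^'n \<Rightarrow> real" and g :: "real^'n \<Rightarrow> ereal" and \<gamma> \<kappa> :: real and xstar z0 :: "real^'n"
    and S :: "nat \<Rightarrow> 'w \<Rightarrow> (real^'n) set" and D :: "nat \<Rightarrow> 'w \<Rightarrow> bool"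
    and law0 :: "(real^'n) set measure" and law :: "nat \<Rightarrow> 'w \<Rightarrow> (real^'n) set measure"
  assumes gradient_step: "\<And>x y. (norm ((x - \<gamma> *\<^sub>R gradient f x) - (y - \<gamma> *\<^sub>R gradient f y)))\<^sup>2
      \<le> \<kappa> * (norm (x - y))\<^sup>2"
    and \<kappa>: "0 \<le> \<kappa>" "\<kappa> \<le> 1"
    and nonexpansive: "\<And>x y. norm (prox \<gamma> g x - prox \<gamma> g y) \<le> norm (x - y)"
    and fixed_point: "prox \<gamma> g (xstar - \<gamma> *\<^sub>R gradient f xstar) = xstar"
    and S_measurable: "\<And>k. k \<ge> 1 \<Longrightarrow> S k \<in> measurable M subspace_algebra"
    and D_measurable: "\<And>k. k \<ge> 1 \<Longrightarrow> Measurable.pred (selection_filtration M S k) (D k)"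
    and law_0: "law 0 = (\<lambda>_. law0)"
    and law_measurable: "\<And>m j. law m \<in> measurable
      (restrict_space (selection_filtration M S (j - 1)) {\<omega>. adapt_time (\<lambda>k. D k \<omega>) m = enat j})
      (prob_algebra subspace_algebra)"
    and law_admissible: "\<And>m \<omega>. \<omega> \<in> space M \<Longrightarrow> adapt_time (\<lambda>k. D k \<omega>) m < \<infinity> \<Longrightarrow> admissible (law m \<omega>)"
    and selections_iid: "\<And>m k B. k \<ge> 1 \<Longrightarrow> B \<in> sets subspace_algebra \<Longrightarrow>
      AE \<omega> in M. adapt_time (\<lambda>k. D k \<omega>) m \<le> enat k \<and> enat k < adapt_time (\<lambda>k. D k \<omega>) (Suc m) \<longrightarrow>
        real_cond_exp M (selection_filtration M S (k - 1)) (\<lambda>\<omega>. indicator B (S k \<omega>)) \<omega> = measure (law m \<omega>) B"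
begin

abbreviation F :: "nat \<Rightarrow> 'w measure" where "F \<equiv> selection_filtration M S"

definition cyc :: "nat \<Rightarrow> 'w \<Rightarrow> nat" where "cyc k \<omega> = cycle_index (\<lambda>j. D j \<omega>) k"

definition start :: "nat \<Rightarrow> 'w \<Rightarrow> nat" where "start k \<omega> = cycle_start (\<lambda>j. D j \<omega>) k"

definition cur_law :: "nat \<Rightarrow> 'w \<Rightarrow> (real^'n) set measure" where "cur_law k \<omega> = law (cyc k \<omega>) \<omega>"

definition proj_sqrt :: "nat \<Rightarrow> 'w \<Rightarrow> real^'n^'n" where
  "proj_sqrt k \<omega> = matrix_sqrt (avg_proj (cur_law k \<omega>))"

definition proj_inv_sqrt :: "nat \<Rightarrow> 'w \<Rightarrow> real^'n^'n" where
  "proj_inv_sqrt k \<omega> = inv_sqrt (avg_proj (cur_law k \<omega>))"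

definition forward :: "real^'n \<Rightarrow> real^'n" where "forward x = x - \<gamma> *\<^sub>R gradient f x"

definition state :: "nat \<Rightarrow> 'w \<Rightarrow> (real^'n) \<times> (real^'n) \<times> nat" where
  "state k \<omega> = arpsd f g \<gamma> z0 (\<lambda>m. inv_sqrt (avg_proj (law m \<omega>))) (\<lambda>j. S j \<omega>) (\<lambda>j. D j \<omega>) k"

definition X :: "nat \<Rightarrow> 'w \<Rightarrow> real^'n" where "X k \<omega> = fst (state k \<omega>)"

definition Z :: "nat \<Rightarrow> 'w \<Rightarrow> real^'n" where "Z k \<omega> = fst (snd (state k \<omega>))"

text \<open>The vector \<open>z\<close> of iteration \<open>k + 1\<close> before the rescaling that accompanies an adaptation.\<close>

definition Zpre :: "nat \<Rightarrow> 'w \<Rightarrow> real^'n" where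
  "Zpre k \<omega> = proj_mat (S (Suc k) \<omega>) *v (proj_inv_sqrt k \<omega> *v forward (X k \<omega>))
     + (mat 1 - proj_mat (S (Suc k) \<omega>)) *v Z k \<omega>"

text \<open>The value of \<open>z\<close> at which the iteration would rest; it changes from cycle to cycle along with the matrices \<open>Q\<close>.\<close>

definition zstar :: "nat \<Rightarrow> 'w \<Rightarrow> real^'n" where
  "zstar k \<omega> = proj_inv_sqrt k \<omega> *v forward xstar"

definition V :: "nat \<Rightarrow> 'w \<Rightarrow> ennreal" where
  "V k \<omega> = ennreal ((norm (Z k \<omega> - zstar k \<omega>))\<^sup>2)"

definition W :: "nat \<Rightarrow> 'w \<Rightarrow> ennreal" where
  "W k \<omega> = ennreal ((norm (Zpre k \<omega> - zstar k \<omega>))\<^sup>2)"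

text \<open>At index \<open>0\<close> this is \<open>1\<close>, as the first iteration takes place at time \<open>1\<close> of the cycle that started at time \<open>0\<close>.\<close>

definition elapsed :: "nat \<Rightarrow> 'w \<Rightarrow> nat" where "elapsed k \<omega> = Suc k - start k \<omega>"

lemma space_F [simp]: "space (F k) = space M"
  unfolding selection_filtration_def by (simp add: space_measure_of_conv)

lemma adapt_time_cyc: "adapt_time (\<lambda>j. D j \<omega>) (cyc k \<omega>) = enat (start k \<omega>)"
  unfolding cyc_def start_def by (rule adapt_time_cycle_index)

lemma law_in_prob_algebra:
  assumes "\<omega> \<in> space M" "adapt_time (\<lambda>k. D k \<omega>) m < \<infinity>"
  shows "law m \<omega> \<in> space (prob_algebra subspace_algebra)"
proof -
  obtain j where "adapt_time (\<lambda>k. D k \<omega>) m = enat j" using assms(2) by auto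
  then show ?thesis
    using assms(1) by (intro measurable_space[OF law_measurable[of m j]]) (simp add: space_restrict_space)
qed

lemma contracting_pd_law:
  assumes "\<omega> \<in> space M" "adapt_time (\<lambda>k. D k \<omega>) m < \<infinity>"
  shows "contracting_pd (avg_proj (law m \<omega>))"
  by (intro contracting_pd_avg_proj law_in_prob_algebra law_admissible assms)

lemma cur_law_in_prob_algebra: "\<omega> \<in> space M \<Longrightarrow> cur_law k \<omega> \<in> space (prob_algebra subspace_algebra)"
  and contracting_pd_cur: "\<omega> \<in> space M \<Longrightarrow> contracting_pd (avg_proj (cur_law k \<omega>))"
  unfolding cur_law_def by (simp_all add: law_in_prob_algebra contracting_pd_law adapt_time_cyc)

lemma proj_sqrt_cancel:
  assumes "\<omega> \<in> space M"
  shows "proj_sqrt k \<omega> *v (proj_inv_sqrt k \<omega> *v x) = x"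
    and "proj_inv_sqrt k \<omega> *v (proj_sqrt k \<omega> *v x) = x"
    and "matrix_inv (proj_inv_sqrt k \<omega>) = proj_sqrt k \<omega>"
  unfolding proj_sqrt_def proj_inv_sqrt_def
  using inv_sqrt_contracting_pd[OF contracting_pd_cur[OF assms]] by auto

lemma cyc_Suc: "cyc (Suc k) \<omega> = (if D (Suc k) \<omega> then Suc (cyc k \<omega>) else cyc k \<omega>)"
  and start_Suc: "start (Suc k) \<omega> = (if D (Suc k) \<omega> then k + 2 else start k \<omega>)"
  and cyc_0: "cyc 0 \<omega> = 0" and start_0: "start 0 \<omega> = 0"
  unfolding cyc_def start_def by simp_all

lemma cur_law_Suc_stay: "\<not> D (Suc k) \<omega> \<Longrightarrow> cur_law (Suc k) \<omega> = cur_law k \<omega>"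
  unfolding cur_law_def cyc_Suc by simp

lemma state_cyc: "snd (snd (state k \<omega>)) = cyc k \<omega>"
  unfolding state_def cyc_def by (induction k) (auto simp: Let_def split: prod.splits)

lemma state_Suc:
  assumes "\<omega> \<in> space M"
  shows "X (Suc k) \<omega> = prox \<gamma> g (proj_sqrt k \<omega> *v Zpre k \<omega>)"
    and "Z (Suc k) \<omega> = (if D (Suc k) \<omega> then proj_inv_sqrt (Suc k) \<omega> *v (proj_sqrt k \<omega> *v Zpre k \<omega>)
      else Zpre k \<omega>)"
proof -
  obtain x z where st: "state k \<omega> = (x, z, cyc k \<omega>)" using state_cyc[of k \<omega>] by (metis prod.collapse)
  then have XZ: "X k \<omega> = x" "Z k \<omega> = z" by (simp_all add: X_def Z_def)
  have Q: "inv_sqrt (avg_proj (law (cyc k \<omega>) \<omega>)) = proj_inv_sqrt k \<omega>"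
    by (simp add: proj_inv_sqrt_def cur_law_def)
  have "state (Suc k) \<omega> = (prox \<gamma> g (proj_sqrt k \<omega> *v Zpre k \<omega>),
      (if D (Suc k) \<omega> then (inv_sqrt (avg_proj (law (Suc (cyc k \<omega>)) \<omega>)) ** proj_sqrt k \<omega>) *v Zpre k \<omega>
       else Zpre k \<omega>), cyc (Suc k) \<omega>)"
    using st unfolding state_def arpsd.simps
    by (simp add: Let_def Q proj_sqrt_cancel(3)[OF assms] Zpre_def XZ forward_def cyc_Suc)
  then show "X (Suc k) \<omega> = prox \<gamma> g (proj_sqrt k \<omega> *v Zpre k \<omega>)"
    and "Z (Suc k) \<omega> = (if D (Suc k) \<omega> then proj_inv_sqrt (Suc k) \<omega> *v (proj_sqrt k \<omega> *v Zpre k \<omega>)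
      else Zpre k \<omega>)"
    by (simp_all add: X_def Z_def proj_inv_sqrt_def cur_law_def cyc_Suc matrix_vector_mul_assoc)
qed

lemma state_0:
  assumes "\<omega> \<in> space M"
  shows "X 0 \<omega> = prox \<gamma> g (proj_sqrt 0 \<omega> *v z0)" and "Z 0 \<omega> = z0"
  using proj_sqrt_cancel(3)[OF assms, of 0]
  by (simp_all add: X_def Z_def state_def proj_inv_sqrt_def cur_law_def cyc_0)

text \<open>Rescaling \<open>z\<close> is designed to keep this invariant: it changes \<open>z\<close> and \<open>Q\<close> but not \<open>Q\<^sup>-\<^sup>1 z\<close>.\<close>

lemma X_eq_prox:
  assumes "\<omega> \<in> space M"
  shows "X k \<omega> = prox \<gamma> g (proj_sqrt k \<omega> *v Z k \<omega>)"
proof (cases k)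
  case (Suc j)
  show ?thesis
    using state_Suc[OF assms, of j] proj_sqrt_cancel(1)[OF assms]
    by (simp add: Suc proj_sqrt_def cur_law_Suc_stay)
qed (use state_0[OF assms] in simp)

text \<open>The target \<open>xstar\<close> is the proximal point of \<open>Q\<^sup>-\<^sup>1 zstar\<close>, and the squared norm of \<open>Q\<^sup>-\<^sup>1 v\<close> is the form of
  the average projection at \<open>v\<close>. The first bound drives the contraction; the second one converts errors in \<open>z\<close>
  to errors in \<open>x\<close> at the very end.\<close>

lemma prox_error_le:
  assumes "\<omega> \<in> space M"
  shows "(norm (prox \<gamma> g (proj_sqrt k \<omega> *v z) - xstar))\<^sup>2
      \<le> (z - zstar k \<omega>) \<bullet> (avg_proj (cur_law k \<omega>) *v (z - zstar k \<omega>))"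
    and "(norm (prox \<gamma> g (proj_sqrt k \<omega> *v z) - xstar))\<^sup>2 \<le> (norm (z - zstar k \<omega>))\<^sup>2"
proof -
  have "norm (prox \<gamma> g (proj_sqrt k \<omega> *v z) - xstar)
      \<le> norm (proj_sqrt k \<omega> *v z - forward xstar)"
    using nonexpansive[of "proj_sqrt k \<omega> *v z" "forward xstar"] fixed_point
    by (simp add: forward_def)
  also have "proj_sqrt k \<omega> *v z - forward xstar = proj_sqrt k \<omega> *v (z - zstar k \<omega>)"
    by (simp add: zstar_def matrix_vector_mult_diff_distrib proj_sqrt_cancel(1)[OF assms])
  finally have le: "norm (prox \<gamma> g (proj_sqrt k \<omega> *v z) - xstar) \<le> norm (proj_sqrt k \<omega> *v (z - zstar k \<omega>))" .
  note norm_sqrt = norm_matrix_sqrt[OF contracting_pd_cur[OF assms], folded proj_sqrt_def]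
  show "(norm (prox \<gamma> g (proj_sqrt k \<omega> *v z) - xstar))\<^sup>2
      \<le> (z - zstar k \<omega>) \<bullet> (avg_proj (cur_law k \<omega>) *v (z - zstar k \<omega>))"
    unfolding norm_sqrt(1)[symmetric] using le by (intro power_mono) auto
  show "(norm (prox \<gamma> g (proj_sqrt k \<omega> *v z) - xstar))\<^sup>2 \<le> (norm (z - zstar k \<omega>))\<^sup>2"
    using le norm_sqrt(2)[of k "z - zstar k \<omega>"] by (intro power_mono) auto
qed

lemma X_error_le:
  assumes "\<omega> \<in> space M"
  shows "ennreal ((norm (X (Suc k) \<omega> - xstar))\<^sup>2) \<le> W k \<omega>"
    and "ennreal ((norm (X 0 \<omega> - xstar))\<^sup>2) \<le> V 0 \<omega>"
  unfolding W_def V_def using prox_error_le(2)[OF assms] state_Suc(1)[OF assms] X_eq_prox[OF assms]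
  by (auto intro!: ennreal_leI)

subsection \<open>Measurability of the iterates\<close>

lemma sets_F: "sets (F k) = sigma_sets (space M) (\<Union>j\<in>{1..k}. {S j -` B \<inter> space M | B. B \<in> sets subspace_algebra})"
  unfolding selection_filtration_def by (rule sets_measure_of) auto

lemma sets_F_mono: "j \<le> k \<Longrightarrow> sets (F j) \<subseteq> sets (F k)"
  unfolding sets_F by (rule sigma_sets_mono') force

lemma subalgebra_F: "subalgebra M (F k)"
proof -
  have "sets (F k) \<subseteq> sets M"
    unfolding sets_F using S_measurable
    by (intro sets.sigma_sets_subset) (auto intro: measurable_sets)
  then show ?thesis by (simp add: subalgebra_def)
qed

lemma measurable_F_mono:
  assumes "h \<in> measurable (F j) N" "j \<le> k"
  shows "h \<in> measurable (F k) N"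
  using assms(1) sets_F_mono[OF assms(2)] unfolding measurable_def by auto

lemma measurable_from_F: "h \<in> measurable (F k) N \<Longrightarrow> h \<in> measurable M N"
  by (rule measurable_from_subalg[OF subalgebra_F])

lemma S_measurable_F: "S (Suc k) \<in> measurable (F (Suc k)) subspace_algebra"
proof (rule measurableI)
  show "S (Suc k) \<omega> \<in> space subspace_algebra" if "\<omega> \<in> space (F (Suc k))" for \<omega>
    using measurable_space[OF S_measurable[of "Suc k"]] that by simp
  show "S (Suc k) -` B \<inter> space (F (Suc k)) \<in> sets (F (Suc k))" if "B \<in> sets subspace_algebra" for B
    unfolding sets_F space_F using that by (intro sigma_sets.Basic) (auto intro!: bexI[of _ "Suc k"])
qed

lemma measurable_cyc: "cyc k \<in> measurable (F k) (count_space UNIV)"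
  and measurable_start: "start k \<in> measurable (F k) (count_space UNIV)"
proof (induction k)
  case 0
  show "cyc 0 \<in> measurable (F 0) (count_space UNIV)" "start 0 \<in> measurable (F 0) (count_space UNIV)"
    unfolding cyc_def start_def by simp_all
next
  case (Suc k)
  have [measurable]: "Measurable.pred (F (Suc k)) (D (Suc k))" by (rule D_measurable) simp
  have [measurable]: "cyc k \<in> measurable (F (Suc k)) (count_space UNIV)"
    "start k \<in> measurable (F (Suc k)) (count_space UNIV)"
    using Suc measurable_F_mono by (meson le_SucI order_refl)+
  show "cyc (Suc k) \<in> measurable (F (Suc k)) (count_space UNIV)"
    unfolding cyc_Suc[abs_def] by measurable
  show "start (Suc k) \<in> measurable (F (Suc k)) (count_space UNIV)"
    unfolding start_Suc[abs_def] by measurable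
qed

text \<open>On the event that the current cycle is \<open>m\<close> and started at time \<open>j\<close>, the current law is \<open>law m\<close>, which was
  fixed by the information available at time \<open>j - 1 \<le> k\<close>; countably many such events cover the space.\<close>

lemma measurable_cur_law: "cur_law k \<in> measurable (F k) (prob_algebra subspace_algebra)"
proof (rule measurable_piecewise_restrict)
  let ?C = "range (\<lambda>(m, j). {\<omega> \<in> space M. cyc k \<omega> = m \<and> start k \<omega> = j})"
  show "countable ?C" by simp
  show "space (F k) \<subseteq> \<Union>?C" by auto
  fix E assume "E \<in> ?C"
  then obtain m j where E: "E = {\<omega> \<in> space M. cyc k \<omega> = m \<and> start k \<omega> = j}" by auto
  note measurable_cyc[measurable] measurable_start[measurable]
  have "{\<omega> \<in> space (F k). cyc k \<omega> = m \<and> start k \<omega> = j} \<in> sets (F k)" by measurable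
  moreover have "E \<inter> space (F k) = {\<omega> \<in> space (F k). cyc k \<omega> = m \<and> start k \<omega> = j}"
    unfolding E by auto
  ultimately show "E \<inter> space (F k) \<in> sets (F k)" by simp
  show "cur_law k \<in> measurable (restrict_space (F k) E) (prob_algebra subspace_algebra)"
  proof (cases "E = {}")
    case False
    then obtain \<omega>0 where "\<omega>0 \<in> E" by blast
    then have "j \<le> Suc k" using cycle_start_le[of "\<lambda>i. D i \<omega>0" k] unfolding E start_def by auto
    then have le: "j - 1 \<le> k" by simp
    let ?A = "{\<omega>. adapt_time (\<lambda>k. D k \<omega>) m = enat j}"
    have EA: "E \<subseteq> ?A" unfolding E using adapt_time_cyc by auto
    have "law m \<in> measurable (restrict_space (F k) ?A) (prob_algebra subspace_algebra)"
    proof (rule measurable_from_subalg[OF _ law_measurable[of m j]])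
      show "subalgebra (restrict_space (F k) ?A) (restrict_space (F (j - 1)) ?A)"
        using image_mono[OF sets_F_mono[OF le]]
        by (simp add: subalgebra_def sets_restrict_space space_restrict_space)
    qed
    then have "law m \<in> measurable (restrict_space (restrict_space (F k) ?A) E) (prob_algebra subspace_algebra)"
      by (rule measurable_restrict_space1)
    moreover have "sets (restrict_space (restrict_space (F k) ?A) E) = sets (restrict_space (F k) E)"
      using EA by (simp add: sets_restrict_restrict_space Int_absorb1)
    ultimately have "law m \<in> measurable (restrict_space (F k) E) (prob_algebra subspace_algebra)"
      using measurable_cong_sets by blast
    then show ?thesis
      by (subst measurable_cong[where g = "law m"]) (auto simp: space_restrict_space E cur_law_def)
  qed (simp add: measurable_def space_restrict_space)
qed

lemma measurable_proj_sqrt: "proj_sqrt k \<in> borel_measurable (F k)"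
  and measurable_proj_inv_sqrt: "proj_inv_sqrt k \<in> borel_measurable (F k)"
proof -
  have avg: "(\<lambda>\<omega>. avg_proj (cur_law k \<omega>)) \<in> borel_measurable (F k)"
    using measurable_compose[OF measurable_prob_algebraD[OF measurable_cur_law] measurable_avg_proj] .
  show B: "proj_sqrt k \<in> borel_measurable (F k)"
    unfolding proj_sqrt_def[abs_def] using avg
    by (rule borel_measurable_matrix_sqrt) (simp add: contracting_pd_cur)
  have "(\<lambda>\<omega>. matrix_inv (proj_sqrt k \<omega>)) \<in> borel_measurable (F k)"
    using B by (rule borel_measurable_matrix_inv)
      (simp add: proj_sqrt_def inv_sqrt_contracting_pd(4)[OF contracting_pd_cur])
  then show "proj_inv_sqrt k \<in> borel_measurable (F k)"
    by (simp add: proj_inv_sqrt_def[abs_def] proj_sqrt_def inv_sqrt_def)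
qed

lemma borel_measurable_nonexpansive:
  fixes T :: "real^'n \<Rightarrow> real^'n"
  assumes "\<And>x y. norm (T x - T y) \<le> norm (x - y)"
  shows "T \<in> borel_measurable borel"
proof -
  have "1-lipschitz_on UNIV T" using assms by (intro lipschitz_onI) (simp_all add: dist_norm)
  then show ?thesis by (intro borel_measurable_continuous_onI lipschitz_on_continuous_on)
qed

lemma measurable_prox: "prox \<gamma> g \<in> borel_measurable borel"
  by (rule borel_measurable_nonexpansive[OF nonexpansive])

lemma measurable_forward: "forward \<in> borel_measurable borel"
proof (rule borel_measurable_nonexpansive, rule power2_le_imp_le)
  show "(norm (forward x - forward y))\<^sup>2 \<le> (norm (x - y))\<^sup>2" for x y
    using gradient_step[of x y] mult_right_mono[OF \<kappa>(2) zero_le_power2[of "norm (x - y)"]]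
    unfolding forward_def by linarith
qed simp

lemma measurable_X: "X k \<in> borel_measurable (F k)"
  and measurable_Z: "Z k \<in> borel_measurable (F k)"
proof -
  have Xf: "X k \<in> borel_measurable (F k)" if Z: "Z k \<in> borel_measurable (F k)" for k
  proof -
    note [measurable] = Z measurable_prox measurable_proj_sqrt[of k]
    have "(\<lambda>\<omega>. prox \<gamma> g (proj_sqrt k \<omega> *v Z k \<omega>)) \<in> borel_measurable (F k)" by measurable
    then show ?thesis by (subst measurable_cong[OF X_eq_prox]) simp_all
  qed
  show Z: "Z k \<in> borel_measurable (F k)" for k
  proof (induction k)
    case 0
    show ?case by (subst measurable_cong[OF state_0(2)]) simp_all
  next
    case (Suc k)
    note up = measurable_F_mono[OF _ le_SucI[OF order_refl]]
    note [measurable] = up[OF Suc] up[OF Xf[OF Suc]] up[OF measurable_proj_sqrt]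
      up[OF measurable_proj_inv_sqrt] measurable_proj_inv_sqrt[of "Suc k"] measurable_forward S_measurable_F
    have [measurable]: "Measurable.pred (F (Suc k)) (D (Suc k))" by (rule D_measurable) simp
    have [measurable]: "Zpre k \<in> borel_measurable (F (Suc k))" unfolding Zpre_def[abs_def] by measurable
    have "(\<lambda>\<omega>. if D (Suc k) \<omega> then proj_inv_sqrt (Suc k) \<omega> *v (proj_sqrt k \<omega> *v Zpre k \<omega>)
      else Zpre k \<omega>) \<in> borel_measurable (F (Suc k))" by measurable
    then show ?case by (subst measurable_cong[OF state_Suc(2)]) simp_all
  qed
  show "X k \<in> borel_measurable (F k)" by (rule Xf[OF Z])
qed

lemma measurable_V: "V k \<in> borel_measurable (F k)"
proof -
  note [measurable] = measurable_Z[of k] measurable_proj_inv_sqrt[of k]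
  show ?thesis unfolding V_def[abs_def] zstar_def by measurable
qed

lemma measurable_W: "W k \<in> borel_measurable M"
proof -
  note [measurable] = measurable_from_F[OF measurable_Z[of k]] measurable_from_F[OF measurable_X[of k]]
    measurable_from_F[OF measurable_proj_inv_sqrt[of k]] measurable_forward
    S_measurable[of "Suc k", simplified]
  show ?thesis unfolding W_def[abs_def] zstar_def Zpre_def by measurable
qed

lemma measurable_elapsed: "elapsed k \<in> measurable (F k) (count_space UNIV)"
  unfolding elapsed_def[abs_def]
  by (rule measurable_compose[OF measurable_start]) simp

subsection \<open>One iteration\<close>

text \<open>With \<open>P\<close> the average projection, \<open>d = y - zstar\<close> and \<open>e = Z - zstar\<close>, the expected squared error is
  \<open>d \<bullet> P d + (norm e)\<^sup>2 - e \<bullet> P e\<close>. Since \<open>Q = P\<^sup>-\<^sup>1\<^sup>/\<^sup>2\<close>, the first term is the squared distance of two gradient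
  steps, and so at most \<open>\<kappa>\<close> times the squared error of \<open>x\<close>, which is at most \<open>\<kappa> e \<bullet> P e\<close>. What remains is a
  decrease by \<open>(1 - \<kappa>) e \<bullet> P e\<close>, controlled by the smallest eigenvalue of \<open>P\<close>.\<close>

lemma expected_error_le:
  assumes \<omega>: "\<omega> \<in> space M" and lam: "lam \<le> lambda_min (avg_proj (cur_law k \<omega>))"
  defines "y \<equiv> proj_inv_sqrt k \<omega> *v forward (X k \<omega>)"
  shows "(\<integral>\<^sup>+U. ennreal ((norm (proj_mat U *v y + (mat 1 - proj_mat U) *v Z k \<omega> - zstar k \<omega>))\<^sup>2) \<partial>cur_law k \<omega>)
      \<le> ennreal (1 - (1 - \<kappa>) * lam) * V k \<omega>"
proof -
  let ?P = "avg_proj (cur_law k \<omega>)"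
  define e where "e = Z k \<omega> - zstar k \<omega>"
  define d where "d = y - zstar k \<omega>"
  have split: "proj_mat U *v y + (mat 1 - proj_mat U) *v Z k \<omega> - zstar k \<omega>
      = proj_mat U *v d + (mat 1 - proj_mat U) *v e" for U
    by (simp add: d_def e_def matrix_vector_mult_diff_distrib matrix_vector_mult_diff_rdistrib)
  have "d \<bullet> (?P *v d) = (norm (proj_sqrt k \<omega> *v d))\<^sup>2"
    using norm_matrix_sqrt(1)[OF contracting_pd_cur[OF \<omega>], of k d] by (simp add: proj_sqrt_def)
  also have "proj_sqrt k \<omega> *v d = forward (X k \<omega>) - forward xstar"
    by (simp add: d_def y_def zstar_def matrix_vector_mult_diff_distrib proj_sqrt_cancel(1)[OF \<omega>])
  also have "(norm (forward (X k \<omega>) - forward xstar))\<^sup>2 \<le> \<kappa> * (norm (X k \<omega> - xstar))\<^sup>2"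
    unfolding forward_def by (rule gradient_step)
  also have "\<dots> \<le> \<kappa> * (e \<bullet> (?P *v e))"
    unfolding e_def X_eq_prox[OF \<omega>] using \<kappa>(1) by (intro mult_left_mono prox_error_le(1)[OF \<omega>])
  finally have d: "d \<bullet> (?P *v d) \<le> \<kappa> * (e \<bullet> (?P *v e))" .
  have "transpose ?P = ?P" using contracting_pd_cur[OF \<omega>] by (simp add: contracting_pd_def)
  then have "lambda_min ?P * (norm e)\<^sup>2 \<le> e \<bullet> (?P *v e)" by (rule lambda_min_le_quadratic_form)
  then have "lam * (norm e)\<^sup>2 \<le> e \<bullet> (?P *v e)"
    using mult_right_mono[OF lam, of "(norm e)\<^sup>2"] by simp
  then have "(1 - \<kappa>) * (lam * (norm e)\<^sup>2) \<le> (1 - \<kappa>) * (e \<bullet> (?P *v e))"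
    using \<kappa>(2) by (intro mult_left_mono) auto
  then have "d \<bullet> (?P *v d) + (norm e)\<^sup>2 - e \<bullet> (?P *v e) \<le> (1 - (1 - \<kappa>) * lam) * (norm e)\<^sup>2"
    using d by (simp add: algebra_simps)
  then have "ennreal (d \<bullet> (?P *v d) + (norm e)\<^sup>2 - e \<bullet> (?P *v e)) \<le> ennreal ((1 - (1 - \<kappa>) * lam) * (norm e)\<^sup>2)"
    by (rule ennreal_leI)
  also have "\<dots> = ennreal (1 - (1 - \<kappa>) * lam) * V k \<omega>"
    unfolding V_def e_def[symmetric] by (simp add: ennreal_mult'' )
  finally show ?thesis
    unfolding split nn_integral_norm_mix_proj_mat[OF cur_law_in_prob_algebra[OF \<omega>]] .
qed

text \<open>The hypothesis on the selections speaks of each cycle separately; the countably many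
  exceptional null sets are united.\<close>

lemma conditional_law_selection:
  assumes "B \<in> sets subspace_algebra"
  shows "AE \<omega> in M. real_cond_exp M (F k) (\<lambda>\<omega>. indicator B (S (Suc k) \<omega>)) \<omega> = measure (cur_law k \<omega>) B"
proof -
  have "AE \<omega> in M. \<forall>m. adapt_time (\<lambda>k. D k \<omega>) m \<le> enat (Suc k) \<and> enat (Suc k) < adapt_time (\<lambda>k. D k \<omega>) (Suc m) \<longrightarrow>
        real_cond_exp M (F k) (\<lambda>\<omega>. indicator B (S (Suc k) \<omega>)) \<omega> = measure (law m \<omega>) B"
    unfolding AE_all_countable using selections_iid[OF _ assms, of "Suc k"] by simp
  then show ?thesis
  proof eventually_elim
    case (elim \<omega>)
    then show ?case unfolding in_cycle_iff by (simp add: cur_law_def cyc_def)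
  qed
qed

lemma iteration_contraction:
  fixes \<phi> :: "nat \<Rightarrow> nat \<Rightarrow> ennreal" and lam :: "nat \<Rightarrow> real"
  assumes lam: "\<And>m. AE \<omega> in M. adapt_time (\<lambda>k. D k \<omega>) m < \<infinity> \<longrightarrow> lam m \<le> lambda_min (avg_proj (law m \<omega>))"
  shows "(\<integral>\<^sup>+\<omega>. \<phi> (cyc k \<omega>) (elapsed k \<omega>) * W k \<omega> \<partial>M)
    \<le> (\<integral>\<^sup>+\<omega>. \<phi> (cyc k \<omega>) (elapsed k \<omega>) * (ennreal (1 - (1 - \<kappa>) * lam (cyc k \<omega>)) * V k \<omega>) \<partial>M)"
proof -
  define w where "w = (\<lambda>(\<omega>, U). ennreal ((norm (proj_mat U *v (proj_inv_sqrt k \<omega> *v forward (X k \<omega>))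
      + (mat 1 - proj_mat U) *v Z k \<omega> - zstar k \<omega>))\<^sup>2))"
  note [measurable] = measurable_Z[of k] measurable_X[of k] measurable_proj_inv_sqrt[of k] measurable_forward
    measurable_cyc[of k] measurable_elapsed[of k]
  have w_meas [measurable]: "w \<in> borel_measurable (F k \<Otimes>\<^sub>M subspace_algebra)"
    unfolding w_def zstar_def by measurable
  have "(\<integral>\<^sup>+\<omega>. \<phi> (cyc k \<omega>) (elapsed k \<omega>) * W k \<omega> \<partial>M)
      = (\<integral>\<^sup>+\<omega>. (\<lambda>(\<omega>, U). \<phi> (cyc k \<omega>) (elapsed k \<omega>) * w (\<omega>, U)) (\<omega>, S (Suc k) \<omega>) \<partial>M)"
    by (simp add: w_def W_def Zpre_def)
  also have "\<dots> = (\<integral>\<^sup>+\<omega>. (\<integral>\<^sup>+U. (\<lambda>(\<omega>, U). \<phi> (cyc k \<omega>) (elapsed k \<omega>) * w (\<omega>, U)) (\<omega>, U) \<partial>cur_law k \<omega>) \<partial>M)"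
  proof (rule nn_integral_conditional_law[OF prob_space_axioms subalgebra_F _ measurable_cur_law conditional_law_selection])
    show "S (Suc k) \<in> measurable M subspace_algebra" by (rule S_measurable) simp
    show "(\<lambda>(\<omega>, U). \<phi> (cyc k \<omega>) (elapsed k \<omega>) * w (\<omega>, U)) \<in> borel_measurable (F k \<Otimes>\<^sub>M subspace_algebra)"
      by measurable
  qed
  also have "\<dots> \<le> (\<integral>\<^sup>+\<omega>. \<phi> (cyc k \<omega>) (elapsed k \<omega>) * (ennreal (1 - (1 - \<kappa>) * lam (cyc k \<omega>)) * V k \<omega>) \<partial>M)"
  proof (rule nn_integral_mono_AE)
    have "AE \<omega> in M. \<forall>m. adapt_time (\<lambda>k. D k \<omega>) m < \<infinity> \<longrightarrow> lam m \<le> lambda_min (avg_proj (law m \<omega>))"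
      unfolding AE_all_countable using lam by blast
    then show "AE \<omega> in M. (\<integral>\<^sup>+U. (\<lambda>(\<omega>, U). \<phi> (cyc k \<omega>) (elapsed k \<omega>) * w (\<omega>, U)) (\<omega>, U) \<partial>cur_law k \<omega>)
        \<le> \<phi> (cyc k \<omega>) (elapsed k \<omega>) * (ennreal (1 - (1 - \<kappa>) * lam (cyc k \<omega>)) * V k \<omega>)"
    proof (rule AE_mp, intro AE_I2 impI)
      fix \<omega> assume \<omega>: "\<omega> \<in> space M"
        and "\<forall>m. adapt_time (\<lambda>k. D k \<omega>) m < \<infinity> \<longrightarrow> lam m \<le> lambda_min (avg_proj (law m \<omega>))"
      then have lam_\<omega>: "lam (cyc k \<omega>) \<le> lambda_min (avg_proj (cur_law k \<omega>))"
        using adapt_time_cyc[of \<omega> k] by (auto simp: cur_law_def)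
      have "(\<lambda>U. w (\<omega>, U)) \<in> borel_measurable subspace_algebra"
        using \<omega> by (intro measurable_compose_Pair1[OF _ w_meas]) simp
      moreover have "sets (cur_law k \<omega>) = sets subspace_algebra"
        using cur_law_in_prob_algebra[OF \<omega>] by (simp add: space_prob_algebra)
      ultimately have "(\<lambda>U. w (\<omega>, U)) \<in> borel_measurable (cur_law k \<omega>)"
        using measurable_cong_sets by blast
      then have "(\<integral>\<^sup>+U. (\<lambda>(\<omega>, U). \<phi> (cyc k \<omega>) (elapsed k \<omega>) * w (\<omega>, U)) (\<omega>, U) \<partial>cur_law k \<omega>)
          = \<phi> (cyc k \<omega>) (elapsed k \<omega>) * (\<integral>\<^sup>+U. w (\<omega>, U) \<partial>cur_law k \<omega>)"
        by (simp add: nn_integral_cmult)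
      also have "(\<integral>\<^sup>+U. w (\<omega>, U) \<partial>cur_law k \<omega>) \<le> ennreal (1 - (1 - \<kappa>) * lam (cyc k \<omega>)) * V k \<omega>"
        using expected_error_le[OF \<omega> lam_\<omega>] by (simp add: w_def)
      finally show "(\<integral>\<^sup>+U. (\<lambda>(\<omega>, U). \<phi> (cyc k \<omega>) (elapsed k \<omega>) * w (\<omega>, U)) (\<omega>, U) \<partial>cur_law k \<omega>)
        \<le> \<phi> (cyc k \<omega>) (elapsed k \<omega>) * (ennreal (1 - (1 - \<kappa>) * lam (cyc k \<omega>)) * V k \<omega>)"
        by (simp add: mult_left_mono)
    qed
  qed
  finally show ?thesis .
qed

text \<open>On adaptation, both \<open>z\<close> and \<open>zstar\<close> are multiplied by the same matrix, whose squared norm is the adaptation cost.\<close>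

lemma iteration_transition:
  fixes a c :: "nat \<Rightarrow> real" and N :: "nat \<Rightarrow> nat"
  assumes cost: "\<And>m. m \<ge> 1 \<Longrightarrow> AE \<omega> in M. adapt_time (\<lambda>k. D k \<omega>) m < \<infinity> \<longrightarrow>
      (spectral_norm (inv_sqrt (avg_proj (law m \<omega>)) ** matrix_inv (inv_sqrt (avg_proj (law (m - 1) \<omega>)))))\<^sup>2 \<le> a m"
    and delay: "\<And>m. m \<ge> 1 \<Longrightarrow> AE \<omega> in M. \<forall>i j. adapt_time (\<lambda>k. D k \<omega>) (m - 1) = enat i \<and> adapt_time (\<lambda>k. D k \<omega>) m = enat j
      \<longrightarrow> N m \<le> j - i"
  shows "AE \<omega> in M.
      (cyc (Suc k) \<omega> = cyc k \<omega> \<and> elapsed (Suc k) \<omega> = Suc (elapsed k \<omega>) \<and> V (Suc k) \<omega> = W k \<omega>) \<or>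
      (cyc (Suc k) \<omega> = Suc (cyc k \<omega>) \<and> elapsed (Suc k) \<omega> = 0
        \<and> V (Suc k) \<omega> \<le> ennreal (a (Suc (cyc k \<omega>))) * W k \<omega> \<and> N (Suc (cyc k \<omega>)) \<le> Suc (elapsed k \<omega>))"
proof -
  have "AE \<omega> in M. \<forall>m\<in>{1..}. adapt_time (\<lambda>k. D k \<omega>) m < \<infinity> \<longrightarrow>
      (spectral_norm (inv_sqrt (avg_proj (law m \<omega>)) ** matrix_inv (inv_sqrt (avg_proj (law (m - 1) \<omega>)))))\<^sup>2 \<le> a m"
    using cost by (subst AE_ball_countable) auto
  moreover have "AE \<omega> in M. \<forall>m\<in>{1..}. \<forall>i j. adapt_time (\<lambda>k. D k \<omega>) (m - 1) = enat i \<and> adapt_time (\<lambda>k. D k \<omega>) m = enat j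
      \<longrightarrow> N m \<le> j - i"
    using delay by (subst AE_ball_countable) auto
  moreover have "AE \<omega> in M. \<omega> \<in> space M" by simp
  ultimately show ?thesis
  proof eventually_elim
    case (elim \<omega>)
    note \<omega> = elim(3)
    have start_le: "start k \<omega> \<le> Suc k" unfolding start_def by (rule cycle_start_le)
    show ?case
    proof (cases "D (Suc k) \<omega>")
      case False
      then have "zstar (Suc k) \<omega> = zstar k \<omega>" "Z (Suc k) \<omega> = Zpre k \<omega>"
        using state_Suc(2)[OF \<omega>, of k] by (simp_all add: zstar_def proj_inv_sqrt_def cur_law_Suc_stay)
      then show ?thesis using False start_le
        by (simp add: cyc_Suc elapsed_def start_Suc V_def W_def)
    next
      case True
      let ?m = "Suc (cyc k \<omega>)"
      let ?R = "proj_inv_sqrt (Suc k) \<omega> ** proj_sqrt k \<omega>"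
      have cyc: "cyc (Suc k) \<omega> = ?m" using True by (simp add: cyc_Suc)
      have times: "adapt_time (\<lambda>k. D k \<omega>) (?m - 1) = enat (start k \<omega>)"
        "adapt_time (\<lambda>k. D k \<omega>) ?m = enat (k + 2)"
        using adapt_time_cyc[of \<omega> k] adapt_time_cyc[of \<omega> "Suc k"] True unfolding cyc
        by (simp_all add: start_Suc)
      have "N ?m \<le> k + 2 - start k \<omega>" using elim(2) times by (metis atLeast_iff le_add1 plus_1_eq_Suc)
      then have N: "N ?m \<le> Suc (elapsed k \<omega>)" using start_le by (simp add: elapsed_def)
      have sn: "(spectral_norm ?R)\<^sup>2 \<le> a ?m"
        using elim(1)[rule_format, of ?m] times(2) proj_sqrt_cancel(3)[OF \<omega>, of k] cyc
        by (simp add: proj_inv_sqrt_def cur_law_def)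
      have "Z (Suc k) \<omega> - zstar (Suc k) \<omega> = ?R *v (Zpre k \<omega> - zstar k \<omega>)"
        using state_Suc(2)[OF \<omega>, of k] True
        by (simp add: zstar_def matrix_vector_mult_diff_distrib proj_sqrt_cancel(1)[OF \<omega>] flip: matrix_vector_mul_assoc)
      then have "(norm (Z (Suc k) \<omega> - zstar (Suc k) \<omega>))\<^sup>2 \<le> (spectral_norm ?R * norm (Zpre k \<omega> - zstar k \<omega>))\<^sup>2"
        using norm_matrix_vector_le by (intro power_mono) auto
      also have "\<dots> \<le> a ?m * (norm (Zpre k \<omega> - zstar k \<omega>))\<^sup>2"
        unfolding power_mult_distrib by (intro mult_right_mono sn) simp
      finally have "V (Suc k) \<omega> \<le> ennreal (a ?m * (norm (Zpre k \<omega> - zstar k \<omega>))\<^sup>2)"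
        unfolding V_def by (rule ennreal_leI)
      also have "\<dots> = ennreal (a ?m) * W k \<omega>" unfolding W_def by (simp add: ennreal_mult'')
      finally show ?thesis using cyc N True by (simp add: elapsed_def start_Suc)
    qed
  qed
qed

end

section \<open>The expected error of a cycle\<close>

lemma contracting_pd_lambda_min_le_1:
  fixes A :: "real^'n^'n"
  assumes "contracting_pd A"
  shows "lambda_min A \<le> 1"
proof -
  obtain b :: "real^'n" where "b \<in> Basis" using nonempty_Basis by blast
  then have "norm b = 1" by simp
  moreover have "transpose A = A" "b \<bullet> (A *v b) \<le> (norm b)\<^sup>2"
    using assms unfolding contracting_pd_def by auto
  ultimately show ?thesis using lambda_min_le_quadratic_form[of A b] by simp
qed

text \<open>Iterations are counted by integers whereas the guaranteed cycle lengths are real.\<close>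

lemma power_le_powr:
  fixes r c :: real
  assumes "0 \<le> r" "r \<le> 1" "0 < c" "c \<le> real n"
  shows "r ^ n \<le> r powr c"
proof (cases "r = 0")
  case True
  then show ?thesis using assms by (simp add: zero_power)
next
  case False
  then have "r ^ n = r powr real n" using assms by (simp add: powr_realpow)
  also have "\<dots> \<le> r powr c" using assms by (intro powr_mono') auto
  finally show ?thesis .
qed

text \<open>An inequality only: for \<open>r = 0\<close> the left-hand side is \<open>0 * \<infinity> = 0\<close>.\<close>

lemma ennreal_mult_inverse_power_Suc:
  fixes r :: real
  shows "ennreal r * inverse (ennreal r ^ Suc e) \<le> inverse (ennreal r ^ e)"
proof (cases "r \<le> 0")
  case False
  then have inv: "inverse (ennreal r ^ n) = ennreal (inverse (r ^ n))" for n
    by (simp add: ennreal_power inverse_ennreal)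
  have "ennreal r * inverse (ennreal r ^ Suc e) = ennreal (r * inverse (r ^ Suc e))"
    unfolding inv using False by (simp add: ennreal_mult)
  also have "r * inverse (r ^ Suc e) = inverse (r ^ e)" using False by simp
  finally show ?thesis unfolding inv by simp
qed (simp add: ennreal_neg)

theorem theorem2:
  fixes f :: "real^'n \<Rightarrow> real" and g :: "real^'n \<Rightarrow> ereal"
    and \<mu> L \<gamma> :: real and xstar z0 :: "real^'n"
    and M :: "'w measure"
    and I :: "'i set" and C :: "'i \<Rightarrow> (real^'n) set"
    and J :: "nat \<Rightarrow> 'w \<Rightarrow> 'i set" and S :: "nat \<Rightarrow> 'w \<Rightarrow> (real^'n) set"
    and F :: "nat \<Rightarrow> 'w measure"
    and D :: "nat \<Rightarrow> 'w \<Rightarrow> bool" and K :: "nat \<Rightarrow> 'w \<Rightarrow> enat"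
    and law0 :: "(real^'n) set measure" and law :: "nat \<Rightarrow> 'w \<Rightarrow> (real^'n) set measure"
    and P Q :: "nat \<Rightarrow> 'w \<Rightarrow> real^'n^'n"
    and x :: "nat \<Rightarrow> 'w \<Rightarrow> real^'n"
    and a c lam \<alpha> \<beta> :: "nat \<Rightarrow> real" and l :: nat
  assumes f_smooth: "smooth_fun L f" and f_convex: "strongly_convex \<mu> f" and mu: "0 < \<mu>"
    and g: "convex_ereal g" "proper_fun g" "lower_semicontinuous g"
    and xstar: "is_arg_min (\<lambda>y. ereal (f y) + g y) (\<lambda>_. True) xstar"
    and gamma: "0 < \<gamma>" "\<gamma> \<le> 2 / (\<mu> + L)"
    \<comment> \<open>random selections and adaptation decisions\<close>
    and M: "prob_space M"
    and C: "covering_family I C"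
    and J: "\<And>k \<omega>. k \<ge> 1 \<Longrightarrow> \<omega> \<in> space M \<Longrightarrow> finite (J k \<omega>) \<and> J k \<omega> \<subseteq> I"
    and S: "S = (\<lambda>k \<omega>. subspace_sum C (J k \<omega>))"
    and S_measurable: "\<And>k. k \<ge> 1 \<Longrightarrow> S k \<in> measurable M subspace_algebra"
    and F: "F = selection_filtration M S"
    and D_measurable: "\<And>k. k \<ge> 1 \<Longrightarrow> Measurable.pred (F k) (D k)"
    and K: "K = (\<lambda>m \<omega>. adapt_time (\<lambda>k. D k \<omega>) m)"
    \<comment> \<open>\<open>law m\<close> is the law of the selections in cycle \<open>m\<close>, generated from the past\<close>
    and law_0: "law 0 = (\<lambda>_. law0)"
    and law_measurable: "\<And>m j. law m \<in>
          measurable (restrict_space (F (j - 1)) {\<omega>. K m \<omega> = enat j}) (prob_algebra subspace_algebra)"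
    and law_admissible: "\<And>m \<omega>. \<omega> \<in> space M \<Longrightarrow> K m \<omega> < \<infinity> \<Longrightarrow> admissible (law m \<omega>)"
    and selections_iid: "\<And>m k B. k \<ge> 1 \<Longrightarrow> B \<in> sets subspace_algebra \<Longrightarrow>
          AE \<omega> in M. K m \<omega> \<le> enat k \<and> enat k < K (Suc m) \<omega> \<longrightarrow>
            real_cond_exp M (F (k - 1)) (\<lambda>\<omega>. indicator B (S k \<omega>)) \<omega> = measure (law m \<omega>) B"
    \<comment> \<open>the iterates\<close>
    and P: "P = (\<lambda>m \<omega>. avg_proj (law m \<omega>))"
    and Q: "Q = (\<lambda>m \<omega>. inv_sqrt (P m \<omega>))"
    and x: "\<And>k \<omega>. x (k + 1) \<omega> =
          fst (arpsd f g \<gamma> z0 (\<lambda>m. Q m \<omega>) (\<lambda>j. S j \<omega>) (\<lambda>j. D j \<omega>) k)"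
    \<comment> \<open>the adaptation strategy\<close>
    and adapt_cost: "\<And>m. m \<ge> 1 \<Longrightarrow> AE \<omega> in M. K m \<omega> < \<infinity> \<longrightarrow>
          (spectral_norm (Q m \<omega> ** matrix_inv (Q (m - 1) \<omega>)))\<^sup>2 \<le> a m"
    and adapt_delay: "\<And>m. m \<ge> 1 \<Longrightarrow> 0 < c m"
      "\<And>m. m \<ge> 1 \<Longrightarrow> AE \<omega> in M. \<forall>i j. K (m - 1) \<omega> = enat i \<and> K m \<omega> = enat j \<longrightarrow>
          c m \<le> real j - real i"
    and uniformity: "\<And>m. 0 \<le> lam m"
      "\<And>m. AE \<omega> in M. K m \<omega> < \<infinity> \<longrightarrow> lam m \<le> lambda_min (P m \<omega>)"
    \<comment> \<open>cycle \<open>0\<close> consists of only \<open>K 1 - 1\<close> iterations; vacuous if \<open>lam 0 \<le> lam l\<close>\<close>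
    and first_cycle: "lam l < lam 0 \<Longrightarrow> AE \<omega> in M. \<forall>j. K 1 \<omega> = enat j \<longrightarrow> c 1 \<le> real j - 1"
    and alpha: "\<And>m. 1 - \<alpha> m = 1 - 2 * \<gamma> * \<mu> * L * lam m / (\<mu> + L)"
    and beta: "\<And>m. m \<ge> 1 \<Longrightarrow> 1 - \<beta> m = (1 - \<alpha> (m - 1)) * a m powr (1 / c m)"
  shows
    \<comment> \<open>\<open>k\<close> fixed, on the event that \<open>k\<close> is in cycle \<open>l\<close>; \<open>K l\<close> is random, so its power is under the integral\<close>
    "(\<forall>k. (\<integral>\<^sup>+\<omega>\<in>{\<omega> \<in> space M. K l \<omega> \<le> enat k \<and> enat k < K (Suc l) \<omega>}.
              ennreal ((norm (x (k + 1) \<omega> - xstar))\<^sup>2)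
                / ennreal ((1 - \<alpha> l) ^ (k - the_enat (K l \<omega>))) \<partial>M)
          \<le> ennreal ((\<Prod>m=1..l. (1 - \<beta> m) powr c m)
              * (norm (z0 - inv_sqrt (avg_proj law0) *v (xstar - \<gamma> *\<^sub>R gradient f xstar)))\<^sup>2)) \<and>
     \<comment> \<open>\<open>k = K l + i\<close> with \<open>i\<close> fixed, on the event that \<open>k\<close> is in cycle \<open>l\<close>\<close>
     (\<forall>i. (\<integral>\<^sup>+\<omega>\<in>{\<omega> \<in> space M. K l \<omega> + enat i < K (Suc l) \<omega>}.
              ennreal ((norm (x (the_enat (K l \<omega>) + i + 1) \<omega> - xstar))\<^sup>2) \<partial>M)
          \<le> ennreal ((1 - \<alpha> l) ^ i * (\<Prod>m=1..l. (1 - \<beta> m) powr c m)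
              * (norm (z0 - inv_sqrt (avg_proj law0) *v (xstar - \<gamma> *\<^sub>R gradient f xstar)))\<^sup>2))"
proof -
  interpret M: prob_space M by fact
  have \<mu>L: "\<mu> \<le> L" by (rule smooth_strongly_convex_const[OF f_smooth f_convex])
  define \<kappa> where "\<kappa> = 1 - 2 * \<gamma> * \<mu> * L / (\<mu> + L)"
  have \<kappa>: "0 \<le> \<kappa>" "\<kappa> \<le> 1"
    using gradient_step_factor[OF mu \<mu>L gamma] by (simp_all add: \<kappa>_def)
  note fixpoint = prox_gradient_fixed_point[OF f_smooth g xstar]
  interpret A: arpsd_process M f g \<gamma> \<kappa> xstar z0 S D law0 law
  proof
    show "(norm ((x - \<gamma> *\<^sub>R gradient f x) - (y - \<gamma> *\<^sub>R gradient f y)))\<^sup>2 \<le> \<kappa> * (norm (x - y))\<^sup>2" for x y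
      unfolding \<kappa>_def by (rule gradient_step_contraction[OF f_smooth f_convex mu gamma])
    show "norm (prox \<gamma> g x - prox \<gamma> g y) \<le> norm (x - y)" for x y
      by (rule prox_nonexpansive[OF g fixpoint(1) gamma(1)])
    show "prox \<gamma> g (xstar - \<gamma> *\<^sub>R gradient f xstar) = xstar" by (rule fixpoint(2)[OF gamma(1)])
  qed (fact \<kappa> S_measurable D_measurable[unfolded F] law_0 law_measurable[unfolded F K]
      law_admissible[unfolded K] selections_iid[unfolded F K])+
  define \<rho> where "\<rho> m = 1 - \<alpha> m" for m
  have \<rho>: "\<rho> m = 1 - (1 - \<kappa>) * lam m" for m
    using alpha[of m] by (simp add: \<rho>_def \<kappa>_def)
  have \<rho>_le_1: "\<rho> m \<le> 1" for m using uniformity(1)[of m] \<kappa>(2) by (simp add: \<rho>)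
  \<comment> \<open>Cycle \<open>0\<close> has one iteration less than its length suggests. The missing factor \<open>\<rho> 0\<close> is either
    made up for by the factor \<open>\<rho> l\<close> of the last iteration, or, if \<open>\<rho> l\<close> is the larger one, provided by a
    first cycle that is longer by one.\<close>
  define N where "N m = nat \<lceil>c m\<rceil> + (if m = 1 \<and> lam l < lam 0 then 1 else 0)" for m
  have delay: "AE \<omega> in M. \<forall>i j. adapt_time (\<lambda>k. D k \<omega>) (m - 1) = enat i
      \<and> adapt_time (\<lambda>k. D k \<omega>) m = enat j \<longrightarrow> N m \<le> j - i" if m: "m \<ge> 1" for m
  proof (cases "m = 1 \<and> lam l < lam 0")
    case True
    then have "AE \<omega> in M. \<forall>j. adapt_time (\<lambda>k. D k \<omega>) 1 = enat j \<longrightarrow> c 1 \<le> real j - 1"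
      using first_cycle unfolding K by blast
    then show ?thesis
    proof eventually_elim
      case (elim \<omega>)
      show ?case
      proof (intro allI impI, elim conjE)
        fix i j assume ij: "adapt_time (\<lambda>k. D k \<omega>) (m - 1) = enat i" "adapt_time (\<lambda>k. D k \<omega>) m = enat j"
        have "i = 0" using ij(1) True by (simp add: zero_enat_def)
        moreover have c1: "c 1 \<le> real j - 1" using elim ij(2) True by simp
        moreover have "0 < c 1" using adapt_delay(1)[of 1] by simp
        ultimately have "1 \<le> j" "c 1 \<le> real (j - 1)" by auto
        then have "nat \<lceil>c 1\<rceil> \<le> j - 1" by (simp add: nat_ceiling_le_eq)
        moreover have "N m = nat \<lceil>c 1\<rceil> + 1" using True by (simp add: N_def)
        ultimately show "N m \<le> j - i" using \<open>1 \<le> j\<close> \<open>i = 0\<close> by linarith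
      qed
    qed
  next
    case False
    show ?thesis using adapt_delay(2)[OF m] unfolding K
    proof eventually_elim
      case (elim \<omega>)
      show ?case
      proof (intro allI impI)
        fix i j assume "adapt_time (\<lambda>k. D k \<omega>) (m - 1) = enat i \<and> adapt_time (\<lambda>k. D k \<omega>) m = enat j"
        then have "c m \<le> real j - real i" using elim by blast
        moreover from this have "i \<le> j" using adapt_delay(1)[OF m] by linarith
        ultimately have "nat \<lceil>c m\<rceil> \<le> j - i" by (simp add: nat_ceiling_le_eq of_nat_diff)
        moreover have "N m = nat \<lceil>c m\<rceil>" using False by (simp only: N_def if_False add_0_right)
        ultimately show "N m \<le> j - i" by simp
      qed
    qed
  qed
  interpret Y: cycle_process M A.V A.W A.cyc A.elapsed "\<lambda>m. ennreal (\<rho> m)" "\<lambda>m. ennreal (a m)" N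
  proof
    show "A.V k \<in> borel_measurable M" "A.W k \<in> borel_measurable M"
      "A.cyc k \<in> measurable M (count_space UNIV)" "A.elapsed k \<in> measurable M (count_space UNIV)" for k
      using A.measurable_from_F A.measurable_V A.measurable_W A.measurable_cyc A.measurable_elapsed by blast+
    show "(\<integral>\<^sup>+\<omega>. \<phi> (A.cyc k \<omega>) (A.elapsed k \<omega>) * A.W k \<omega> \<partial>M)
        \<le> (\<integral>\<^sup>+\<omega>. \<phi> (A.cyc k \<omega>) (A.elapsed k \<omega>) * (ennreal (\<rho> (A.cyc k \<omega>)) * A.V k \<omega>) \<partial>M)"
      for k and \<phi> :: "nat \<Rightarrow> nat \<Rightarrow> ennreal"
      unfolding \<rho> by (rule A.iteration_contraction) (rule uniformity(2)[unfolded K P])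
    show "AE \<omega> in M.
      (A.cyc (Suc k) \<omega> = A.cyc k \<omega> \<and> A.elapsed (Suc k) \<omega> = Suc (A.elapsed k \<omega>) \<and> A.V (Suc k) \<omega> = A.W k \<omega>) \<or>
      (A.cyc (Suc k) \<omega> = Suc (A.cyc k \<omega>) \<and> A.elapsed (Suc k) \<omega> = 0
        \<and> A.V (Suc k) \<omega> \<le> ennreal (a (Suc (A.cyc k \<omega>))) * A.W k \<omega>
        \<and> N (Suc (A.cyc k \<omega>)) \<le> Suc (A.elapsed k \<omega>))" for k
      by (rule A.iteration_transition[OF adapt_cost[unfolded K Q P] delay])
  qed
  define n0 where "n0 = (norm (z0 - inv_sqrt (avg_proj law0) *v (xstar - \<gamma> *\<^sub>R gradient f xstar)))\<^sup>2"
  have n0: "0 \<le> n0" by (simp add: n0_def)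
  have V0: "A.V 0 \<omega> = ennreal n0" if "\<omega> \<in> space M" for \<omega>
    using A.state_0(2)[OF that]
    by (simp add: A.V_def A.zstar_def A.proj_inv_sqrt_def A.cur_law_def A.cyc_0 law_0 A.forward_def n0_def)
  have x_X: "x (Suc k) \<omega> = A.X k \<omega>" for k \<omega>
    using x[of k \<omega>] by (simp add: A.X_def A.state_def Q P)
  have x_0: "ennreal ((norm (x (Suc 0) \<omega> - xstar))\<^sup>2) \<le> ennreal n0" if "\<omega> \<in> space M" for \<omega>
    using A.X_error_le(2)[OF that] V0[OF that] by (simp add: x_X)
  have x_Suc: "ennreal ((norm (x (Suc (Suc k)) \<omega> - xstar))\<^sup>2) \<le> A.W k \<omega>" if "\<omega> \<in> space M" for k \<omega>
    using A.X_error_le(1)[OF that] by (simp add: x_X)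
  have K_pos: "0 < K m \<omega>" if "m \<noteq> 0" for m \<omega>
  proof -
    have "adapt_time (\<lambda>k. D k \<omega>) 0 < adapt_time (\<lambda>k. D k \<omega>) (Suc 0)"
      by (rule adapt_time_Suc_gt) (simp add: zero_enat_def)
    also have "\<dots> \<le> K m \<omega>" unfolding K using that by (intro adapt_time_mono) simp
    finally show ?thesis by simp
  qed
  have in_cycle: "A.cyc k \<omega> = l \<and> K l \<omega> = enat (A.start k \<omega>)"
    if "K l \<omega> \<le> enat (Suc k)" "enat (Suc k) < K (Suc l) \<omega>" for k \<omega>
    using that in_cycle_iff[of "\<lambda>k. D k \<omega>" l k] A.adapt_time_cyc[of \<omega> k]
    unfolding K A.cyc_def by blast
  show ?thesis
  proof (cases "AE \<omega> in M. K l \<omega> = \<infinity>")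
    case True
    \<comment> \<open>Cycle \<open>l\<close> is never reached. This case is separate because then \<open>\<rho> l\<close> may be negative.\<close>
    have null: "(\<integral>\<^sup>+\<omega>\<in>E. u \<omega> \<partial>M) \<le> b" if "E \<subseteq> {\<omega>. K l \<omega> \<noteq> \<infinity>}" for E and u :: "'w \<Rightarrow> ennreal" and b
    proof -
      have "(\<integral>\<^sup>+\<omega>\<in>E. u \<omega> \<partial>M) \<le> (\<integral>\<^sup>+\<omega>. 0 \<partial>M)"
        by (rule nn_integral_mono_AE, rule AE_mp[OF True], rule AE_I2)
          (use that in \<open>auto simp: indicator_def\<close>)
      then show ?thesis by simp
    qed
    have "K l \<omega> \<noteq> \<infinity>" if "K l \<omega> \<le> enat k" for k \<omega> using that by (cases "K l \<omega>") auto
    moreover have "K l \<omega> \<noteq> \<infinity>" if "K l \<omega> + enat i < K (Suc l) \<omega>" for i \<omega>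
      using that by (cases "K l \<omega>") auto
    ultimately show ?thesis by (intro conjI allI null) blast+
  next
    case False
    \<comment> \<open>One path that reaches cycle \<open>l\<close> suffices to determine the signs of the deterministic sequences.\<close>
    have "\<exists>\<omega>\<in>space M. K l \<omega> \<noteq> \<infinity> \<and> (\<forall>m. K m \<omega> < \<infinity> \<longrightarrow> lam m \<le> lambda_min (P m \<omega>)) \<and>
      (\<forall>m\<in>{1..}. K m \<omega> < \<infinity> \<longrightarrow> (spectral_norm (Q m \<omega> ** matrix_inv (Q (m - 1) \<omega>)))\<^sup>2 \<le> a m)"
    proof (rule ccontr)
      assume none: "\<not> ?thesis"
      have "AE \<omega> in M. \<forall>m. K m \<omega> < \<infinity> \<longrightarrow> lam m \<le> lambda_min (P m \<omega>)"
        unfolding AE_all_countable using uniformity(2) by blast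
      moreover have "AE \<omega> in M. \<forall>m\<in>{1..}. K m \<omega> < \<infinity> \<longrightarrow>
          (spectral_norm (Q m \<omega> ** matrix_inv (Q (m - 1) \<omega>)))\<^sup>2 \<le> a m"
        using adapt_cost by (subst AE_ball_countable) auto
      moreover have "AE \<omega> in M. \<omega> \<in> space M" by simp
      ultimately have "AE \<omega> in M. K l \<omega> = \<infinity>"
        by eventually_elim (use none in blast)
      then show False using False by blast
    qed
    then obtain \<omega>0 where \<omega>0: "\<omega>0 \<in> space M" "K l \<omega>0 \<noteq> \<infinity>"
      "\<And>m. K m \<omega>0 < \<infinity> \<Longrightarrow> lam m \<le> lambda_min (P m \<omega>0)"
      "\<And>m. m \<ge> 1 \<Longrightarrow> K m \<omega>0 < \<infinity> \<Longrightarrow> (spectral_norm (Q m \<omega>0 ** matrix_inv (Q (m - 1) \<omega>0)))\<^sup>2 \<le> a m"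
      by auto
    have reached: "K m \<omega>0 < \<infinity>" if "m \<le> l" for m
    proof -
      have "K m \<omega>0 \<le> K l \<omega>0" unfolding K using that by (rule adapt_time_mono)
      also have "\<dots> < \<infinity>" using \<omega>0(2) by simp
      finally show ?thesis .
    qed
    have a_nonneg: "0 \<le> a m" if "1 \<le> m" "m \<le> l" for m
      using \<omega>0(4)[OF that(1) reached[OF that(2)]] order_trans zero_le_power2 by blast
    have \<rho>_nonneg: "0 \<le> \<rho> m" if "m \<le> l" for m
    proof -
      have "lam m \<le> lambda_min (P m \<omega>0)" using \<omega>0(3) reached[OF that] by blast
      also have "\<dots> \<le> 1"
        using A.contracting_pd_law[OF \<omega>0(1)] reached[OF that]
        unfolding K P by (intro contracting_pd_lambda_min_le_1) blast
      finally have "(1 - \<kappa>) * lam m \<le> 1 * 1"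
        using uniformity(1)[of m] \<kappa> by (intro mult_mono) auto
      then show ?thesis by (simp add: \<rho>)
    qed
    define PR where "PR = (\<Prod>m=1..l. (1 - \<beta> m) powr c m)"
    have PR: "PR = (\<Prod>m=1..l. \<rho> (m - 1) powr c m * a m)"
      unfolding PR_def
    proof (rule prod.cong[OF refl])
      fix m assume "m \<in> {1..l}"
      then have m: "1 \<le> m" "m \<le> l" by auto
      have "(1 - \<beta> m) powr c m = \<rho> (m - 1) powr c m * (a m powr (1 / c m)) powr c m"
        using \<rho>_nonneg[of "m - 1"] m by (simp add: beta \<rho>_def powr_mult)
      also have "(a m powr (1 / c m)) powr c m = a m"
        using adapt_delay(1)[OF m(1)] a_nonneg[OF m] by (simp add: powr_powr)
      finally show "(1 - \<beta> m) powr c m = \<rho> (m - 1) powr c m * a m" .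
    qed
    have first_factor: "\<rho> 0 ^ (N 1 - 1) * \<rho> l \<le> \<rho> 0 powr c 1" if "l \<noteq> 0"
    proof (cases "lam l < lam 0")
      case True
      have "\<rho> 0 ^ (N 1 - 1) * \<rho> l \<le> \<rho> 0 ^ (N 1 - 1) * 1"
        using \<rho>_nonneg[of 0] \<rho>_le_1 by (intro mult_left_mono) auto
      also have "\<dots> \<le> \<rho> 0 powr c 1"
        unfolding mult_1_right using \<rho>_nonneg[of 0] \<rho>_le_1 adapt_delay(1)[of 1] True
        by (intro power_le_powr) (auto simp: N_def real_nat_ceiling_ge)
      finally show ?thesis .
    next
      case False
      then have "\<rho> l \<le> \<rho> 0" using \<kappa>(2) by (simp add: \<rho> mult_left_mono)
      then have "\<rho> 0 ^ (N 1 - 1) * \<rho> l \<le> \<rho> 0 ^ (N 1 - 1) * \<rho> 0"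
        using \<rho>_nonneg[of 0] by (intro mult_left_mono) auto
      also have "\<dots> = \<rho> 0 ^ N 1"
      proof -
        have "0 < N 1" using adapt_delay(1)[of 1] by (simp add: N_def)
        then show ?thesis by (metis Suc_diff_1 power_Suc2)
      qed
      also have "\<dots> \<le> \<rho> 0 powr c 1"
        using \<rho>_nonneg[of 0] \<rho>_le_1 adapt_delay(1)[of 1] False
        by (intro power_le_powr) (auto simp: N_def real_nat_ceiling_ge)
      finally show ?thesis .
    qed
    have product: "\<rho> 0 ^ (N 1 - 1) * (a 1 * ((\<Prod>r=2..l. \<rho> (r - 1) ^ N r * a r) * \<rho> l)) \<le> PR" if "l \<noteq> 0"
    proof -
      have later: "(\<Prod>r=2..l. \<rho> (r - 1) ^ N r * a r) \<le> (\<Prod>r=2..l. \<rho> (r - 1) powr c r * a r)"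
      proof (rule prod_mono, intro conjI)
        fix r assume "r \<in> {2..l}"
        then have r: "1 \<le> r" "2 \<le> r" "r \<le> l" "r - 1 \<le> l" by auto
        show "0 \<le> \<rho> (r - 1) ^ N r * a r" using \<rho>_nonneg[OF r(4)] a_nonneg[OF r(1,3)] by simp
        have "\<rho> (r - 1) ^ N r \<le> \<rho> (r - 1) powr c r"
          using \<rho>_nonneg[OF r(4)] \<rho>_le_1 adapt_delay(1)[OF r(1)] r
          by (intro power_le_powr) (auto simp: N_def real_nat_ceiling_ge)
        then show "\<rho> (r - 1) ^ N r * a r \<le> \<rho> (r - 1) powr c r * a r"
          using a_nonneg[OF r(1,3)] by (rule mult_right_mono)
      qed
      have later_nonneg: "0 \<le> (\<Prod>r=2..l. \<rho> (r - 1) ^ N r * a r)"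
        using \<rho>_nonneg a_nonneg by (intro prod_nonneg) auto
      have "\<rho> 0 ^ (N 1 - 1) * (a 1 * ((\<Prod>r=2..l. \<rho> (r - 1) ^ N r * a r) * \<rho> l))
          = (\<rho> 0 ^ (N 1 - 1) * \<rho> l) * a 1 * (\<Prod>r=2..l. \<rho> (r - 1) ^ N r * a r)"
        by (simp add: mult_ac)
      also have "\<dots> \<le> \<rho> 0 powr c 1 * a 1 * (\<Prod>r=2..l. \<rho> (r - 1) powr c r * a r)"
        using first_factor[OF that] later later_nonneg a_nonneg[of 1] that
        by (intro mult_mono mult_right_mono) auto
      also have "\<dots> = PR"
      proof -
        have "{1..l} = insert 1 {2..l}" using that by auto
        then show ?thesis unfolding PR by simp
      qed
      finally show ?thesis .
    qed
    have PR_nonneg: "0 \<le> PR" unfolding PR_def by (intro prod_nonneg) simp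
    let ?r = "ennreal (\<rho> l)"
    \<comment> \<open>\<open>?r\<close> is the factor of the iteration whose error is paid for, \<open>H\<close> what the target cycle allows beyond it\<close>
    have bound: "(\<Sum>k. \<integral>\<^sup>+\<omega>. (if A.cyc k \<omega> = l then R k (A.elapsed k \<omega>) else 0) * A.W k \<omega> \<partial>M)
        \<le> ennreal PR * H * ennreal n0"
      if target: "\<And>k e. ?r * (R k e + h (Suc k) (Suc e)) \<le> h k e" and entry: "\<And>k. h k 0 \<le> ?r * H"
        and first: "l = 0 \<Longrightarrow> h 0 1 \<le> H"
      for R h :: "nat \<Rightarrow> nat \<Rightarrow> ennreal" and H :: ennreal
    proof -
      have "(\<Sum>k. \<integral>\<^sup>+\<omega>. (if A.cyc k \<omega> = l then R k (A.elapsed k \<omega>) else 0) * A.W k \<omega> \<partial>M)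
          \<le> (if l = 0 then h 0 1 else ennreal (\<rho> 0) ^ (N 1 - 1) * (ennreal (a 1) *
            ((\<Prod>r=2..l. ennreal (\<rho> (r - 1)) ^ N r * ennreal (a r)) * (?r * H)))) * ennreal n0"
        by (rule Y.target_cycle_bound[where R = R and h = h, OF _ target entry])
          (use \<rho>_le_1 in \<open>simp_all add: A.cyc_0 A.elapsed_def A.start_0 V0 M.emeasure_space_1\<close>)
      also have "\<dots> \<le> ennreal PR * H * ennreal n0"
      proof (rule mult_right_mono)
        show "(if l = 0 then h 0 1 else ennreal (\<rho> 0) ^ (N 1 - 1) * (ennreal (a 1) *
            ((\<Prod>r=2..l. ennreal (\<rho> (r - 1)) ^ N r * ennreal (a r)) * (?r * H)))) \<le> ennreal PR * H"
        proof (cases "l = 0")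
          case True
          then show ?thesis using first by (simp add: PR_def)
        next
          case False
          have prod: "(\<Prod>r=2..l. ennreal (\<rho> (r - 1)) ^ N r * ennreal (a r))
              = ennreal (\<Prod>r=2..l. \<rho> (r - 1) ^ N r * a r)"
          proof -
            have nonneg: "0 \<le> \<rho> (r - 1)" "0 \<le> a r" if "r \<in> {2..l}" for r
              using that by (auto intro!: \<rho>_nonneg a_nonneg)
            have "ennreal (\<rho> (r - 1)) ^ N r * ennreal (a r) = ennreal (\<rho> (r - 1) ^ N r * a r)"
              if "r \<in> {2..l}" for r
              using nonneg[OF that] by (simp add: ennreal_mult' ennreal_power)
            moreover have "0 \<le> \<rho> (r - 1) ^ N r * a r" if "r \<in> {2..l}" for r
              using nonneg[OF that] by simp
            ultimately show ?thesis using prod_ennreal[of "{2..l}" "\<lambda>r. \<rho> (r - 1) ^ N r * a r"] by simp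
          qed
          have nonneg: "0 \<le> (\<Prod>r=2..l. \<rho> (r - 1) ^ N r * a r)" "0 \<le> \<rho> 0" "0 \<le> \<rho> l" "0 \<le> a 1"
            using \<rho>_nonneg a_nonneg False by (auto intro!: prod_nonneg)
          have "ennreal (\<rho> 0) ^ (N 1 - 1) * (ennreal (a 1) *
              ((\<Prod>r=2..l. ennreal (\<rho> (r - 1)) ^ N r * ennreal (a r)) * (?r * H)))
              = ennreal (\<rho> 0 ^ (N 1 - 1) * (a 1 * ((\<Prod>r=2..l. \<rho> (r - 1) ^ N r * a r) * \<rho> l))) * H"
            unfolding prod using nonneg by (simp add: ennreal_mult ennreal_power mult.assoc)
          also have "\<dots> \<le> ennreal PR * H"
            by (intro mult_right_mono ennreal_leI product[OF False]) simp
          finally show ?thesis using False by simp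
        qed
      qed simp
      finally show ?thesis .
    qed
    have at_time: "(\<integral>\<^sup>+\<omega>\<in>{\<omega> \<in> space M. K l \<omega> \<le> enat k \<and> enat k < K (Suc l) \<omega>}.
              ennreal ((norm (x (k + 1) \<omega> - xstar))\<^sup>2)
                / ennreal (\<rho> l ^ (k - the_enat (K l \<omega>))) \<partial>M)
          \<le> ennreal (PR * n0)" (is "?lhs k \<le> _") for k
    proof (cases k)
      case 0
      show ?thesis
      proof (cases "l = 0")
        case True
        have "?lhs k \<le> (\<integral>\<^sup>+\<omega>. ennreal n0 \<partial>M)"
          using x_0 by (intro nn_integral_mono) (simp add: 0 indicator_def divide_ennreal_def)
        then show ?thesis using True by (simp add: M.emeasure_space_1 PR_def)
      next
        case False
        then have "{\<omega> \<in> space M. K l \<omega> \<le> enat k \<and> enat k < K (Suc l) \<omega>} = {}"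
          using K_pos 0 by (auto simp: zero_enat_def[symmetric] not_le)
        then show ?thesis by simp
      qed
    next
      case (Suc j)
      \<comment> \<open>A single payment in iteration \<open>j + 1\<close>, weighted by the inverse of the rate accumulated in the cycle.\<close>
      define R where "R i e = (if i = j then inverse (?r ^ e) else 0)" for i e
      define h where "h i e = (if i \<le> j then ?r * inverse (?r ^ e) else 0)" for i e
      have "?lhs k \<le> (\<integral>\<^sup>+\<omega>. (if A.cyc j \<omega> = l then R j (A.elapsed j \<omega>) else 0) * A.W j \<omega> \<partial>M)"
      proof (rule nn_integral_mono)
        fix \<omega> assume \<omega>: "\<omega> \<in> space M"
        show "ennreal ((norm (x (k + 1) \<omega> - xstar))\<^sup>2) / ennreal (\<rho> l ^ (k - the_enat (K l \<omega>)))
            * indicator {\<omega> \<in> space M. K l \<omega> \<le> enat k \<and> enat k < K (Suc l) \<omega>} \<omega>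
          \<le> (if A.cyc j \<omega> = l then R j (A.elapsed j \<omega>) else 0) * A.W j \<omega>"
        proof (cases "K l \<omega> \<le> enat k \<and> enat k < K (Suc l) \<omega>")
          case True
          then have "A.cyc j \<omega> = l" "K l \<omega> = enat (A.start j \<omega>)" using in_cycle Suc by auto
          moreover have "ennreal (\<rho> l ^ n) = ?r ^ n" for n
            using \<rho>_nonneg[of l] by (simp add: ennreal_power)
          ultimately show ?thesis
            using x_Suc[OF \<omega>, of j] True \<omega>
            by (simp add: Suc R_def A.elapsed_def divide_ennreal_def mult.commute[of "inverse _"] mult_right_mono)
        qed simp
      qed
      also have "\<dots> = (\<Sum>i\<in>{j}. \<integral>\<^sup>+\<omega>. (if A.cyc i \<omega> = l then R i (A.elapsed i \<omega>) else 0) * A.W i \<omega> \<partial>M)"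
        by simp
      also have "\<dots> \<le> (\<Sum>i. \<integral>\<^sup>+\<omega>. (if A.cyc i \<omega> = l then R i (A.elapsed i \<omega>) else 0) * A.W i \<omega> \<partial>M)"
        by (rule sum_le_suminf) simp_all
      also have "\<dots> \<le> ennreal PR * 1 * ennreal n0"
      proof (rule bound)
        fix i e
        have step: "?r * (?r * inverse (?r ^ Suc e)) \<le> ?r * inverse (?r ^ e)"
          by (intro mult_left_mono ennreal_mult_inverse_power_Suc) simp
        show "?r * (R i e + h (Suc i) (Suc e)) \<le> h i e"
          using step by (auto simp: R_def h_def simp del: power_Suc)
        show "h i 0 \<le> ?r * 1" by (simp add: h_def)
        show "h 0 1 \<le> 1" using ennreal_mult_inverse_power_Suc[of "\<rho> l" 0] by (simp add: h_def)
      qed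
      also have "\<dots> = ennreal (PR * n0)" using PR_nonneg n0 by (simp add: ennreal_mult)
      finally show ?thesis .
    qed
    have after_entry: "(\<integral>\<^sup>+\<omega>\<in>{\<omega> \<in> space M. K l \<omega> + enat i < K (Suc l) \<omega>}.
              ennreal ((norm (x (the_enat (K l \<omega>) + i + 1) \<omega> - xstar))\<^sup>2) \<partial>M)
          \<le> ennreal (\<rho> l ^ i * PR * n0)" (is "?lhs i \<le> _") for i
    proof (cases "l = 0 \<and> i = 0")
      case True
      have "?lhs i \<le> (\<integral>\<^sup>+\<omega>. ennreal n0 \<partial>M)"
      proof (rule nn_integral_mono)
        fix \<omega> assume "\<omega> \<in> space M"
        moreover have "the_enat (K l \<omega>) + i + 1 = Suc 0" using True by (simp add: K zero_enat_def)
        ultimately show "ennreal ((norm (x (the_enat (K l \<omega>) + i + 1) \<omega> - xstar))\<^sup>2)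
            * indicator {\<omega> \<in> space M. K l \<omega> + enat i < K (Suc l) \<omega>} \<omega> \<le> ennreal n0"
          using x_0 by (simp add: indicator_def)
      qed
      then show ?thesis using True by (simp add: M.emeasure_space_1 PR_def)
    next
      case False
      \<comment> \<open>A payment of the plain error whenever the elapsed time is \<open>i\<close>, which happens at most once.\<close>
      define R where "R k e = (if e = i then 1 else 0 :: ennreal)" for k :: nat and e
      define h where "h k e = (if e \<le> i then ?r ^ (Suc i - e) else 0)" for k :: nat and e
      let ?t = "\<lambda>k \<omega>. (if A.cyc k \<omega> = l then R k (A.elapsed k \<omega>) else 0) * A.W k \<omega>"
      have "?lhs i \<le> (\<integral>\<^sup>+\<omega>. (\<Sum>k. ?t k \<omega>) \<partial>M)"
      proof (rule nn_integral_mono)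
        fix \<omega> assume \<omega>: "\<omega> \<in> space M"
        show "ennreal ((norm (x (the_enat (K l \<omega>) + i + 1) \<omega> - xstar))\<^sup>2)
            * indicator {\<omega> \<in> space M. K l \<omega> + enat i < K (Suc l) \<omega>} \<omega> \<le> (\<Sum>k. ?t k \<omega>)"
        proof (cases "K l \<omega> + enat i < K (Suc l) \<omega>")
          case True
          then obtain s where s: "K l \<omega> = enat s" by (cases "K l \<omega>") auto
          have "0 < s + i"
            using False K_pos[of l \<omega>] s by (cases "l = 0") (auto simp: zero_enat_def)
          then obtain j where j: "s + i = Suc j" by (metis gr0_implies_Suc)
          have "K l \<omega> \<le> enat (Suc j)" unfolding s j[symmetric] by simp
          moreover have "enat (Suc j) < K (Suc l) \<omega>" using True unfolding s j[symmetric] by simp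
          ultimately have cyc: "A.cyc j \<omega> = l" and "K l \<omega> = enat (A.start j \<omega>)"
            using in_cycle by blast+
          then have "A.elapsed j \<omega> = i" using s j unfolding A.elapsed_def by simp
          with cyc have "?t j \<omega> = A.W j \<omega>" by (simp add: R_def)
          then have "ennreal ((norm (x (the_enat (K l \<omega>) + i + 1) \<omega> - xstar))\<^sup>2) \<le> (\<Sum>k\<in>{j}. ?t k \<omega>)"
            using x_Suc[OF \<omega>, of j] j by (simp add: s)
          also have "\<dots> \<le> (\<Sum>k. ?t k \<omega>)" by (rule sum_le_suminf) simp_all
          finally show ?thesis using True \<omega> by simp
        qed simp
      qed
      also have "\<dots> = (\<Sum>k. \<integral>\<^sup>+\<omega>. ?t k \<omega> \<partial>M)"
        by (rule nn_integral_suminf) measurable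
      also have "\<dots> \<le> ennreal PR * ?r ^ i * ennreal n0"
      proof (rule bound)
        fix k e
        have "?r * ?r ^ (i - e) = ?r ^ (Suc i - e)" if "e \<le> i" using that by (simp add: Suc_diff_le)
        then show "?r * (R k e + h (Suc k) (Suc e)) \<le> h k e"
          by (auto simp: R_def h_def Suc_le_eq)
        show "h k 0 \<le> ?r * ?r ^ i" by (simp add: h_def)
        show "h 0 1 \<le> ?r ^ i" if "l = 0" using False that by (simp add: h_def)
      qed
      also have "\<dots> = ennreal (\<rho> l ^ i * PR * n0)"
        using PR_nonneg n0 \<rho>_nonneg[of l] by (simp add: ennreal_mult ennreal_power mult_ac)
      finally show ?thesis .
    qed
    show ?thesis
      using at_time after_entry unfolding PR_def n0_def \<rho>_def by blast
  qed
qed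

end
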